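(* Let $U^{tw}$ be an irreducible restricted module over the Lie superalgebra $\mathcal A^{tw}$ on which $C$ acts as $-3$, and let $F_{-1}^{T}$ be one of the two irreducible twisted $F_{-1}$-modules $F_{-1}^{T_1}, F_{-1}^{T_2}$. Then $U^{tw}\otimes F_{-1}^{T}$ has the structure of an irreducible $\widehat{sl_2}[\Theta]$-module at the critical level (i.e. $K$ acts as $-2$), the action being the one described in the context.
   Context: **The Lie superalgebra $\mathcal A^{tw}$.** It has basis $\mathcal S(n),\ \mathcal T(n+\tfrac12),\ \mathcal G(r),\ C$ ($n\in\mathbb Z$, $r\in\tfrac12\mathbb Z$), with $\mathcal S(n),\mathcal T(n+\frac12),C$ even and central, $\mathcal G(r)$ odd, and $$\{\mathcal G(r),\mathcal G(s)\}=(-1)^{2r+1}\Big(2\delta^{\mathbb Z}_{r+s}\mathcal S(r+s)-\delta^{\frac12+\mathbb Z}_{r+s}(r-s)\mathcal T(r+s)+\tfrac C3\,\delta^{\mathbb Z}_{r+s}(r^2-\tfrac14)\delta_{r+s,0}\Big),$$ where $\delta_m^X=1$ if $m\in X$ and $0$ otherwise. A module $U$ is restricted if for each $u\in U$ all of $\mathcal S(n)u,\mathcal T(n+\frac12)u,\mathcal G(r)u$ vanish for $n,r$ sufficiently large. Modules are not required to be $\mathbb Z_2$-graded; irreducible means no proper nonzero invariant subspace. Put $\mathcal G(z)=\sum_{r\in\frac12\mathbb Z}\mathcal G(r)z^{-r-3/2}$ and $\mathcal T(z)=\sum_{n\in\frac12+\mathbb Z}\mathcal T(n)z^{-n-1}$.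 **The twisted modules $F_{-1}^{T_i}$.** Let $\beta(k)$, $k\in\frac12+\mathbb Z$, generate the twisted Heisenberg algebra $[\beta(k),\beta(l)]=-k\,\delta_{k+l,0}$ (so $\langle\beta,\beta\rangle=-1$), and let $M_{\frac12+\mathbb Z}(1)=\mathbb C[\beta(-\frac12),\beta(-\frac32),\dots]$ be its Fock space. For $i=1,2$, $F_{-1}^{T_i}=M_{\frac12+\mathbb Z}(1)$ as a vector space, with $\beta(z)=\sum_{k\in\frac12+\mathbb Z}\beta(k)z^{-k-1}$ and $$Y_{tw}(e^{\beta},z)=-(2\sqrt{-1})(-1)^i z^{1/2}\exp\Big(\sum_{k\in\frac12+\mathbb Z_{\ge0}}\tfrac{\beta(-k)}{k}z^{k}\Big)\exp\Big(-\sum_{k\in\frac12+\mathbb Z_{\ge0}}\tfrac{\beta(k)}{k}z^{-k}\Big).$$ **The Lie algebra $\widehat{sl_2}[\Theta]$** (the affine Lie algebra $A_1^{(1)}$ in the principal gradation) has basis $K$ (central), $h(m)$, $x^-(m)$ ($m\in\frac12+\mathbb Z$), $x^+(r)$ ($r\in\mathbb Z$), with, for $m,n\in\frac12+\mathbb Z$, $r,s\in\mathbb Z$: $[h(m),h(n)]=2m\delta_{m+n,0}K$, $[h(m),x^+(r)]=2x^-(m+r)$, $[h(m),x^-(n)]=2x^+(m+n)$, $[x^+(r),x^+(s)]=2r\delta_{r+s,0}K$, $[x^+(r),x^-(m)]=-2h(m+r)$, $[x^-(m),x^-(n)]=-2m\delta_{m+n,0}K$. Put $X_+(z)=\frac12\big(\sum_{n\in\mathbb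 Z}x^+(n)z^{-n-1}+\sum_{n\in\frac12+\mathbb Z}x^-(n)z^{-n-1}\big)$ and $h(z)=\sum_{n\in\frac12+\mathbb Z}h(n)z^{-n-1}$. **Action on $U^{tw}\otimes F_{-1}^{T_i}$.** $K$ acts as $-2$, and $$X_+(z)=\tfrac1{\sqrt2}\,\mathcal G(z)\otimes Y_{tw}(e^{\beta},z),\qquad h(z)=-2\beta(z)+2\mathcal T(z),$$ where operators on the two factors are tensored without signs. *)

theory Defs
  imports Complex_Main "HOL-Library.Poly_Mapping"
begin

text \<open>
  Half-integer indices are encoded by integers: a family indexed by \<open>1/2 \<int>\<close> takes the doubled
  index (\<open>k\<close> stands for \<open>k/2\<close>), and a family indexed by \<open>1/2 + \<int>\<close> takes the integer part
  (\<open>m\<close> stands for \<open>m + 1/2\<close>).  For odd \<open>k\<close>, \<open>k/2 = (k div 2) + 1/2\<close>, also when \<open>k\<close> is negative.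

  A complex vector space is a type \<open>'v :: ab_group_add\<close> with a scalar multiplication
  \<open>s :: complex \<Rightarrow> 'v \<Rightarrow> 'v\<close> satisfying \<^locale>\<open>vector_space\<close>.
\<close>


section \<open>Modules over Lie superalgebras given by structure constants\<close>

text \<open>
  A Lie superalgebra is presented by a homogeneous basis \<open>'b\<close>, the set \<open>odd_b\<close> of its odd elements,
  and the bracket of basis elements as a finite linear combination of basis elements.  A module is
  given by the operators of the basis elements; \<open>lin_ext\<close> extends them to the whole algebra.
\<close>

definition lin_ext ::
  "(complex \<Rightarrow> 'v \<Rightarrow> 'v::ab_group_add) \<Rightarrow> ('b \<Rightarrow> 'v \<Rightarrow> 'v) \<Rightarrow> ('b \<Rightarrow>\<^sub>0 complex) \<Rightarrow> 'v \<Rightarrow> 'v" where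
  "lin_ext s \<rho> a v = (\<Sum>b\<in>Poly_Mapping.keys a. s (Poly_Mapping.lookup a b) (\<rho> b v))"

text \<open>No \<open>\<int>\<^sub>2\<close>-grading on the module is required.\<close>

definition lie_super_module ::
  "'b set \<Rightarrow> ('b \<Rightarrow> 'b \<Rightarrow> 'b \<Rightarrow>\<^sub>0 complex) \<Rightarrow> (complex \<Rightarrow> 'v \<Rightarrow> 'v::ab_group_add) \<Rightarrow>
    ('b \<Rightarrow> 'v \<Rightarrow> 'v) \<Rightarrow> bool" where
  "lie_super_module odd_b br s \<rho> \<longleftrightarrow>
     vector_space s \<and>
     (\<forall>a. Vector_Spaces.linear s s (\<rho> a)) \<and>
     (\<forall>a b v.
        (if a \<in> odd_b \<and> b \<in> odd_b
         then \<rho> a (\<rho> b v) + \<rho> b (\<rho> a v)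
         else \<rho> a (\<rho> b v) - \<rho> b (\<rho> a v))
        = lin_ext s \<rho> (br a b) v)"

abbreviation lie_module ::
  "('b \<Rightarrow> 'b \<Rightarrow> 'b \<Rightarrow>\<^sub>0 complex) \<Rightarrow> (complex \<Rightarrow> 'v \<Rightarrow> 'v::ab_group_add) \<Rightarrow> ('b \<Rightarrow> 'v \<Rightarrow> 'v) \<Rightarrow> bool"
  where "lie_module \<equiv> lie_super_module {}"

text \<open>As usual, an irreducible module is nonzero.\<close>

definition irreducible_action ::
  "(complex \<Rightarrow> 'v \<Rightarrow> 'v::ab_group_add) \<Rightarrow> ('b \<Rightarrow> 'v \<Rightarrow> 'v) \<Rightarrow> bool" where
  "irreducible_action s \<rho> \<longleftrightarrow>
     (\<exists>v::'v. v \<noteq> 0) \<and>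
     (\<forall>W. module.subspace s W \<and> (\<forall>a. \<forall>w\<in>W. \<rho> a w \<in> W) \<longrightarrow> W = {0} \<or> W = UNIV)"


section \<open>Tensor products with a space of finitely supported functions\<close>

definition pm_scale ::
  "(complex \<Rightarrow> 'v \<Rightarrow> 'v) \<Rightarrow> complex \<Rightarrow> ('k \<Rightarrow>\<^sub>0 'v::ab_group_add) \<Rightarrow> ('k \<Rightarrow>\<^sub>0 'v)" where
  "pm_scale s c w = Poly_Mapping.map (s c) w"

text \<open>
  For a complex vector space \<open>U\<close> with scalar multiplication \<open>s\<close>, the tensor product of \<open>U\<close> with the
  space \<open>'k \<Rightarrow>\<^sub>0 complex\<close> with basis \<open>'k\<close> is realised as \<open>'k \<Rightarrow>\<^sub>0 'u\<close>, with \<open>u \<otimes> f = (k \<mapsto> f(k) u)\<close>.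
  Lemma \<open>tens_universal\<close> below is its universal property.
\<close>

definition tens ::
  "(complex \<Rightarrow> 'u \<Rightarrow> 'u) \<Rightarrow> 'u::ab_group_add \<Rightarrow> ('k \<Rightarrow>\<^sub>0 complex) \<Rightarrow> ('k \<Rightarrow>\<^sub>0 'u)" where
  "tens s u f = Poly_Mapping.map (\<lambda>c. s c u) f"

text \<open>\<open>A \<otimes> B\<close>, without signs; it is characterised by lemmas \<open>tensor_op_linear\<close> and \<open>tensor_op_tens\<close>.\<close>

definition tensor_op ::
  "(complex \<Rightarrow> 'u \<Rightarrow> 'u) \<Rightarrow> ('u \<Rightarrow> 'u) \<Rightarrow> (('k \<Rightarrow>\<^sub>0 complex) \<Rightarrow> ('k \<Rightarrow>\<^sub>0 complex)) \<Rightarrow>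
    ('k \<Rightarrow>\<^sub>0 'u::ab_group_add) \<Rightarrow> ('k \<Rightarrow>\<^sub>0 'u)" where
  "tensor_op s A B w =
     (\<Sum>k\<in>Poly_Mapping.keys w. tens s (A (Poly_Mapping.lookup w k)) (B (Poly_Mapping.single k 1)))"

lemma vector_space_complex_mult: "vector_space ((*) :: complex \<Rightarrow> complex \<Rightarrow> complex)"
  by unfold_locales (auto simp: algebra_simps)

context
  fixes s :: "complex \<Rightarrow> 'u \<Rightarrow> 'u::ab_group_add"
  assumes s: "vector_space s"
begin

interpretation U: vector_space s by (rule s)

lemma lookup_pm_scale: "Poly_Mapping.lookup (pm_scale s c w) k = s c (Poly_Mapping.lookup w k)"
  by (simp add: pm_scale_def Poly_Mapping.map.rep_eq when_def)

lemma vector_space_pm_scale: "vector_space (pm_scale s :: complex \<Rightarrow> ('k \<Rightarrow>\<^sub>0 'u) \<Rightarrow> _)"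
  by unfold_locales
     (auto intro!: poly_mapping_eqI
       simp: lookup_pm_scale lookup_add U.scale_right_distrib U.scale_left_distrib)

lemma lookup_tens: "Poly_Mapping.lookup (tens s u f) k = s (Poly_Mapping.lookup f k) u"
  by (simp add: tens_def Poly_Mapping.map.rep_eq when_def)

lemma tens_bilinear:
  "tens s (u + u') f = tens s u f + tens s u' f"
  "tens s u (f + f') = tens s u f + tens s u f'"
  "tens s (s c u) f = pm_scale s c (tens s u f)"
  "tens s u (pm_scale (*) c f) = pm_scale s c (tens s u f)"
  by (rule poly_mapping_eqI;
      simp add: lookup_tens lookup_add lookup_pm_scale U.scale_right_distrib U.scale_left_distrib
        pm_scale_def[of "(*)"] Poly_Mapping.map.rep_eq when_def mult.commute)+

lemma tens_single: "tens s u (Poly_Mapping.single k c) = Poly_Mapping.single k (s c u)"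
  by (rule poly_mapping_eqI) (simp add: lookup_tens lookup_single when_def)


lemma sum_single_keys: "(\<Sum>k\<in>Poly_Mapping.keys w. Poly_Mapping.single k (Poly_Mapping.lookup w k)) = w"
  for w :: "'k \<Rightarrow>\<^sub>0 'v::ab_group_add"
  by (rule poly_mapping_eqI)
     (simp add: lookup_sum lookup_single when_def in_keys_iff)

lemma sum_keys_superset:
  fixes w :: "'k \<Rightarrow>\<^sub>0 'v::ab_group_add" and F :: "'k \<Rightarrow> 'v \<Rightarrow> 'w::ab_group_add"
  assumes "finite K" "Poly_Mapping.keys w \<subseteq> K" "\<And>k. F k 0 = 0"
  shows "(\<Sum>k\<in>Poly_Mapping.keys w. F k (Poly_Mapping.lookup w k)) = (\<Sum>k\<in>K. F k (Poly_Mapping.lookup w k))"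
  by (rule sum.mono_neutral_left) (use assms in \<open>auto simp: in_keys_iff\<close>)

context
  fixes t :: "complex \<Rightarrow> 'w \<Rightarrow> 'w::ab_group_add" and b :: "'u \<Rightarrow> ('k \<Rightarrow>\<^sub>0 complex) \<Rightarrow> 'w"
  assumes t: "vector_space t"
    and b1: "\<And>f. Vector_Spaces.linear s t (\<lambda>u. b u f)"
    and b2: "\<And>u. Vector_Spaces.linear (pm_scale (*)) t (b u)"
begin

definition tens_lift where
  "tens_lift w = (\<Sum>k\<in>Poly_Mapping.keys w. b (Poly_Mapping.lookup w k) (Poly_Mapping.single k 1))"

interpretation W: vector_space t by (rule t)
interpretation P: vector_space "pm_scale s :: complex \<Rightarrow> ('k \<Rightarrow>\<^sub>0 'u) \<Rightarrow> _" by (rule vector_space_pm_scale)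
interpretation b1: Vector_Spaces.linear s t "\<lambda>u. b u f" for f by (rule b1)
interpretation b2: Vector_Spaces.linear "pm_scale (*)" t "b u" for u by (rule b2)

lemma tens_lift_superset:
  assumes "finite K" "Poly_Mapping.keys w \<subseteq> K"
  shows "tens_lift w = (\<Sum>k\<in>K. b (Poly_Mapping.lookup w k) (Poly_Mapping.single k 1))"
  unfolding tens_lift_def
  by (rule sum_keys_superset[where F = "\<lambda>k u. b u (Poly_Mapping.single k 1)"])
     (use assms b1.zero in auto)

lemma tens_lift_linear: "Vector_Spaces.linear (pm_scale s) t tens_lift"
proof -
  have "tens_lift (v + w) = tens_lift v + tens_lift w" for v w
  proof -
    let ?K = "Poly_Mapping.keys v \<union> Poly_Mapping.keys w"
    have "finite ?K" by simp
    moreover have "Poly_Mapping.keys (v + w) \<subseteq> ?K" by (rule Poly_Mapping.keys_add)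
    ultimately show ?thesis
      by (simp add: tens_lift_superset[of ?K] lookup_add b1.add sum.distrib)
  qed
  moreover have "tens_lift (pm_scale s c w) = t c (tens_lift w)" for c w
  proof -
    have "Poly_Mapping.keys (pm_scale s c w) \<subseteq> Poly_Mapping.keys w"
      by (auto simp: in_keys_iff lookup_pm_scale)
    then show ?thesis
      by (simp add: tens_lift_superset[of "Poly_Mapping.keys w"] lookup_pm_scale b1.scale W.scale_sum_right)
  qed
  ultimately show ?thesis by unfold_locales auto
qed

lemma tens_lift_tens: "tens_lift (tens s u f) = b u f"
proof -
  have "Poly_Mapping.keys (tens s u f) \<subseteq> Poly_Mapping.keys f"
    by (auto simp: in_keys_iff lookup_tens)
  then have "tens_lift (tens s u f) =
      (\<Sum>k\<in>Poly_Mapping.keys f. b u (pm_scale (*) (Poly_Mapping.lookup f k) (Poly_Mapping.single k 1)))"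
    by (simp add: tens_lift_superset[of "Poly_Mapping.keys f"] lookup_tens b1.scale b2.scale)
  also have "\<dots> = b u (\<Sum>k\<in>Poly_Mapping.keys f. Poly_Mapping.single k (Poly_Mapping.lookup f k))"
    by (simp add: b2.sum pm_scale_def)
  finally show ?thesis by (simp only: sum_single_keys)
qed

lemma tens_universal:
  "\<exists>!M. Vector_Spaces.linear (pm_scale s) t M \<and> (\<forall>u f. M (tens s u f) = b u f)"
proof (rule ex1I[of _ tens_lift])
  show "Vector_Spaces.linear (pm_scale s) t tens_lift \<and> (\<forall>u f. tens_lift (tens s u f) = b u f)"
    by (simp add: tens_lift_linear tens_lift_tens)
next
  fix M assume M: "Vector_Spaces.linear (pm_scale s) t M \<and> (\<forall>u f. M (tens s u f) = b u f)"
  then interpret M: Vector_Spaces.linear "pm_scale s" t M by blast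
  show "M = tens_lift"
  proof
    fix w
    have "M w = M (\<Sum>k\<in>Poly_Mapping.keys w. tens s (Poly_Mapping.lookup w k) (Poly_Mapping.single k 1))"
      by (simp add: tens_single sum_single_keys)
    also have "\<dots> = tens_lift w"
      using M by (simp add: M.sum tens_lift_def)
    finally show "M w = tens_lift w" .
  qed
qed

end

context
  fixes A :: "'u \<Rightarrow> 'u" and B :: "('k \<Rightarrow>\<^sub>0 complex) \<Rightarrow> ('k \<Rightarrow>\<^sub>0 complex)"
  assumes A: "Vector_Spaces.linear s s A"
    and B: "Vector_Spaces.linear (pm_scale (*)) (pm_scale (*)) B"
begin

interpretation A: Vector_Spaces.linear s s A by (rule A)
interpretation B: Vector_Spaces.linear "pm_scale (*)" "pm_scale (*)" B by (rule B)
interpretation P: vector_space "pm_scale s :: complex \<Rightarrow> ('k \<Rightarrow>\<^sub>0 'u) \<Rightarrow> _" by (rule vector_space_pm_scale)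

private lemma tensor_op_bilinear:
  "Vector_Spaces.linear s (pm_scale s) (\<lambda>u. tens s (A u) (B f))"
  "Vector_Spaces.linear (pm_scale (*)) (pm_scale s) (\<lambda>f. tens s (A u) (B f))"
  by (unfold_locales; simp add: A.add A.scale B.add B.scale tens_bilinear)+

private lemma tensor_op_eq: "tens_lift (\<lambda>u f. tens s (A u) (B f)) = tensor_op s A B"
  by (rule ext) (simp add: tens_lift_def[OF vector_space_pm_scale tensor_op_bilinear] tensor_op_def)

lemma tensor_op_linear: "Vector_Spaces.linear (pm_scale s) (pm_scale s) (tensor_op s A B)"
  using tens_lift_linear[OF vector_space_pm_scale tensor_op_bilinear] by (simp only: tensor_op_eq)

lemma tensor_op_tens: "tensor_op s A B (tens s u f) = tens s (A u) (B f)"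
  using tens_lift_tens[OF vector_space_pm_scale tensor_op_bilinear] by (simp only: tensor_op_eq)

end

end


section \<open>Operator-valued formal distributions in \<open>z\<^sup>1\<^sup>/\<^sup>2\<close>\<close>

text \<open>
  \<open>A :: 'v fdist\<close> stands for \<open>\<Sum>k\<in>\<int>. A k z\<^bsup>k/2\<^esup>\<close>.  The sums defining the coefficients of products and
  exponentials are taken vectorwise, and \<^const>\<open>Sum_any\<close> sums over the nonzero terms.  In all uses
  below these are finitely many for each vector: each of the two exponents involves only positive or
  only negative powers of \<open>z\<close>; the exponential of annihilation operators, applied to a vector, is a
  polynomial in \<open>z\<^bsup>-1/2\<^esup>\<close>; and on each vector of a restricted module \<open>\<G>(z)\<close>, as well as
  \<open>Y\<^sub>t\<^sub>w(e\<^sup>\<beta>, z)\<close>, has only finitely many negative powers of \<open>z\<close>.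
\<close>

type_synonym 'v fdist = "int \<Rightarrow> 'v \<Rightarrow> 'v"

definition fd_one :: "'v::ab_group_add fdist" where
  "fd_one k v = (if k = 0 then v else 0)"

definition fd_mult :: "'v::ab_group_add fdist \<Rightarrow> 'v fdist \<Rightarrow> 'v fdist" where
  "fd_mult A B k v = Sum_any (\<lambda>l. A l (B (k - l) v))"

fun fd_power :: "'v::ab_group_add fdist \<Rightarrow> nat \<Rightarrow> 'v fdist" where
  "fd_power A 0 = fd_one"
| "fd_power A (Suc n) = fd_mult A (fd_power A n)"

definition fd_exp :: "(complex \<Rightarrow> 'v \<Rightarrow> 'v) \<Rightarrow> 'v::ab_group_add fdist \<Rightarrow> 'v fdist" where
  "fd_exp s A k v = Sum_any (\<lambda>n. s (1 / fact n) (fd_power A n k v))"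

definition fd_tensor ::
  "(complex \<Rightarrow> 'u \<Rightarrow> 'u) \<Rightarrow> 'u::ab_group_add fdist \<Rightarrow> ('k \<Rightarrow>\<^sub>0 complex) fdist \<Rightarrow> ('k \<Rightarrow>\<^sub>0 'u) fdist" where
  "fd_tensor s A B k w = Sum_any (\<lambda>l. tensor_op s (A l) (B (k - l)) w)"


section \<open>The Lie superalgebra \<open>\<A>\<^sup>t\<^sup>w\<close>\<close>

text \<open>
  \<open>tw_S n\<close>, \<open>tw_T n\<close>, \<open>tw_G k\<close>, \<open>tw_C\<close> stand for \<open>\<S>(n)\<close>, \<open>\<T>(n + 1/2)\<close>, \<open>\<G>(k/2)\<close>, \<open>C\<close>.
\<close>

datatype atw = tw_S int | tw_T int | tw_G int | tw_C

definition atw_odd :: "atw set" where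
  "atw_odd = range tw_G"

fun atw_bracket :: "atw \<Rightarrow> atw \<Rightarrow> atw \<Rightarrow>\<^sub>0 complex" where
  "atw_bracket (tw_G k) (tw_G l) =
     pm_scale (*) ((-1) powi (k + 1))
       ((if even (k + l) then Poly_Mapping.single (tw_S ((k + l) div 2)) 2 else 0)
        - (if odd (k + l)
           then Poly_Mapping.single (tw_T ((k + l) div 2)) (of_int k / 2 - of_int l / 2) else 0)
        + (if k + l = 0 then Poly_Mapping.single tw_C (((of_int k / 2)\<^sup>2 - 1 / 4) / 3) else 0))"
| "atw_bracket _ _ = 0"

definition atw_restricted :: "(atw \<Rightarrow> 'u \<Rightarrow> 'u::ab_group_add) \<Rightarrow> bool" where
  "atw_restricted \<rho> \<longleftrightarrow>
     (\<forall>u. \<exists>N. \<forall>n\<ge>N. \<rho> (tw_S n) u = 0 \<and> \<rho> (tw_T n) u = 0 \<and> \<rho> (tw_G n) u = 0)"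

text \<open>\<open>\<G>(z) = \<Sum>r. \<G>(r) z\<^bsup>-r-3/2\<^esup>\<close>: the coefficient of \<open>z\<^bsup>k/2\<^esup>\<close> has \<open>2r = -k - 3\<close>.\<close>

definition G_dist :: "(atw \<Rightarrow> 'u \<Rightarrow> 'u) \<Rightarrow> 'u fdist" where
  "G_dist \<rho> k = \<rho> (tw_G (- k - 3))"


section \<open>The twisted modules \<open>F\<^sub>-\<^sub>1\<^sup>T\<close>\<close>

text \<open>
  The polynomial algebra \<open>\<complex>[\<beta>(-1/2), \<beta>(-3/2), \<dots>]\<close>: monomials are exponent vectors, and the variable
  with index \<open>j\<close> is \<open>\<beta>(-(j + 1/2))\<close>.
\<close>

type_synonym fock = "(nat \<Rightarrow>\<^sub>0 nat) \<Rightarrow>\<^sub>0 complex"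

definition fock_var :: "nat \<Rightarrow> fock" where
  "fock_var j = Poly_Mapping.single (Poly_Mapping.single j 1) 1"

definition fock_deriv :: "nat \<Rightarrow> fock \<Rightarrow> fock" where
  "fock_deriv j f =
     (\<Sum>m\<in>Poly_Mapping.keys f.
        Poly_Mapping.single (m - Poly_Mapping.single j 1)
          (of_nat (Poly_Mapping.lookup m j) * Poly_Mapping.lookup f m))"

text \<open>
  \<open>beta m\<close> is \<open>\<beta>(m + 1/2)\<close>: negative modes multiply, and \<open>\<beta>(k)\<close> acts as \<open>-k \<partial>/\<partial>\<beta>(-k)\<close> for \<open>k > 0\<close>,
  since \<open>[\<beta>(k), \<beta>(-k)] = -k\<close>.
\<close>

definition beta :: "int \<Rightarrow> fock \<Rightarrow> fock" where
  "beta m f =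
     (if m < 0 then fock_var (nat (- m - 1)) * f
      else pm_scale (*) (- (of_int m + 1 / 2)) (fock_deriv (nat m) f))"

text \<open>
  The exponents \<open>\<Sum>k. \<beta>(-k)/k z\<^sup>k\<close> and \<open>-\<Sum>k. \<beta>(k)/k z\<^bsup>-k\<^esup>\<close> over \<open>k \<in> 1/2 + \<int>\<^bsub>\<ge>0\<^esub>\<close>; the coefficient of
  \<open>z\<^bsup>l/2\<^esup>\<close> has \<open>k = l/2\<close>, respectively \<open>k = -l/2\<close>.
\<close>

definition exponent_creation :: "fock fdist" where
  "exponent_creation l f =
     (if odd l \<and> l > 0 then pm_scale (*) (1 / (of_int l / 2)) (beta ((- l) div 2) f) else 0)"

definition exponent_annihilation :: "fock fdist" where
  "exponent_annihilation l f =
     (if odd l \<and> l < 0 then pm_scale (*) (- (1 / (of_int (- l) / 2))) (beta ((- l) div 2) f) else 0)"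

text \<open>\<open>Y\<^sub>t\<^sub>w(e\<^sup>\<beta>, z)\<close> on \<open>F\<^sub>-\<^sub>1\<close> twisted by \<open>T\<^sub>i\<close>; the factor \<open>z\<^sup>1\<^sup>/\<^sup>2\<close> shifts the index by one.\<close>

definition Y_tw :: "nat \<Rightarrow> fock fdist" where
  "Y_tw i l f =
     pm_scale (*) (- (2 * \<i>) * (-1) ^ i)
       (fd_mult (fd_exp (pm_scale (*)) exponent_creation)
          (fd_exp (pm_scale (*)) exponent_annihilation) (l - 1) f)"


section \<open>The affine Lie algebra \<open>sl\<^sub>2[\<Theta>]\<close>\<close>

text \<open>
  \<open>sl_h m\<close>, \<open>sl_xm m\<close>, \<open>sl_xp r\<close>, \<open>sl_K\<close> stand for \<open>h(m + 1/2)\<close>, \<open>x\<^sup>-(m + 1/2)\<close>, \<open>x\<^sup>+(r)\<close>, \<open>K\<close>.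
\<close>

datatype sl2t = sl_h int | sl_xm int | sl_xp int | sl_K

fun sl2t_bracket :: "sl2t \<Rightarrow> sl2t \<Rightarrow> sl2t \<Rightarrow>\<^sub>0 complex" where
  "sl2t_bracket (sl_h m) (sl_h n) =
     (if m + n + 1 = 0 then Poly_Mapping.single sl_K (2 * (of_int m + 1 / 2)) else 0)"
| "sl2t_bracket (sl_h m) (sl_xp r) = Poly_Mapping.single (sl_xm (m + r)) 2"
| "sl2t_bracket (sl_xp r) (sl_h m) = Poly_Mapping.single (sl_xm (m + r)) (-2)"
| "sl2t_bracket (sl_h m) (sl_xm n) = Poly_Mapping.single (sl_xp (m + n + 1)) 2"
| "sl2t_bracket (sl_xm n) (sl_h m) = Poly_Mapping.single (sl_xp (m + n + 1)) (-2)"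
| "sl2t_bracket (sl_xp r) (sl_xp t) =
     (if r + t = 0 then Poly_Mapping.single sl_K (2 * of_int r) else 0)"
| "sl2t_bracket (sl_xp r) (sl_xm m) = Poly_Mapping.single (sl_h (m + r)) (-2)"
| "sl2t_bracket (sl_xm m) (sl_xp r) = Poly_Mapping.single (sl_h (m + r)) 2"
| "sl2t_bracket (sl_xm m) (sl_xm n) =
     (if m + n + 1 = 0 then Poly_Mapping.single sl_K (- 2 * (of_int m + 1 / 2)) else 0)"
| "sl2t_bracket sl_K _ = 0"
| "sl2t_bracket _ sl_K = 0"


section \<open>The action on \<open>U\<^sup>t\<^sup>w \<otimes> F\<^sub>-\<^sub>1\<^sup>T\<close>\<close>

definition X_plus ::
  "(complex \<Rightarrow> 'u \<Rightarrow> 'u) \<Rightarrow> (atw \<Rightarrow> 'u \<Rightarrow> 'u) \<Rightarrow> nat \<Rightarrow> ((nat \<Rightarrow>\<^sub>0 nat) \<Rightarrow>\<^sub>0 'u::ab_group_add) fdist" where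
  "X_plus s \<rho> i k w =
     pm_scale s (1 / complex_of_real (sqrt 2)) (fd_tensor s (G_dist \<rho>) (Y_tw i) k w)"

text \<open>
  \<open>x\<^sup>+(n)\<close> and \<open>x\<^sup>-(n + 1/2)\<close> are twice the coefficients of \<open>z\<^bsup>-n-1\<^esup>\<close> and \<open>z\<^bsup>-n-3/2\<^esup>\<close> in \<open>X\<^sub>+(z)\<close>;
  \<open>h(m + 1/2) = -2 \<beta>(m + 1/2) + 2 \<T>(m + 1/2)\<close>.
\<close>

fun sl2t_action ::
  "(complex \<Rightarrow> 'u \<Rightarrow> 'u) \<Rightarrow> (atw \<Rightarrow> 'u \<Rightarrow> 'u) \<Rightarrow> nat \<Rightarrow> sl2t \<Rightarrow>
    ((nat \<Rightarrow>\<^sub>0 nat) \<Rightarrow>\<^sub>0 'u::ab_group_add) \<Rightarrow> ((nat \<Rightarrow>\<^sub>0 nat) \<Rightarrow>\<^sub>0 'u)" where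
  "sl2t_action s \<rho> i sl_K w = pm_scale s (-2) w"
| "sl2t_action s \<rho> i (sl_xp n) w = pm_scale s 2 (X_plus s \<rho> i (2 * (- n - 1)) w)"
| "sl2t_action s \<rho> i (sl_xm n) w = pm_scale s 2 (X_plus s \<rho> i (2 * (- n - 1) - 1) w)"
| "sl2t_action s \<rho> i (sl_h m) w =
     pm_scale s (-2) (tensor_op s id (beta m) w) + pm_scale s 2 (tensor_op s (\<rho> (tw_T m)) id w)"

end

theory Submission
  imports Defs "HOL-Analysis.Continuum_Not_Denumerable"
    "HOL-Computational_Algebra.Fundamental_Theorem_Algebra"
begin

text \<open>
  Write \<open>a = z\<^sup>1\<^sup>/\<^sup>2\<close> and \<open>b = w\<^sup>1\<^sup>/\<^sup>2\<close>.  Normal ordering gives \<open>Y(a) Y(b) = (a + b)/(a - b) N(a,b)\<close> for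
  \<open>|a| > |b|\<close>, with \<open>N\<close> symmetric.  Hence the commutator of \<open>\<G>(a) \<otimes> Y(a)\<close> and \<open>\<G>(b) \<otimes> Y(b)\<close> is
  \<open>N(a,b)\<close> tensored with the antisymmetrisation of \<open>(a + b)/(a - b) \<G>(a) \<G>(b)\<close>, and coefficientwise the
  latter is a finite sum of anticommutators of the \<open>\<G>(r)\<close>.  In this sum the \<open>\<S>\<close>-terms cancel, and the
  remaining terms are supported at \<open>a = -b\<close>.  There \<open>N(-a,a) = 4 a\<^sup>2\<close>, which produces \<open>\<T>\<close> and the level,
  while the first derivative of \<open>N\<close> produces \<open>\<beta>\<close>.  As the Fock space is irreducible, identities
  between operators on it only need to be checked on commutators with the \<open>\<beta>(m)\<close> and on vacuum
  expectation values; this avoids computing with the exponentials.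

  For irreducibility, \<open>U\<close> has countable dimension, so by Schur's lemma each \<open>\<T>(m)\<close> is a scalar, and a
  submodule \<open>W\<close> is stable under the operators \<open>\<beta>(m)\<close>.  Therefore \<open>W = U' \<otimes> F\<close>, and the vacuum component
  of \<open>X\<^sub>+(z) (u \<otimes> 1)\<close> shows that \<open>U'\<close> is stable under the \<open>\<G>(r)\<close>.
\<close>

text \<open>The factor (a + b)/(a - b) is the cost of moving the annihilation exponential at a past
  the creation exponential at b: as [beta(k), beta(-k)] = -k, it equals exp(2 sum (b/a)^m / m) over
  odd m > 0. Its antisymmetry as a rational function is what trades a commutator of the X's for
  anticommutators of the G's. The S-terms cancel because (-1)^(2r+1) alternates along a line of
  constant r + s, and the factor couples neighbouring points of that line. The value C = -3 gives
  the derivative of N the coefficient for which its beta and the T combine to exactly one mode of h.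
  The technical obstacle is convergence: \<open>Sum_any\<close> is 0 on infinite support, so each
  exchange of summations needs joint finiteness, obtained from restrictedness and from lower bounds
  on the indices of \<open>Y\<close> and N on a given vector. In Schur's lemma, a non-scalar central
  t would make all vectors (t - c)^(-1) u exist and be independent, uncountably many of
  them.\<close>

no_notation suminf (binder "\<Sum>" 10)

section \<open>Sums with finite support\<close>

lemma Sum_any_additive:
  assumes "finite {a. g a \<noteq> 0}" "h 0 = 0" "\<And>x y. h (x + y) = h x + h y"
  shows "h (Sum_any g) = (\<Sum>a. h (g a))"
proof -
  have *: "h (sum g A) = (\<Sum>a\<in>A. h (g a))" if "finite A" for A
    using that by (induction A rule: finite_induct) (auto simp: assms)
  have "{a. h (g a) \<noteq> 0} \<subseteq> {a. g a \<noteq> 0}" using assms(2) by auto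
  then have "(\<Sum>a. h (g a)) = (\<Sum>a\<in>{a. g a \<noteq> 0}. h (g a))"
    by (rule Sum_any.expand_superset[OF assms(1)])
  then show ?thesis by (simp add: * assms(1) Sum_any.expand_set)
qed

lemma Sum_any_diff:
  fixes f g :: "'a \<Rightarrow> 'b::ab_group_add"
  assumes "finite {a. f a \<noteq> 0}" "finite {a. g a \<noteq> 0}"
  shows "(\<Sum>a. f a - g a) = Sum_any f - Sum_any g"
proof -
  have "(\<Sum>a. f a + - g a) = Sum_any f + (\<Sum>a. - g a)"
    using assms by (intro Sum_any.distrib) auto
  also have "(\<Sum>a. - g a) = - Sum_any g"
    using Sum_any_additive[of g uminus] assms by auto
  finally show ?thesis by simp
qed

lemma Sum_any_shift:
  fixes g :: "int \<Rightarrow> 'b::comm_monoid_add"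
  shows "(\<Sum>n. g (n + c)) = Sum_any g"
proof -
  have "bij (\<lambda>n. n + c)" by (rule bijI') (auto intro: exI[of _ "_ - c"])
  then show ?thesis by (intro Sum_any.reindex_cong[symmetric]) auto
qed

lemma finite_support_int:
  fixes g :: "int \<Rightarrow> 'b::zero"
  assumes "\<And>n. n < a \<Longrightarrow> g n = 0" "\<And>n. b < n \<Longrightarrow> g n = 0"
  shows "finite {n. g n \<noteq> 0}"
  by (rule finite_subset[of _ "{a..b}"]) (use assms in \<open>force simp: not_less[symmetric]\<close>, simp)

lemma Sum_any_eq_0: "(\<And>a. g a = 0) \<Longrightarrow> Sum_any g = 0"
  by simp

text \<open>The weights are the coefficients 1, 2, 2, ... of (1 + x)/(1 - x). Doubling is written
  \<open>x + x\<close> since they act on numbers, Fock vectors, elements of U and tensors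
  alike.\<close>

definition wt :: "int \<Rightarrow> 'v \<Rightarrow> 'v::ab_group_add" where
  "wt n x = (if n < 0 then 0 else if n = 0 then x else x + x)"

text \<open>The coefficientwise form of \<open>(a + b)/(a - b)\<close>, expanded as \<open>1 + 2 \<Sum>\<^bsub>n > 0\<^esub> (b/a)\<^sup>n\<close>.\<close>

definition hsum :: "(int \<Rightarrow> 'v) \<Rightarrow> 'v::ab_group_add" where
  "hsum g = (\<Sum>n. wt n (g n))"

lemma wt_0 [simp]: "wt n 0 = 0"
  and wt_add: "wt n (x + y) = wt n x + wt n y"
  by (auto simp: wt_def)

lemma wt_additive: "h 0 = 0 \<Longrightarrow> (\<And>x y. h (x + y) = h x + h y) \<Longrightarrow> h (wt n x) = wt n (h x)"
  by (auto simp: wt_def)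

lemma wt_finite:
  assumes "\<And>n. M \<le> n \<Longrightarrow> g n = 0"
  shows "finite {n. wt n (g n) \<noteq> 0}"
  by (rule finite_support_int[of 0 _ M]) (auto simp: wt_def assms)

text \<open>This is (1 - x)(1 + 2x + 2x^2 + ...) = 1 + x coefficientwise: consecutive weights differ
  only at n = 0 and n = 1, by one each. It yields the recursions for \<open>N\<close> and
  \<open>A\<close>.\<close>

lemma hsum_shift:
  assumes "\<And>n. M \<le> n \<Longrightarrow> g n = 0"
  shows "hsum g = hsum (\<lambda>n. g (n + 1)) + g 0 + g 1"
proof -
  have fin: "finite {n. wt (n - 1) (g n) \<noteq> 0}"
    by (rule finite_support_int[of 0 _ M]) (auto simp: wt_def assms)
  have "hsum (\<lambda>n. g (n + 1)) = (\<Sum>n. wt (n - 1) (g n))"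
    using Sum_any_shift[of "\<lambda>n. wt (n - 1) (g n)" 1] by (simp add: hsum_def)
  then have "hsum g - hsum (\<lambda>n. g (n + 1)) = (\<Sum>n. wt n (g n) - wt (n - 1) (g n))"
    using Sum_any_diff[OF wt_finite[OF assms] fin] by (simp add: hsum_def)
  also have "\<dots> = (\<Sum>n\<in>{0,1}. wt n (g n) - wt (n - 1) (g n))"
    by (rule Sum_any.expand_superset) (auto simp: wt_def)
  finally show ?thesis by (simp add: wt_def algebra_simps)
qed

lemma hsum_additive:
  assumes "\<And>n. M \<le> n \<Longrightarrow> g n = 0" "h 0 = 0" "\<And>x y. h (x + y) = h x + h y"
  shows "h (hsum g) = hsum (\<lambda>n. h (g n))"
  unfolding hsum_def
  by (subst Sum_any_additive[OF wt_finite[OF assms(1)]]) (auto simp: assms wt_additive[of h])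

lemma hsum_add:
  assumes "\<And>n. M \<le> n \<Longrightarrow> f n = 0" "\<And>n. M' \<le> n \<Longrightarrow> g n = 0"
  shows "hsum (\<lambda>n. f n + g n) = hsum f + hsum g"
  unfolding hsum_def wt_add by (rule Sum_any.distrib) (rule wt_finite, fact)+

lemma hsum_eq_0: "(\<And>n. n \<ge> 0 \<Longrightarrow> g n = 0) \<Longrightarrow> hsum g = 0"
  unfolding hsum_def by (rule Sum_any_eq_0) (auto simp: wt_def)

section \<open>Linear maps and finitely supported sums\<close>

lemma linearD:
  assumes "Vector_Spaces.linear s t h"
  shows "h 0 = 0" "h (x + y) = h x + h y" "h (x - y) = h x - h y" "h (- x) = - h x"
    "h (s c x) = t c (h x)"
proof -
  interpret Vector_Spaces.linear s t h by (rule assms)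
  show "h 0 = 0" "h (x + y) = h x + h y" "h (x - y) = h x - h y" "h (- x) = - h x"
    "h (s c x) = t c (h x)" by (simp_all add: add diff neg scale)
qed

lemma linearI:
  assumes "vector_space s" "vector_space t"
    "\<And>x y. h (x + y) = h x + h y" "\<And>c x. h (s c x) = t c (h x)"
  shows "Vector_Spaces.linear s t h"
  using assms by (simp add: Vector_Spaces.linear_iff)

lemma Sum_any_linear:
  assumes "Vector_Spaces.linear s t h" "finite {a. g a \<noteq> 0}"
  shows "h (Sum_any g) = (\<Sum>a. h (g a))"
  by (rule Sum_any_additive) (use assms linearD[OF assms(1)] in auto)

lemma linear_Sum_any:
  assumes "vector_space s" "vector_space t" "\<And>a. Vector_Spaces.linear s t (A a)"
    "\<And>v. finite {a. A a v \<noteq> 0}"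
  shows "Vector_Spaces.linear s t (\<lambda>v. \<Sum>a. A a v)"
proof (rule linearI[OF assms(1,2)])
  interpret t: vector_space t by fact
  have ts: "Vector_Spaces.linear t t (t c)" for c
    by (rule linearI) (auto simp: assms t.scale_right_distrib)
  show "(\<Sum>a. A a (x + y)) = (\<Sum>a. A a x) + (\<Sum>a. A a y)" for x y
    by (simp add: linearD(2)[OF assms(3)] Sum_any.distrib assms)
  show "(\<Sum>a. A a (s c x)) = t c (\<Sum>a. A a x)" for c x
    by (simp add: linearD(5)[OF assms(3)] Sum_any_linear[OF ts] assms)
qed

lemma linear_comp:
  "Vector_Spaces.linear s t f \<Longrightarrow> Vector_Spaces.linear t r g \<Longrightarrow> Vector_Spaces.linear s r (\<lambda>x. g (f x))"
  using Vector_Spaces.linear_compose[of s t f r g] by (simp add: o_def)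

lemma linear_scaled:
  assumes "Vector_Spaces.linear s t f" shows "Vector_Spaces.linear s t (\<lambda>x. t c (f x))"
proof -
  interpret Vector_Spaces.linear s t f by fact
  show ?thesis by (rule linearI) (auto simp: linearD[OF assms] vs1.vector_space_axioms vs2.vector_space_axioms
        vs2.scale_right_distrib vs2.scale_left_commute)
qed

lemma linear_plus:
  assumes "Vector_Spaces.linear s t f" "Vector_Spaces.linear s t g"
  shows "Vector_Spaces.linear s t (\<lambda>x. f x + g x)"
proof -
  interpret Vector_Spaces.linear s t f by fact
  show ?thesis by (rule linearI) (auto simp: linearD[OF assms(1)] linearD[OF assms(2)] vs1.vector_space_axioms vs2.vector_space_axioms
        vs2.scale_right_distrib)
qed

section \<open>Exponentials of formal distributions\<close>

text \<open>The sign \<open>\<sigma>\<close> lets one development serve both the creation and the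
  annihilation exponent. The coefficient at 0 vanishes too, so the n-th power starts in degree n and
  each coefficient of the exponential is a finite sum.\<close>

locale one_sided_dist =
  fixes s :: "complex \<Rightarrow> 'v \<Rightarrow> 'v::ab_group_add" and A :: "'v fdist" and \<sigma> :: int
  assumes vs: "vector_space s"
    and A_linear: "\<And>l. Vector_Spaces.linear s s (A l)"
    and sigma: "\<sigma> = 1 \<or> \<sigma> = - 1"
    and A_support: "\<And>l v. \<sigma> * l \<le> 0 \<Longrightarrow> A l v = 0"
begin

interpretation V: vector_space s by (rule vs)

lemma fd_power_eq_0: "\<sigma> * k < int n \<Longrightarrow> fd_power A n k v = 0"
proof (induction n arbitrary: k)
  case 0
  then show ?case by (auto simp: fd_one_def)
next
  case (Suc n)
  have "A l (fd_power A n (k - l) v) = 0" for l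
  proof (cases "\<sigma> * l \<le> 0")
    case False
    then have "\<sigma> * (k - l) < int n" using Suc.prems by (simp add: algebra_simps)
    then show ?thesis by (simp add: Suc.IH linearD[OF A_linear])
  qed (simp add: A_support)
  then show ?case by (simp add: fd_mult_def)
qed

lemma fd_power_finite: "finite {l. A l (fd_power A n (k - l) v) \<noteq> 0}"
proof (rule finite_support_int[of "- \<bar>k\<bar>" _ "\<bar>k\<bar>"])
  have "A l (fd_power A n (k - l) v) = 0" if "\<bar>k\<bar> < \<bar>l\<bar>" for l
  proof (cases "\<sigma> * l \<le> 0")
    case False
    then have "\<sigma> * (k - l) < int n" using that sigma by (auto simp: abs_if split: if_splits)
    then show ?thesis by (simp add: fd_power_eq_0 linearD[OF A_linear])
  qed (simp add: A_support)
  then show "A n' (fd_power A n (k - n') v) = 0" if "n' < - \<bar>k\<bar>" for n' using that by auto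
  show "A n' (fd_power A n (k - n') v) = 0" if "\<bar>k\<bar> < n'" for n'
    using that \<open>\<And>l. \<bar>k\<bar> < \<bar>l\<bar> \<Longrightarrow> A l (fd_power A n (k - l) v) = 0\<close> by auto
qed

lemma fd_power_linear: "Vector_Spaces.linear s s (fd_power A n k)"
proof (induction n arbitrary: k)
  case 0
  then show ?case
    by (simp add: fd_one_def[abs_def]) (rule linearI, auto simp: vs)
next
  case (Suc n)
  show ?case
    unfolding fd_power.simps fd_mult_def[abs_def]
    by (rule linear_Sum_any) (auto simp: vs fd_power_finite intro: linear_comp[OF Suc A_linear])
qed

lemma fd_exp_finite: "finite {n. s (1 / fact n) (fd_power A n k v) \<noteq> 0}"
proof (rule finite_subset[of _ "{..nat \<bar>k\<bar>}"])
  show "{n. s (1 / fact n) (fd_power A n k v) \<noteq> 0} \<subseteq> {..nat \<bar>k\<bar>}"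
  proof
    fix n assume "n \<in> {n. s (1 / fact n) (fd_power A n k v) \<noteq> 0}"
    then have "\<not> \<sigma> * k < int n" using fd_power_eq_0[of k n v] by auto
    then show "n \<in> {..nat \<bar>k\<bar>}" using sigma by auto
  qed
qed simp

lemma fd_exp_linear: "Vector_Spaces.linear s s (fd_exp s A k)"
  unfolding fd_exp_def[abs_def]
  by (rule linear_Sum_any[OF vs vs linear_scaled[OF fd_power_linear] fd_exp_finite])

lemma fd_exp_eq_sum:
  assumes "nat \<bar>k\<bar> \<le> N"
  shows "fd_exp s A k v = (\<Sum>n\<le>N. s (1 / fact n) (fd_power A n k v))"
  unfolding fd_exp_def
proof (rule Sum_any.expand_superset, simp, safe)
  fix n assume "s (1 / fact n) (fd_power A n k v) \<noteq> 0"
  then have "\<not> \<sigma> * k < int n" using fd_power_eq_0[of k n v] by auto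
  then show "n \<le> N" using sigma assms by auto
qed

lemma fd_exp_eq_0: "\<sigma> * k < 0 \<Longrightarrow> fd_exp s A k v = 0"
  unfolding fd_exp_def by (rule Sum_any_eq_0) (simp add: fd_power_eq_0)

lemma fd_exp_0: "fd_exp s A 0 v = v"
  using fd_exp_eq_sum[of 0 0 v] by (simp add: fd_one_def)

lemma fd_exp_vacuum:
  assumes "\<And>l. A l v = 0"
  shows "fd_exp s A k v = (if k = 0 then v else 0)"
proof -
  have "fd_power A (Suc n) k v = 0" for n k
  proof (induction n arbitrary: k)
    case 0
    have "A l (fd_one (k - l) v) = 0" for l by (simp add: fd_one_def assms linearD[OF A_linear])
    then show ?case by (simp add: fd_mult_def)
  next
    case (Suc n)
    then show ?case
      by (simp only: fd_power.simps(2)[of A "Suc n"] fd_mult_def) (simp add: linearD[OF A_linear])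
  qed
  then have "fd_power A n k v = 0" if "n \<noteq> 0" for n using that by (cases n) auto
  then have "fd_exp s A k v = (\<Sum>n\<le>nat \<bar>k\<bar>. if n = 0 then fd_one k v else 0)"
    by (subst fd_exp_eq_sum[OF order_refl]) (rule sum.cong, auto)
  then show ?thesis by (auto simp: fd_one_def)
qed

lemma fd_exp_in_subspace:
  assumes "k \<noteq> 0" "module.subspace s S" "\<And>l v. A l v \<in> S"
  shows "fd_exp s A k v \<in> S"
proof -
  have "fd_power A n k v \<in> S" for n
  proof (cases n)
    case 0
    then show ?thesis using assms by (simp add: fd_one_def V.subspace_0)
  next
    case (Suc m)
    have "(\<Sum>l\<in>{l. A l (fd_power A m (k - l) v) \<noteq> 0}. A l (fd_power A m (k - l) v)) \<in> S"
      by (rule V.subspace_sum) (use assms in auto)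
    then show ?thesis by (simp add: Suc fd_mult_def Sum_any.expand_set)
  qed
  then show ?thesis
    by (subst fd_exp_eq_sum[OF order_refl])
       (intro V.subspace_sum V.subspace_scale assms(2))
qed

text \<open>Leibniz rule: the commutator of B with A is the scalar \<open>\<gamma>\<close> in degree
  q, and each of the n factors contributes it once. For n = 0 the truncated \<open>n - 1\<close> is
  harmless, as its coefficient is zero.\<close>

lemma fd_power_commutator:
  assumes B: "Vector_Spaces.linear s s B"
    and comm: "\<And>l v. B (A l v) = A l (B v) + (if l = q then s \<gamma> v else 0)"
  shows "B (fd_power A n k v) =
    fd_power A n k (B v) + s (of_nat n * \<gamma>) (fd_power A (n - 1) (k - q) v)"
proof (induction n arbitrary: k)
  case 0
  then show ?case by (simp add: fd_one_def linearD[OF B])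
next
  case (Suc n)
  let ?P = "fd_power A"
  have "B (?P (Suc n) k v) = (\<Sum>l. B (A l (?P n (k - l) v)))"
    by (simp add: fd_mult_def Sum_any_linear[OF B] fd_power_finite)
  also have "\<dots> = (\<Sum>l. A l (?P n (k - l) (B v)) +
      (s (of_nat n * \<gamma>) (A l (?P (n - 1) (k - q - l) v)) + (if l = q then s \<gamma> (?P n (k - l) v) else 0)))"
    by (rule Sum_any.cong) (simp add: comm Suc linearD[OF A_linear] algebra_simps)
  also have "\<dots> = (\<Sum>l. A l (?P n (k - l) (B v))) +
      ((\<Sum>l. s (of_nat n * \<gamma>) (A l (?P (n - 1) (k - q - l) v)))
       + (\<Sum>l. if l = q then s \<gamma> (?P n (k - l) v) else 0))"
  proof -
    have f1: "finite {l. s (of_nat n * \<gamma>) (A l (?P (n - 1) (k - q - l) v)) \<noteq> 0}"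
      by (rule finite_subset[OF _ fd_power_finite[of "n - 1" "k - q" v]]) auto
    have f2: "finite {l. (if l = q then s \<gamma> (?P n (k - l) v) else 0) \<noteq> 0}"
      by (rule finite_subset[of _ "{q}"]) auto
    have f3: "finite {l. s (of_nat n * \<gamma>) (A l (?P (n - 1) (k - q - l) v)) +
        (if l = q then s \<gamma> (?P n (k - l) v) else 0) \<noteq> 0}"
      by (rule finite_subset[OF _ finite_UnI[OF f1 f2]]) auto
    show ?thesis
      by (simp only: Sum_any.distrib[OF fd_power_finite f3] Sum_any.distrib[OF f1 f2])
  qed
  also have "(\<Sum>l. A l (?P n (k - l) (B v))) = ?P (Suc n) k (B v)"
    by (simp add: fd_mult_def)
  also have "(\<Sum>l. if l = q then s \<gamma> (?P n (k - l) v) else 0) = s \<gamma> (?P n (k - q) v)"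
    by simp
  also have "(\<Sum>l. s (of_nat n * \<gamma>) (A l (?P (n - 1) (k - q - l) v))) = s (of_nat n * \<gamma>) (?P n (k - q) v)"
  proof (cases n)
    case (Suc m)
    have "Vector_Spaces.linear s s (s c)" for c
      by (rule linearI) (auto simp: vs V.scale_right_distrib)
    from Sum_any_linear[OF this fd_power_finite] show ?thesis by (simp add: Suc fd_mult_def)
  qed simp
  finally show ?case by (simp add: V.scale_left_distrib algebra_simps)
qed

lemma fd_exp_commutator:
  assumes B: "Vector_Spaces.linear s s B"
    and comm: "\<And>l v. B (A l v) = A l (B v) + (if l = q then s \<gamma> v else 0)"
  shows "B (fd_exp s A k v) = fd_exp s A k (B v) + s \<gamma> (fd_exp s A (k - q) v)"
proof -
  \<comment> \<open>Large enough for the exponentials at both \<open>k\<close> and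
    \<open>k - q\<close>. The derivative series loses its term n = 0, hence the sums up to
    \<open>Suc N\<close> and \<open>N\<close>.\<close>
  define N where "N = nat \<bar>k\<bar> + nat \<bar>k - q\<bar>"
  interpret B: Vector_Spaces.linear s s B by (rule B)
  let ?P = "fd_power A"
  have "B (fd_exp s A k v) = (\<Sum>n\<le>Suc N. s (1 / fact n) (B (?P n k v)))"
    by (subst fd_exp_eq_sum[of k "Suc N"]) (simp_all only: B.sum B.scale, simp add: N_def)
  also have "\<dots> = (\<Sum>n\<le>Suc N. s (1 / fact n) (?P n k (B v))) +
      (\<Sum>n\<le>Suc N. s (of_nat n / fact n * \<gamma>) (?P (n - 1) (k - q) v))"
    by (simp only: fd_power_commutator[OF B comm] V.scale_right_distrib sum.distrib V.scale_scale
        times_divide_eq_left mult_1 mult.assoc)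
  also have "(\<Sum>n\<le>Suc N. s (1 / fact n) (?P n k (B v))) = fd_exp s A k (B v)"
    by (rule fd_exp_eq_sum[symmetric]) (simp add: N_def)
  also have "(\<Sum>n\<le>Suc N. s (of_nat n / fact n * \<gamma>) (?P (n - 1) (k - q) v))
      = (\<Sum>n\<le>N. s (of_nat (Suc n) / fact (Suc n) * \<gamma>) (?P n (k - q) v))"
    by (subst sum.atMost_Suc_shift) simp
  also have "\<dots> = (\<Sum>n\<le>N. s \<gamma> (s (1 / fact n) (?P n (k - q) v)))"
  proof (rule sum.cong[OF refl])
    fix n
    have "(of_nat (Suc n) / fact (Suc n) :: complex) = 1 / fact n"
      by (simp del: of_nat_Suc)
    then show "s (of_nat (Suc n) / fact (Suc n) * \<gamma>) (?P n (k - q) v) = s \<gamma> (s (1 / fact n) (?P n (k - q) v))"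
      by (simp only: V.scale_scale mult.commute)
  qed
  also have "\<dots> = s \<gamma> (fd_exp s A (k - q) v)"
    by (subst fd_exp_eq_sum[of "k - q" N]) (simp_all add: N_def V.scale_sum_right)
  finally show ?thesis .
qed

end

section \<open>The Fock space\<close>

lemma monomial_cases:
  fixes m :: "nat \<Rightarrow>\<^sub>0 nat"
  obtains "m = 0" | m' j where "m = m' + Poly_Mapping.single j 1"
proof (cases "m = 0")
  case False
  then obtain j where "Poly_Mapping.lookup m j \<noteq> 0"
    by (metis lookup_zero poly_mapping_eqI)
  then have "m = (m - Poly_Mapping.single j 1) + Poly_Mapping.single j 1"
    by (intro poly_mapping_eqI) (auto simp: lookup_add lookup_minus lookup_single when_def)
  then show ?thesis using that by blast
qed (use that in blast)

definition mdeg :: "(nat \<Rightarrow>\<^sub>0 nat) \<Rightarrow> nat" where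
  "mdeg m = (\<Sum>j\<in>Poly_Mapping.keys m. Poly_Mapping.lookup m j)"

lemma mdeg_Suc [simp]: "mdeg (m + Poly_Mapping.single j (Suc 0)) = Suc (mdeg m)"
proof -
  have "mdeg (m + Poly_Mapping.single j 1) = mdeg m + mdeg (Poly_Mapping.single j 1)"
    unfolding mdeg_def by (rule setsum_keys_plus_distrib) auto
  then show ?thesis by (simp add: mdeg_def)
qed

lemma monomial_induct [case_names zero add]:
  assumes "P 0" "\<And>m j. P m \<Longrightarrow> P (m + Poly_Mapping.single j (Suc 0))"
  shows "P (m :: nat \<Rightarrow>\<^sub>0 nat)"
proof (induction "mdeg m" arbitrary: m rule: less_induct)
  case less
  show ?case
  proof (cases m rule: monomial_cases)
    case (2 m' j)
    then show ?thesis using less[of m'] assms(2) by simp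
  qed (use assms in simp)
qed

abbreviation fscale :: "complex \<Rightarrow> fock \<Rightarrow> fock" where
  "fscale \<equiv> pm_scale (*)"

abbreviation flinear :: "(fock \<Rightarrow> fock) \<Rightarrow> bool" where
  "flinear \<equiv> Vector_Spaces.linear fscale fscale"

lemma vector_space_fock: "vector_space fscale"
  by (rule vector_space_pm_scale[OF vector_space_complex_mult])

interpretation Fock: vector_space fscale
  by (rule vector_space_fock)

lemma lookup_fscale [simp]: "Poly_Mapping.lookup (fscale c f) m = c * Poly_Mapping.lookup f m"
  by (rule lookup_pm_scale[OF vector_space_complex_mult])

lemma flinearI:
  "(\<And>x y. h (x + y) = h x + h y) \<Longrightarrow> (\<And>c x. h (fscale c x) = fscale c (h x)) \<Longrightarrow> flinear h"
  by (rule linearI[OF vector_space_fock vector_space_fock])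

text \<open>Monomials without the variable j get weight zero in \<open>fock_deriv\<close>, so its
  truncated subtraction does no harm and a single monomial contributes to each coefficient.\<close>

lemma lookup_fock_deriv:
  "Poly_Mapping.lookup (fock_deriv j f) m =
     of_nat (Suc (Poly_Mapping.lookup m j)) * Poly_Mapping.lookup f (m + Poly_Mapping.single j 1)"
proof -
  have *: "Poly_Mapping.lookup (Poly_Mapping.single (k - Poly_Mapping.single j 1)
        (of_nat (Poly_Mapping.lookup k j) * Poly_Mapping.lookup f k)) m =
      (if k = m + Poly_Mapping.single j 1 then
        of_nat (Suc (Poly_Mapping.lookup m j)) * Poly_Mapping.lookup f (m + Poly_Mapping.single j 1) else 0)"
    for k
  proof (cases "Poly_Mapping.lookup k j = 0")
    case True
    then have "k \<noteq> m + Poly_Mapping.single j 1" by (auto simp: lookup_add)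
    then show ?thesis by (simp add: True)
  next
    case False
    then have k: "k = (k - Poly_Mapping.single j 1) + Poly_Mapping.single j 1"
      by (intro poly_mapping_eqI) (auto simp: lookup_add lookup_minus lookup_single when_def)
    show ?thesis
    proof (cases "k - Poly_Mapping.single j 1 = m")
      case True
      then show ?thesis using k by (auto simp: lookup_add)
    next
      case False
      then have "k \<noteq> m + Poly_Mapping.single j 1" by auto
      then show ?thesis using False by (simp add: lookup_single)
    qed
  qed
  show ?thesis
    unfolding fock_deriv_def lookup_sum * by (auto simp: sum.delta' in_keys_iff)
qed

lemma fock_sum_singles:
  "f = (\<Sum>k\<in>Poly_Mapping.keys f. fscale (Poly_Mapping.lookup f k) (Poly_Mapping.single k 1))"
  for f :: fock
  by (rule poly_mapping_eqI) (auto simp: lookup_sum lookup_single when_def in_keys_iff if_distrib cong: if_cong)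

lemma fscale_mult: "g * fscale c f = fscale c (g * f)" for f g :: fock
  by (simp add: pm_scale_def mult_map_scale_conv_mult mult.left_commute)

lemma lookup_fock_var_mult:
  "Poly_Mapping.lookup (fock_var j * f) m =
    (if Poly_Mapping.lookup m j = 0 then 0 else Poly_Mapping.lookup f (m - Poly_Mapping.single j 1))"
proof -
  have "fock_var j * f = (\<Sum>k\<in>Poly_Mapping.keys f.
      fscale (Poly_Mapping.lookup f k) (Poly_Mapping.single (Poly_Mapping.single j 1 + k) 1))"
    using arg_cong[OF fock_sum_singles[of f], of "(*) (fock_var j)"]
    by (simp add: sum_distrib_left fscale_mult fock_var_def mult_single)
  then have "Poly_Mapping.lookup (fock_var j * f) m =
     (\<Sum>k\<in>Poly_Mapping.keys f. Poly_Mapping.lookup f k * (1 when Poly_Mapping.single j 1 + k = m))"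
    by (simp add: lookup_sum lookup_single)
  also have "\<dots> = (\<Sum>k\<in>Poly_Mapping.keys f. if k = m - Poly_Mapping.single j 1 then
      (if Poly_Mapping.lookup m j = 0 then 0 else Poly_Mapping.lookup f k) else 0)"
  proof (rule sum.cong[OF refl])
    fix k
    have "Poly_Mapping.single j 1 + k = m \<longleftrightarrow> k = m - Poly_Mapping.single j 1 \<and> Poly_Mapping.lookup m j \<noteq> 0"
      by (auto simp: poly_mapping_eq_iff fun_eq_iff lookup_add lookup_minus lookup_single when_def)
    then show "Poly_Mapping.lookup f k * (1 when Poly_Mapping.single j 1 + k = m) =
       (if k = m - Poly_Mapping.single j 1 then
      (if Poly_Mapping.lookup m j = 0 then 0 else Poly_Mapping.lookup f k) else 0)"
      by (simp add: when_def)
  qed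
  also have "\<dots> = (if Poly_Mapping.lookup m j = 0 then 0 else Poly_Mapping.lookup f (m - Poly_Mapping.single j 1))"
    by (auto simp: sum.delta in_keys_iff)
  finally show ?thesis .
qed

lemma fock_deriv_var_mult:
  "fock_deriv i (fock_var j * f) = fock_var j * fock_deriv i f + (if i = j then f else 0)"
proof (rule poly_mapping_eqI)
  fix m
  show "Poly_Mapping.lookup (fock_deriv i (fock_var j * f)) m =
    Poly_Mapping.lookup (fock_var j * fock_deriv i f + (if i = j then f else 0)) m"
  proof (cases "Poly_Mapping.lookup m j = 0")
    case True
    then show ?thesis
      by (simp add: lookup_add lookup_fock_deriv lookup_fock_var_mult lookup_single)
  next
    case False
    then have "m + Poly_Mapping.single i 1 - Poly_Mapping.single j 1 =
        m - Poly_Mapping.single j 1 + Poly_Mapping.single i 1"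
      by (intro poly_mapping_eqI) (auto simp: lookup_add lookup_minus lookup_single when_def)
    moreover have "i = j \<Longrightarrow> m - Poly_Mapping.single j (Suc 0) + Poly_Mapping.single i (Suc 0) = m"
      using False by (intro poly_mapping_eqI) (auto simp: lookup_add lookup_minus lookup_single when_def)
    ultimately show ?thesis using False
      by (auto simp: lookup_add lookup_minus lookup_fock_deriv lookup_fock_var_mult lookup_single ring_distribs)
  qed
qed

lemma fock_deriv_linear: "flinear (fock_deriv j)"
  by (rule flinearI; rule poly_mapping_eqI) (simp_all add: lookup_fock_deriv lookup_add algebra_simps)

lemma fock_var_mult_linear: "flinear ((*) (fock_var j))"
  by (rule flinearI) (simp_all add: fscale_mult algebra_simps)

lemma fock_deriv_commute: "fock_deriv i (fock_deriv j f) = fock_deriv j (fock_deriv i f)"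
  by (rule poly_mapping_eqI)
     (cases "i = j", simp_all add: lookup_fock_deriv lookup_add lookup_single add_ac)

lemma fock_deriv_1: "fock_deriv j 1 = 0"
proof (rule poly_mapping_eqI)
  fix m
  have "Poly_Mapping.lookup (m + Poly_Mapping.single j 1) j \<noteq> Poly_Mapping.lookup (0 :: nat \<Rightarrow>\<^sub>0 nat) j" by (simp add: lookup_add)
  then have "m + Poly_Mapping.single j 1 \<noteq> 0" by metis
  then show "Poly_Mapping.lookup (fock_deriv j 1) m = Poly_Mapping.lookup 0 m"
    by (simp add: lookup_fock_deriv lookup_one)
qed

lemma fock_induct [case_names one var add scale]:
  assumes "P 1" "\<And>j f. P f \<Longrightarrow> P (fock_var j * f)" "\<And>f g. P f \<Longrightarrow> P g \<Longrightarrow> P (f + g)"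
    "\<And>c f. P f \<Longrightarrow> P (fscale c f)"
  shows "P f"
proof -
  have mono: "P (Poly_Mapping.single m 1)" for m
  proof (induction m rule: monomial_induct)
    case (add m j)
    have "Poly_Mapping.single (m + Poly_Mapping.single j (Suc 0)) 1 = fock_var j * Poly_Mapping.single m 1"
      by (simp add: fock_var_def mult_single add.commute)
    then show ?case using assms(2)[OF add] by simp
  qed (use assms(1) in simp)
  have "P 0" using assms(4)[OF assms(1), of 0] by simp
  have "P (\<Sum>k\<in>K. fscale (Poly_Mapping.lookup f k) (Poly_Mapping.single k 1))" if "finite K" for K
    using that by (induction K rule: finite_induct) (auto intro: \<open>P 0\<close> assms mono)
  from this[of "Poly_Mapping.keys f"] show ?thesis using fock_sum_singles[of f] by simp
qed

lemma beta_nonneg: "0 \<le> m \<Longrightarrow> beta m f = fscale (- (of_int m + 1 / 2)) (fock_deriv (nat m) f)"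
  and beta_neg: "m < 0 \<Longrightarrow> beta m f = fock_var (nat (- m - 1)) * f"
  by (simp_all add: beta_def)

lemma beta_linear: "flinear (beta m)"
  unfolding beta_def[abs_def]
  by (cases "m < 0") (simp_all add: fock_var_mult_linear linear_scaled[OF fock_deriv_linear])

lemma beta_commutator:
  "beta m (beta n f) = beta n (beta m f) + (if m + n + 1 = 0 then fscale (- (of_int m + 1 / 2)) f else 0)"
proof -
  consider "m < 0" "n < 0" | "m < 0" "0 \<le> n" | "0 \<le> m" "n < 0" | "0 \<le> m" "0 \<le> n" by linarith
  then show ?thesis
  proof cases
    case 1
    then show ?thesis by (simp add: beta_neg mult.left_commute)
  next
    case 2
    then have "(n = - m - 1) = (m + n + 1 = 0)" "nat n = nat (- m - 1) \<longleftrightarrow> n = - m - 1" by auto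
    with 2 show ?thesis
      by (auto simp: beta_neg beta_nonneg fscale_mult fock_deriv_var_mult Fock.scale_right_distrib
          simp flip: Fock.scale_left_distrib)
  next
    case 3
    then have "nat m = nat (- n - 1) \<longleftrightarrow> m + n + 1 = 0" by auto
    with 3 show ?thesis
      by (simp add: beta_neg beta_nonneg fscale_mult fock_deriv_var_mult Fock.scale_right_distrib)
  next
    case 4
    then show ?thesis
      by (simp add: beta_nonneg fock_deriv_commute linearD[OF fock_deriv_linear] mult.commute)
  qed
qed

section \<open>Irreducibility of the Fock space\<close>

abbreviation vac :: "fock \<Rightarrow> complex" where
  "vac f \<equiv> Poly_Mapping.lookup f 0"

lemma vac_beta_neg: "m < 0 \<Longrightarrow> vac (beta m f) = 0"
  by (simp add: beta_neg lookup_fock_var_mult)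

lemma beta_1: "0 \<le> m \<Longrightarrow> beta m 1 = 0"
  by (simp add: beta_nonneg fock_deriv_1)

text \<open>The modes with \<open>0 \<le> m\<close> are nonzero multiples of the partial
  derivatives, so the span of B is closed under these. Up to a nonzero factor, any coefficient of a
  vector is the vacuum coefficient of an iterated derivative. A whole set B is needed because the
  modes permute the coefficients of a distribution.\<close>

lemma fock_vectors_eq_0:
  assumes vac: "\<And>x. x \<in> B \<Longrightarrow> vac x = 0"
    and closed: "\<And>x m. x \<in> B \<Longrightarrow> 0 \<le> m \<Longrightarrow> beta m x \<in> Fock.span B"
    and "x \<in> B"
  shows "x = 0"
proof -
  have deriv: "fock_deriv j x \<in> Fock.span B" if "x \<in> Fock.span B" for x j
    using that
  proof (induction x rule: Fock.span_induct_alt)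
    case base
    then show ?case by (simp add: linearD[OF fock_deriv_linear] Fock.span_zero)
  next
    case (step c x y)
    have "fock_deriv j x = fscale (- 1 / (of_nat j + 1 / 2)) (beta (int j) x)"
    proof -
      have "of_nat j + 1 / 2 \<noteq> (0 :: complex)"
        by (simp add: complex_eq_iff)
      then show ?thesis by (simp add: beta_nonneg minus_divide_left[symmetric] del: minus_add_distrib)
    qed
    with closed[OF step(1), of "int j"] have "fock_deriv j x \<in> Fock.span B"
      by (simp add: Fock.span_scale Fock.span_neg)
    with step show ?case by (simp add: linearD[OF fock_deriv_linear] Fock.span_add Fock.span_scale)
  qed
  have "Poly_Mapping.lookup x m = 0" if "x \<in> Fock.span B" for x m
    using that
  proof (induction m arbitrary: x rule: monomial_induct)
    case zero
    then show ?case
      by (induction x rule: Fock.span_induct_alt) (auto simp: vac lookup_add)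
  next
    case (add m j)
    have "of_nat (Suc (Poly_Mapping.lookup m j)) * Poly_Mapping.lookup x (m + Poly_Mapping.single j (Suc 0)) = 0"
      using add.IH[OF deriv[OF add.prems]] lookup_fock_deriv[of j x m] by simp
    then show ?case by (simp del: of_nat_Suc)
  qed
  then show ?thesis using \<open>x \<in> B\<close> by (intro poly_mapping_eqI) (simp add: Fock.span_base)
qed

text \<open>Induction on the vector: the non-negative modes settle the vacuum through
  \<open>fock_vectors_eq_0\<close>; for a creation mode, all members of the family vanish at f by
  induction, hence so does the commutator. The span absorbs the index shifts caused by the
  modes.\<close>

lemma fock_operators_eq_0:
  fixes Op :: "'i \<Rightarrow> fock \<Rightarrow> fock"
  assumes lin: "\<And>a. flinear (Op a)"
    and vac: "\<And>a. vac (Op a 1) = 0"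
    and comm: "\<And>a m f. beta m (Op a f) - Op a (beta m f) \<in> Fock.span (range (\<lambda>b. Op b f))"
  shows "Op a f = 0"
proof (induction f arbitrary: a rule: fock_induct)
  case one
  show ?case
  proof (rule fock_vectors_eq_0[of "range (\<lambda>b. Op b 1)"])
    fix x m assume "x \<in> range (\<lambda>b. Op b 1)" "0 \<le> (m::int)"
    then show "beta m x \<in> Fock.span (range (\<lambda>b. Op b 1))"
      using comm[of m _ 1] by (auto simp: beta_1 linearD[OF lin])
  qed (use vac in auto)
next
  case (var j f)
  have "range (\<lambda>b. Op b f) \<subseteq> {0}" using var by auto
  then have "Fock.span (range (\<lambda>b. Op b f)) \<subseteq> {0}"
    by (metis Fock.span_insert_0 Fock.span_mono Fock.span_empty)
  then have "beta (- int j - 1) (Op a f) = Op a (beta (- int j - 1) f)"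
    using comm[of "- int j - 1" a f] by auto
  then show ?case by (simp add: var beta_neg)
next
  case (add f g)
  then show ?case by (simp add: linearD[OF lin])
next
  case (scale c f)
  then show ?case by (simp add: linearD[OF lin])
qed

section \<open>The vertex operator\<close>

lemma exponent_creation_linear: "flinear (exponent_creation l)"
  by (rule flinearI)
     (simp_all add: exponent_creation_def linearD[OF beta_linear] Fock.scale_right_distrib mult.commute)

lemma exponent_annihilation_linear: "flinear (exponent_annihilation l)"
  by (rule flinearI)
     (simp_all add: exponent_annihilation_def linearD[OF beta_linear] Fock.scale_right_distrib mult.commute)

interpretation creation: one_sided_dist fscale exponent_creation 1
  by (rule one_sided_dist.intro[OF vector_space_fock exponent_creation_linear])
     (auto simp: exponent_creation_def)

interpretation annihilation: one_sided_dist fscale exponent_annihilation "- 1"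
  by (rule one_sided_dist.intro[OF vector_space_fock exponent_annihilation_linear])
     (auto simp: exponent_annihilation_def)

abbreviation creation_exp :: "fock fdist" where
  "creation_exp \<equiv> fd_exp fscale exponent_creation"

abbreviation annihilation_exp :: "fock fdist" where
  "annihilation_exp \<equiv> fd_exp fscale exponent_annihilation"

text \<open>The division by k in the exponent cancels the k of [beta(k), beta(-k)] = -k, so every
  non-negative mode yields the same scalar -1.\<close>

lemma beta_exponent_creation:
  "beta m (exponent_creation l f) = exponent_creation l (beta m f) +
     (if l = 2 * m + 1 then fscale (if 0 \<le> m then - 1 else 0) f else 0)"
proof (cases "odd l \<and> l > 0")
  case True
  then obtain n where n: "l = 2 * n + 1" "0 \<le> n" by (elim conjE oddE) simp
  have neg1: "1 / (complex_of_int l / 2) * - (complex_of_int n + 1 / 2) = - 1"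
  proof -
    have "complex_of_int n + 1 / 2 \<noteq> 0" using n by (simp add: complex_eq_iff)
    moreover have "complex_of_int l / 2 = complex_of_int n + 1 / 2" by (simp add: n field_simps)
    ultimately show ?thesis by (metis minus_mult_right nonzero_divide_eq_eq)
  qed
  have l2: "- l div 2 = - n - 1" using n by presburger
  have lm: "l = 2 * m + 1 \<longleftrightarrow> m = n" using n by auto
  have mn: "m + (- n - 1) + 1 = 0 \<longleftrightarrow> m = n" by auto
  show ?thesis
    using True n(2)
    by (simp only: exponent_creation_def l2 if_True simp_thms linearD[OF beta_linear] beta_commutator[of m "- n - 1"]
          Fock.scale_right_distrib mn lm)
       (auto simp only: Fock.scale_scale neg1 if_True if_False Fock.scale_zero_right simp_thms split: if_split)
next
  case False
  then show ?thesis by (auto simp: exponent_creation_def linearD[OF beta_linear])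
qed

lemma beta_exponent_annihilation:
  "beta m (exponent_annihilation l f) = exponent_annihilation l (beta m f) +
     (if l = 2 * m + 1 then fscale (if m < 0 then - 1 else 0) f else 0)"
proof (cases "odd l \<and> l < 0")
  case True
  then obtain n where n: "l = 2 * n + 1" "n < 0" by (elim conjE oddE) simp
  have neg1: "- (1 / (complex_of_int (- l) / 2)) * - (complex_of_int n + 1 / 2) = - 1"
  proof -
    have "complex_of_int n + 1 / 2 \<noteq> 0"
    proof
      assume "complex_of_int n + 1 / 2 = 0"
      then have "complex_of_int (2 * n + 1) = 0" by (simp add: field_simps)
      then have "2 * n + 1 = 0" by (simp only: of_int_eq_0_iff)
      then show False by presburger
    qed
    moreover have "complex_of_int (- l) / 2 = - (complex_of_int n + 1 / 2)" using n by (simp add: field_simps)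
    ultimately show ?thesis by (metis minus_mult_right mult_minus_left minus_divide_right minus_minus nonzero_divide_eq_eq)
  qed
  have l2: "- l div 2 = - n - 1" using n by presburger
  have lm: "l = 2 * m + 1 \<longleftrightarrow> m = n" using n by auto
  have mn: "m + (- n - 1) + 1 = 0 \<longleftrightarrow> m = n" by auto
  show ?thesis
    using True n(2)
    by (simp only: exponent_annihilation_def l2 if_True simp_thms linearD[OF beta_linear] beta_commutator[of m "- n - 1"]
          Fock.scale_right_distrib mn lm)
       (auto simp only: Fock.scale_scale neg1 if_True if_False Fock.scale_zero_right simp_thms split: if_split)
next
  case False
  then show ?thesis by (auto simp: exponent_annihilation_def linearD[OF beta_linear])
qed

lemma beta_creation_exp:
  "beta m (creation_exp k f) =
    creation_exp k (beta m f) - (if 0 \<le> m then creation_exp (k - 2 * m - 1) f else 0)"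
  using creation.fd_exp_commutator[OF beta_linear beta_exponent_creation, of m k f]
  by (simp add: algebra_simps)

lemma beta_annihilation_exp:
  "beta m (annihilation_exp k f) =
    annihilation_exp k (beta m f) - (if m < 0 then annihilation_exp (k - 2 * m - 1) f else 0)"
  using annihilation.fd_exp_commutator[OF beta_linear beta_exponent_annihilation, of m k f]
  by (simp add: algebra_simps)

lemma annihilation_exp_1: "annihilation_exp k 1 = (if k = 0 then 1 else 0)"
proof (rule annihilation.fd_exp_vacuum)
  fix l
  show "exponent_annihilation l 1 = 0"
    by (cases "0 \<le> - l div 2") (auto simp: exponent_annihilation_def beta_1)
qed

lemma vac_creation_exp: "vac (creation_exp k f) = (if k = 0 then vac f else 0)"
proof (cases "k = 0")
  case True
  then show ?thesis by (simp add: creation.fd_exp_0)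
next
  case False
  have "creation_exp k f \<in> {f. vac f = 0}"
  proof (rule creation.fd_exp_in_subspace[OF False])
    show "Fock.subspace {f. vac f = 0}"
      by (rule Fock.subspaceI) (auto simp: lookup_add)
    fix l :: int and v
    have "odd l \<and> 0 < l \<Longrightarrow> (- l) div 2 < (0::int)" by presburger
    then show "exponent_creation l v \<in> {f. vac f = 0}"
      by (auto simp: exponent_creation_def vac_beta_neg)
  qed
  then show ?thesis using False by simp
qed

text \<open>On the vacuum only the constant term survives, and each creation factor with index j
  lowers the bound by 2j + 1.\<close>

lemma annihilation_exp_bounded: "\<exists>M. \<forall>k<M. annihilation_exp k f = 0"
proof (induction f rule: fock_induct)
  case one
  show ?case by (rule exI[of _ 0]) (simp add: annihilation_exp_1)
next
  case (var j f)
  then obtain M where M: "\<And>k. k < M \<Longrightarrow> annihilation_exp k f = 0" by blast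
  have "annihilation_exp k (fock_var j * f) = 0" if "k < M - 2 * int j - 1" for k
    using beta_annihilation_exp[of "- int j - 1" k f] that
    by (simp add: M beta_neg)
  then show ?case by blast
next
  case (add f g)
  then obtain M M' where "\<And>k. k < M \<Longrightarrow> annihilation_exp k f = 0" "\<And>k. k < M' \<Longrightarrow> annihilation_exp k g = 0" by blast
  then show ?case
    by (intro exI[of _ "min M M'"]) (simp add: linearD[OF annihilation.fd_exp_linear])
next
  case (scale c f)
  then show ?case by (auto simp: linearD[OF annihilation.fd_exp_linear])
qed

text \<open>The offset \<open>a\<close> covers the index-shifted sums that arise when a beta mode is
  moved through.\<close>

lemma vertex_support: "finite {l. creation_exp (l + a) (annihilation_exp (k - l) f) \<noteq> 0}"
proof -
  obtain M where M: "\<And>k. k < M \<Longrightarrow> annihilation_exp k f = 0"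
    using annihilation_exp_bounded[of f] by blast
  show ?thesis
    by (rule finite_support_int[of "- a" _ "k - M"])
       (simp_all add: creation.fd_exp_eq_0 M linearD[OF creation.fd_exp_linear])
qed

lemma vertex_linear: "flinear (fd_mult creation_exp annihilation_exp k)"
  unfolding fd_mult_def[abs_def]
  using vertex_support[of 0 k]
  by (intro linear_Sum_any) (auto simp: vector_space_fock
      intro: linear_comp[OF annihilation.fd_exp_linear creation.fd_exp_linear])

text \<open>Non-negative modes meet the creation exponential, negative ones the annihilation
  exponential. The scalar is -1 in both cases, so one formula covers all m.\<close>

lemma beta_vertex:
  "beta m (fd_mult creation_exp annihilation_exp k f) =
    fd_mult creation_exp annihilation_exp k (beta m f) -
    fd_mult creation_exp annihilation_exp (k - 2 * m - 1) f"
proof -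
  let ?h = "\<lambda>l. if 0 \<le> m then creation_exp (l - 2 * m - 1) (annihilation_exp (k - l) f)
       else creation_exp l (annihilation_exp (k - 2 * m - 1 - l) f)"
  have "beta m (fd_mult creation_exp annihilation_exp k f) =
      (\<Sum>l. beta m (creation_exp l (annihilation_exp (k - l) f)))"
    unfolding fd_mult_def using vertex_support[of 0 k f]
    by (intro Sum_any_linear[OF beta_linear]) simp
  also have "\<dots> = (\<Sum>l. creation_exp l (annihilation_exp (k - l) (beta m f)) - ?h l)"
    by (rule Sum_any.cong)
       (simp add: beta_creation_exp beta_annihilation_exp linearD[OF creation.fd_exp_linear] algebra_simps)
  also have "\<dots> = fd_mult creation_exp annihilation_exp k (beta m f) - (\<Sum>l. ?h l)"
  proof -
    have "finite {l. ?h l \<noteq> 0}"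
      using vertex_support[of "- 2 * m - 1" k f] vertex_support[of 0 "k - 2 * m - 1" f]
      by (cases "0 \<le> m") (simp_all add: algebra_simps)
    then show ?thesis
      unfolding fd_mult_def using vertex_support[of 0 k "beta m f"] by (subst Sum_any_diff) simp_all
  qed
  also have "(\<Sum>l. ?h l) = fd_mult creation_exp annihilation_exp (k - 2 * m - 1) f"
  proof (cases "0 \<le> m")
    case True
    have "(\<Sum>l. ?h l) = (\<Sum>l. ?h (l + (2 * m + 1)))" by (rule Sum_any_shift[symmetric])
    with True show ?thesis by (simp add: fd_mult_def algebra_simps)
  qed (simp add: fd_mult_def)
  finally show ?thesis .
qed

lemma vac_vertex_1: "vac (fd_mult creation_exp annihilation_exp k 1) = (if k = 0 then 1 else 0)"
proof -
  have "fd_mult creation_exp annihilation_exp k 1 = (\<Sum>l. if l = k then creation_exp l 1 else 0)"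
    unfolding fd_mult_def
    by (rule Sum_any.cong) (simp add: annihilation_exp_1 linearD[OF creation.fd_exp_linear])
  then show ?thesis by (simp add: vac_creation_exp)
qed

lemma Y_tw_linear: "flinear (Y_tw i l)"
  unfolding Y_tw_def[abs_def] by (rule linear_scaled[OF vertex_linear])

lemma beta_Y_tw: "beta m (Y_tw i l f) = Y_tw i l (beta m f) - Y_tw i (l - 2 * m - 1) f"
proof -
  have "l - 1 - 2 * m - 1 = l - 2 * m - 1 - 1" by simp
  then show ?thesis
    unfolding Y_tw_def linearD(5)[OF beta_linear] beta_vertex Fock.scale_right_diff_distrib by (simp only:)
qed

lemma vac_Y_tw_1: "vac (Y_tw i l 1) = (if l = 1 then - (2 * \<i>) * (-1) ^ i else 0)"
  by (simp add: Y_tw_def vac_vertex_1)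

text \<open>These relations determine \<open>Y\<close> by \<open>fock_operators_eq_0\<close>; the
  exponentials do not occur again. The constant is 2i or -2i according to the twist, and only its
  square enters the commutators.\<close>

locale vertex_operator =
  fixes Y :: "fock fdist" and c :: complex
  assumes Y_linear: "flinear (Y l)"
    and beta_Y: "beta m (Y l f) = Y l (beta m f) - Y (l - 2 * m - 1) f"
    and vac_Y_1: "vac (Y l 1) = (if l = 1 then c else 0)"
    and c_square: "c * c = - 4"

lemma vertex_operator_Y_tw: "vertex_operator (Y_tw i) (- (2 * \<i>) * (-1) ^ i)"
proof (rule vertex_operator.intro[OF Y_tw_linear beta_Y_tw vac_Y_tw_1])
  show "- (2 * \<i>) * (- 1) ^ i * (- (2 * \<i>) * (- 1) ^ i) = - 4"
    by (cases "even i") auto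
qed

definition sg :: "int \<Rightarrow> 'v \<Rightarrow> 'v::ab_group_add" where
  "sg n x = (if even n then x else - x)"

lemma sg_0 [simp]: "sg n 0 = 0" "sg 0 x = x" "sg 1 x = - x"
  and sg_add: "sg n (x + y) = sg n x + sg n y"
  and sg_diff: "sg n (x - y) = sg n x - sg n y"
  and sg_uminus: "sg n (- x) = - sg n x"
  and sg_eq_0_iff [simp]: "sg n x = 0 \<longleftrightarrow> x = 0"
  by (auto simp: sg_def)

lemma sg_Suc [simp]: "sg (n + 1) x = - sg n x"
  by (simp add: sg_def)

lemma linear_sg:
  assumes "Vector_Spaces.linear s t f"
  shows "Vector_Spaces.linear s t (\<lambda>x. sg n (f x))"
proof -
  interpret Vector_Spaces.linear s t f by (rule assms)
  show ?thesis using linear_scaled[OF assms, of "if even n then 1 else - 1"]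
    by (cases "even n") (simp_all add: sg_def)
qed

lemma linear_wt:
  assumes "Vector_Spaces.linear s t f"
  shows "Vector_Spaces.linear s t (\<lambda>x. wt n (f x))"
proof -
  interpret Vector_Spaces.linear s t f by (rule assms)
  have "wt n x = t (if n < 0 then 0 else if n = 0 then 1 else 2) x" for x
    using vs2.scale_left_distrib[of 1 1 x] by (simp add: wt_def)
  then show ?thesis using linear_scaled[OF assms] by simp
qed

section \<open>The vertex operator on the vacuum and the two-point function\<close>

context vertex_operator
begin

text \<open>Non-negative modes only lower the index, so this family is closed under them, and the
  only nonzero vacuum component sits at l = 1.\<close>

lemma Y_1_eq_0: "l < 1 \<Longrightarrow> Y l 1 = 0"
proof (rule fock_vectors_eq_0[of "{Y l 1 |l. l < 1}"])
  fix x m assume "x \<in> {Y l 1 |l. l < 1}" "0 \<le> (m::int)"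
  then obtain l where "beta m x = - Y (l - 2 * m - 1) 1" "l - 2 * m - 1 < 1"
    by (auto simp: beta_Y beta_1 linearD[OF Y_linear])
  moreover from this(2) have "Y (l - 2 * m - 1) 1 \<in> Fock.span {Y l 1 |l. l < 1}"
    by (intro Fock.span_base) blast
  ultimately show "beta m x \<in> Fock.span {Y l 1 |l. l < 1}"
    by (simp add: Fock.span_neg)
qed (auto simp: vac_Y_1)

lemma Y_1_1: "Y 1 1 = fscale c 1"
proof -
  have "Y 1 1 - fscale c 1 = 0"
    by (rule fock_vectors_eq_0[of "{Y 1 1 - fscale c 1}"])
      (auto simp: lookup_minus vac_Y_1 beta_Y beta_1 Y_1_eq_0 linearD[OF Y_linear] linearD[OF beta_linear] Fock.span_zero)
  then show ?thesis by simp
qed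

lemma Y_var: "Y l (fock_var j * f) = fock_var j * Y l f + Y (l + 2 * int j + 1) f"
  using beta_Y[of "- int j - 1" l f] by (simp add: beta_neg algebra_simps)

lemma Y_bounded: "\<exists>M. \<forall>l<M. Y l f = 0"
proof (induction f rule: fock_induct)
  case one
  show ?case by (rule exI[of _ 1]) (simp add: Y_1_eq_0)
next
  case (var j f)
  then obtain M where M: "\<And>k. k < M \<Longrightarrow> Y k f = 0" by blast
  then have "Y k (fock_var j * f) = 0" if "k < M - 2 * int j - 1" for k
    using that by (simp add: Y_var)
  then show ?case by blast
next
  case (add f g)
  then obtain M M' where "\<And>k. k < M \<Longrightarrow> Y k f = 0" "\<And>k. k < M' \<Longrightarrow> Y k g = 0" by blast
  then show ?case
    by (intro exI[of _ "min M M'"]) (simp add: linearD[OF Y_linear])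
next
  case (scale c f)
  then show ?case by (auto simp: linearD[OF Y_linear])
qed

lemma vac_Y_var: "vac (Y l (fock_var j * f)) = vac (Y (l + 2 * int j + 1) f)"
  by (simp add: Y_var lookup_add lookup_fock_var_mult)

lemma creation_finite: "finite {j. fock_var j * Y (l - 2 * int j - 1) 1 \<noteq> 0}"
  by (rule finite_subset[of _ "{..nat \<bar>l\<bar>}"]) (auto simp: Y_1_eq_0 not_le[symmetric], rule ccontr, simp add: Y_1_eq_0)

text \<open>The equation \<open>a d/da Y(a)1 = Y(a)1 + 2 \<Sum>\<^bsub>k > 0\<^esub> \<beta>(-k) a\<^bsup>2k\<^esup> Y(a)1\<close>.\<close>

lemma Y_1_derivative:
  "fscale (of_int (l - 1)) (Y l 1) = fscale 2 (\<Sum>j. fock_var j * Y (l - 2 * int j - 1) 1)"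
proof -
  let ?S = "\<lambda>l. \<Sum>j. fock_var j * Y (l - 2 * int j - 1) 1"
  \<comment> \<open>The defect of the equation. Annihilation modes carry it to itself with a shifted
    index, so the family of all \<open>R l\<close> satisfies the vanishing criterion.\<close>
  define R where "R l = fscale (of_int (l - 1)) (Y l 1) - fscale 2 (?S l)" for l
  have beta_R: "beta m (R l) = - R (l - 2 * m - 1)" if m: "0 \<le> m" for m l
  proof -
    have bY: "beta m (Y l 1) = - Y (l - 2 * m - 1) 1" for l
      by (simp add: beta_Y beta_1 m linearD[OF Y_linear])
    have "beta m (?S l) = (\<Sum>j. beta m (fock_var j * Y (l - 2 * int j - 1) 1))"
      by (rule Sum_any_linear[OF beta_linear creation_finite])
    also have "\<dots> = (\<Sum>j. - (fock_var j * Y (l - 2 * m - 1 - 2 * int j - 1) 1) -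
        (if j = nat m then fscale (of_int m + 1 / 2) (Y (l - 2 * m - 1) 1) else 0))"
    proof (rule Sum_any.cong)
      fix j
      have "beta m (fock_var j * Y (l - 2 * int j - 1) 1) =
         beta m (beta (- int j - 1) (Y (l - 2 * int j - 1) 1))"
        by (simp add: beta_neg)
      also have "\<dots> = fock_var j * beta m (Y (l - 2 * int j - 1) 1) -
          (if j = nat m then fscale (of_int m + 1 / 2) (Y (l - 2 * int j - 1) 1) else 0)"
      proof -
        have "m + (- int j - 1) + 1 = 0 \<longleftrightarrow> j = nat m" using m by auto
        then have "beta m (beta (- int j - 1) v) = beta (- int j - 1) (beta m v) -
            (if j = nat m then fscale (of_int m + 1 / 2) v else 0)" for v
          by (subst beta_commutator) (simp only: Fock.scale_minus_left, simp)
        then show ?thesis by (simp add: beta_neg)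
      qed
      also have "\<dots> = - (fock_var j * Y (l - 2 * m - 1 - 2 * int j - 1) 1) -
          (if j = nat m then fscale (of_int m + 1 / 2) (Y (l - 2 * m - 1) 1) else 0)"
        using m by (simp add: bY algebra_simps)
      finally show "beta m (fock_var j * Y (l - 2 * int j - 1) 1) =
        - (fock_var j * Y (l - 2 * m - 1 - 2 * int j - 1) 1) -
          (if j = nat m then fscale (of_int m + 1 / 2) (Y (l - 2 * m - 1) 1) else 0)" .
    qed
    also have "\<dots> = - ?S (l - 2 * m - 1) - fscale (of_int m + 1 / 2) (Y (l - 2 * m - 1) 1)"
    proof -
      have neg: "(\<Sum>j. - (fock_var j * Y (l - 2 * m - 1 - 2 * int j - 1) 1)) = - ?S (l - 2 * m - 1)"
        using Sum_any_additive[OF creation_finite, of uminus "l - 2 * m - 1"] by simp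
      have "finite {j. - (fock_var j * Y (l - 2 * m - 1 - 2 * int j - 1) 1) \<noteq> 0}"
        using creation_finite[of "l - 2 * m - 1"] by simp
      then show ?thesis by (subst Sum_any_diff) (assumption, simp, simp only: neg Sum_any.delta)
    qed
    finally have bS: "beta m (?S l) = - ?S (l - 2 * m - 1) - fscale (of_int m + 1 / 2) (Y (l - 2 * m - 1) 1)" .
    \<comment> \<open>The contraction of beta(m) with the creation mode in \<open>?S\<close>,
      doubled, is 2m + 1, which is exactly the change of the factor l - 1 under the shift.\<close>
    have "fscale 2 (fscale (of_int m + 1 / 2) x) = fscale (of_int (l - 1)) x - fscale (of_int (l - 2 * m - 1 - 1)) x" for x
    proof -
      have "2 * (of_int m + 1 / 2) = (of_int (l - 1) - of_int (l - 2 * m - 1 - 1) :: complex)" by simp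
      then show ?thesis by (simp only: Fock.scale_scale Fock.scale_left_diff_distrib[symmetric])
    qed
    then show ?thesis
      by (simp only: R_def linearD[OF beta_linear] bY bS Fock.scale_right_diff_distrib Fock.scale_minus_right) simp
  qed
  have "R l = 0" for l
  proof (rule fock_vectors_eq_0[of "range R"])
    fix x assume "x \<in> range R"
    then obtain l where x: "x = R l" by blast
    have "vac (?S l) = 0"
      unfolding Sum_any.expand_set by (simp add: lookup_sum lookup_fock_var_mult)
    then show "vac x = 0" by (simp add: x R_def lookup_minus vac_Y_1)
  next
    fix x m assume "x \<in> range R" "0 \<le> (m :: int)"
    then obtain l where "beta m x = - R (l - 2 * m - 1)" by (auto simp: beta_R)
    then show "beta m x \<in> Fock.span (range R)" by (simp add: Fock.span_neg Fock.span_base)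
  qed simp
  then show ?thesis by (simp add: R_def)
qed

text \<open>Under \<open>vac\<close>, creation operators pass through \<open>Y i\<close> by shifting
  its index. So \<open>Y_1_derivative\<close> becomes a sum over odd shifts of (i, j); subtracting
  the same identity at (i + 2, j - 2) leaves one term.\<close>

lemma vac_YY_rec:
  "of_int (j - 1) * vac (Y i (Y j 1)) =
    of_int (j - 3) * vac (Y (i + 2) (Y (j - 2) 1)) + 2 * vac (Y (i + 1) (Y (j - 1) 1))"
proof -
  define N where "N = nat \<bar>j\<bar>"
  have *: "of_int (j - 1) * vac (Y i (Y j 1)) =
      2 * (\<Sum>k\<le>n. vac (Y (i + 2 * int k + 1) (Y (j - 2 * int k - 1) 1)))"
    if "nat \<bar>j\<bar> \<le> n" for i j n
  proof -
    have S: "(\<Sum>k. fock_var k * Y (j - 2 * int k - 1) 1) = (\<Sum>k\<le>n. fock_var k * Y (j - 2 * int k - 1) 1)"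
    proof (rule Sum_any.expand_superset)
      have "Y (j - 2 * int k - 1) 1 = 0" if "n < k" for k
        using that \<open>nat \<bar>j\<bar> \<le> n\<close> by (intro Y_1_eq_0) auto
      then show "{k. fock_var k * Y (j - 2 * int k - 1) 1 \<noteq> 0} \<subseteq> {..n}"
        by (auto simp: not_less[symmetric])
    qed simp
    have lin: "Y i (sum g A) = (\<Sum>k\<in>A. Y i (g k))" for g and A :: "nat set"
    proof -
      interpret Y: Vector_Spaces.linear fscale fscale "Y i" by (rule Y_linear)
      show ?thesis by (rule Y.sum)
    qed
    have "of_int (j - 1) * vac (Y i (Y j 1)) = vac (Y i (fscale (of_int (j - 1)) (Y j 1)))"
      by (simp only: linearD(5)[OF Y_linear] lookup_fscale)
    also have "\<dots> = 2 * vac (Y i (\<Sum>k\<le>n. fock_var k * Y (j - 2 * int k - 1) 1))"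
      by (simp only: Y_1_derivative linearD(5)[OF Y_linear] S lookup_fscale)
    finally show ?thesis by (simp only: lin lookup_sum vac_Y_var)
  qed
  \<comment> \<open>The cut-offs leave room for the shift: the second sum is used at j - 2, and |j -
    2| is at most |j| + 2.\<close>
  have "of_int (j - 1) * vac (Y i (Y j 1)) =
      2 * (\<Sum>k\<le>Suc (N + 2). vac (Y (i + 2 * int k + 1) (Y (j - 2 * int k - 1) 1)))"
    by (rule *) (simp add: N_def)
  also have "\<dots> = 2 * vac (Y (i + 1) (Y (j - 1) 1)) +
      2 * (\<Sum>k\<le>N + 2. vac (Y (i + 2 + 2 * int k + 1) (Y (j - 2 - 2 * int k - 1) 1)))"
    by (subst sum.atMost_Suc_shift) (simp add: algebra_simps)
  also have "2 * (\<Sum>k\<le>N + 2. vac (Y (i + 2 + 2 * int k + 1) (Y (j - 2 - 2 * int k - 1) 1))) =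
      of_int (j - 2 - 1) * vac (Y (i + 2) (Y (j - 2) 1))"
    by (rule *[symmetric]) (simp add: N_def)
  finally show ?thesis by simp
qed

text \<open>The two-point function is c^2 a b (a + b)/(a - b) expanded in b/a; the factor a b
  accounts for the argument j - 1 of \<open>wt\<close>.\<close>

lemma vac_YY: "vac (Y i (Y j 1)) = (if i + j = 2 then wt (j - 1) (c * c) else 0)"
proof (induction "nat j" arbitrary: i j rule: less_induct)
  case less
  consider "j < 1" | "j = 1" | "j = 2" | "2 < j" by linarith
  then show ?case
  proof cases
    case 1
    then show ?thesis by (simp add: Y_1_eq_0 linearD[OF Y_linear] wt_def)
  next
    case 2
    then show ?thesis by (simp add: Y_1_1 linearD[OF Y_linear] vac_Y_1 wt_def)
  next
    case 3
    then show ?thesis using vac_YY_rec[of j i] less[of 1 "i + 1"] less[of 0 "i + 2"]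
      by (simp add: wt_def)
  next
    case 4
    have 1: "vac (Y (i + 1) (Y (j - 1) 1)) = (if i + j = 2 then c * c + c * c else 0)"
      using less[of "j - 1" "i + 1"] 4 by (simp add: wt_def)
    \<comment> \<open>At j = 3 the weight is not yet doubled, but then the prefactor j - 3 is
      zero.\<close>
    have 2: "of_int (j - 3) * vac (Y (i + 2) (Y (j - 2) 1)) =
        of_int (j - 3) * (if i + j = 2 then c * c + c * c else 0)"
      using less[of "j - 2" "i + 2"] 4 by (cases "j = 3") (simp_all add: wt_def)
    have "of_int (j - 1) * vac (Y i (Y j 1)) = of_int (j - 1) * (if i + j = 2 then wt (j - 1) (c * c) else 0)"
    proof -
      have "of_int (j - 3) * x + 2 * x = of_int (j - 1) * x" for x :: complex
        by (simp add: algebra_simps)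
      moreover have "wt (j - 1) (c * c) = c * c + c * c" using 4 by (simp add: wt_def)
      ultimately show ?thesis by (simp only: vac_YY_rec[of j i] 1 2)
    qed
    moreover have "of_int (j - 1) \<noteq> (0::complex)" using 4 unfolding of_int_eq_0_iff by linarith
    ultimately show ?thesis using mult_left_cancel by blast
  qed
qed

text \<open>
  The normally ordered product \<open>N(a,b)\<close>, determined by \<open>(a + b) N(a,b) = (a - b) Y(a) Y(b)\<close>.
\<close>

definition N :: "int \<Rightarrow> int \<Rightarrow> fock \<Rightarrow> fock" where
  "N i j f = hsum (\<lambda>n. sg n (Y (i + n) (Y (j - n) f)))"

lemma YY_vanish: "\<exists>M. \<forall>n\<ge>M. Y (i + a n) (Y (j - n) f) = 0"
proof -
  obtain M where "\<And>l. l < M \<Longrightarrow> Y l f = 0" using Y_bounded[of f] by blast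
  then have "Y (i + a n) (Y (j - n) f) = 0" if "j - M + 1 \<le> n" for n
    using that by (simp add: linearD[OF Y_linear])
  then show ?thesis by blast
qed

lemma N_linear: "flinear (N i j)"
proof -
  have "finite {n. wt n (sg n (Y (i + n) (Y (j - n) f))) \<noteq> 0}" for f
  proof -
    obtain M where "\<And>n. M \<le> n \<Longrightarrow> Y (i + n) (Y (j - n) f) = 0"
      using YY_vanish[of i "\<lambda>n. n" j f] by blast
    then show ?thesis by (intro wt_finite[of M]) simp
  qed
  then show ?thesis
    unfolding N_def[abs_def] hsum_def
    by (intro linear_Sum_any linear_wt linear_sg linear_comp[OF Y_linear Y_linear] vector_space_fock)
qed

text \<open>The alternating sign replaces x by -x in \<open>hsum\<close>, so \<open>N\<close> is the
  product multiplied by (1 - x)/(1 + x) with x = b/a; this is \<open>hsum_shift\<close>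
  again.\<close>

lemma N_rec: "N i j f + N (i + 1) (j - 1) f = Y i (Y j f) - Y (i + 1) (Y (j - 1) f)"
proof -
  obtain M where M: "\<And>n. M \<le> n \<Longrightarrow> Y (i + n) (Y (j - n) f) = 0"
    using YY_vanish[of i "\<lambda>n. n" j f] by blast
  have M': "M \<le> n + 1 \<Longrightarrow> Y (i + 1 + n) (Y (j - 1 - n) f) = 0" for n
    using M[of "n + 1"] by (simp add: algebra_simps)
  have "hsum (\<lambda>n. sg (n + 1) (Y (i + (n + 1)) (Y (j - (n + 1)) f))) = - N (i + 1) (j - 1) f"
  proof -
    have "- hsum (\<lambda>n. sg n (Y (i + 1 + n) (Y (j - 1 - n) f)))
        = hsum (\<lambda>n. - sg n (Y (i + 1 + n) (Y (j - 1 - n) f)))"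
      by (rule hsum_additive[of "M - 1"]) (simp_all add: M')
    then show ?thesis by (simp add: N_def algebra_simps)
  qed
  with hsum_shift[of M "\<lambda>n. sg n (Y (i + n) (Y (j - n) f))"] M show ?thesis
    by (simp add: N_def)
qed

lemma beta_N: "beta m (N i j f) = N i j (beta m f) - N (i - 2 * m - 1) j f - N i (j - 2 * m - 1) f"
proof -
  let ?q = "2 * m + 1"
  obtain M1 where M1: "\<And>n. M1 \<le> n \<Longrightarrow> Y (i + n) (Y (j - n) f) = 0"
    using YY_vanish[of i "\<lambda>n. n" j f] by blast
  obtain M2 where M2: "\<And>n. M2 \<le> n \<Longrightarrow> Y (i + n) (Y (j - n) (beta m f)) = 0"
    using YY_vanish[of i "\<lambda>n. n" j "beta m f"] by blast
  obtain M3 where M3: "\<And>n. M3 \<le> n \<Longrightarrow> Y (i - ?q + n) (Y (j - n) f) = 0"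
    using YY_vanish[of "i - ?q" "\<lambda>n. n" j f] by blast
  obtain M4 where M4: "\<And>n. M4 \<le> n \<Longrightarrow> Y (i + n) (Y (j - ?q - n) f) = 0"
    using YY_vanish[of i "\<lambda>n. n" "j - ?q" f] by blast
  have "beta m (N i j f) = hsum (\<lambda>n. beta m (sg n (Y (i + n) (Y (j - n) f))))"
    unfolding N_def by (rule hsum_additive[of M1]) (simp_all add: M1 linearD[OF beta_linear])
  also have "\<dots> = hsum (\<lambda>n. sg n (Y (i + n) (Y (j - n) (beta m f))) +
       (- sg n (Y (i - ?q + n) (Y (j - n) f)) + - sg n (Y (i + n) (Y (j - ?q - n) f))))"
    by (rule arg_cong[of _ _ hsum], rule ext)
       (simp add: sg_def beta_Y linearD[OF beta_linear] linearD[OF Y_linear] algebra_simps)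
  also have "\<dots> = N i j (beta m f) + (hsum (\<lambda>n. - sg n (Y (i - ?q + n) (Y (j - n) f))) +
        hsum (\<lambda>n. - sg n (Y (i + n) (Y (j - ?q - n) f))))"
  proof -
    have "hsum (\<lambda>n. - sg n (Y (i - ?q + n) (Y (j - n) f)) + - sg n (Y (i + n) (Y (j - ?q - n) f))) =
        hsum (\<lambda>n. - sg n (Y (i - ?q + n) (Y (j - n) f))) +
        hsum (\<lambda>n. - sg n (Y (i + n) (Y (j - ?q - n) f)))"
      by (rule hsum_add[of M3 _ M4]) (simp_all only: M3 M4 sg_0 minus_zero)
    then show ?thesis
      unfolding N_def
      by (subst hsum_add[of M2 _ "max M3 M4"]) (simp_all only: M2 M3 M4 sg_0 minus_zero add_0 max.bounded_iff)
  qed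
  also have "hsum (\<lambda>n. - sg n (Y (i - ?q + n) (Y (j - n) f))) = - N (i - ?q) j f"
    unfolding N_def by (rule hsum_additive[symmetric, of M3]) (simp_all add: M3)
  also have "hsum (\<lambda>n. - sg n (Y (i + n) (Y (j - ?q - n) f))) = - N i (j - ?q) f"
    unfolding N_def by (rule hsum_additive[symmetric, of M4]) (simp_all add: M4)
  finally show ?thesis by (simp add: algebra_simps)
qed

lemma N_vanish_right: "\<exists>M. \<forall>i j. j < M \<longrightarrow> N i j f = 0"
proof -
  obtain M where M: "\<And>l. l < M \<Longrightarrow> Y l f = 0" using Y_bounded[of f] by blast
  then have "N i j f = 0" if "j < M" for i j
    unfolding N_def using that by (intro hsum_eq_0) (simp add: linearD[OF Y_linear])
  then show ?thesis by blast
qed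

text \<open>The factor (a - b)/(a + b) cancels the singular part of the two-point function and
  leaves c^2 a b, which is symmetric. The recursion in j starts from the vanishing at j = 0.\<close>

lemma vac_N_1: "vac (N i j 1) = (if i = 1 \<and> j = 1 then c * c else 0)"
proof (cases "1 \<le> j")
  case False
  then have "N i j 1 = 0"
    unfolding N_def by (intro hsum_eq_0) (simp add: linearD[OF Y_linear] Y_1_eq_0)
  with False show ?thesis by simp
next
  case True
  have rec: "vac (N i j 1) + vac (N (i + 1) (j - 1) 1) =
      vac (Y i (Y j 1)) - vac (Y (i + 1) (Y (j - 1) 1))" for i j
    using N_rec[of i j 1] by (metis lookup_add lookup_minus)
  have z: "vac (N i 0 1) = 0" for i
    unfolding N_def by (subst hsum_eq_0) (simp_all add: linearD[OF Y_linear] Y_1_eq_0)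
  show ?thesis using True
  proof (induction j arbitrary: i rule: int_ge_induct)
    case base
    then show ?case using rec[of i 1] by (simp add: z vac_YY wt_def)
  next
    case (step j)
    then show ?case using rec[of i "j + 1"] by (cases "j = 1"; cases "i + j = 1") (auto simp: vac_YY wt_def)
  qed
qed

text \<open>The antisymmetric part of \<open>N\<close> has zero vacuum expectation, and its
  commutators with the modes stay in the family indexed by pairs.\<close>

lemma N_commute: "N i j f = N j i f"
proof -
  define Op where "Op = (\<lambda>(i, j) f. N i j f - N j i f)"
  have "Op (i, j) f = 0"
  proof (rule fock_operators_eq_0[of Op])
    show "flinear (Op a)" for a
      by (rule flinearI; cases a) (simp_all add: Op_def linearD[OF N_linear] Fock.scale_right_diff_distrib)
    show "vac (Op a 1) = 0" for a
      by (auto simp: Op_def lookup_minus vac_N_1 split: prod.split)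
    fix a :: "int \<times> int" and m f
    obtain i j where a: "a = (i, j)" by (cases a)
    have "beta m (Op a f) - Op a (beta m f) = - Op (i - 2 * m - 1, j) f - Op (i, j - 2 * m - 1) f"
      by (simp add: a Op_def linearD[OF beta_linear] beta_N)
    also have "\<dots> \<in> Fock.span (range (\<lambda>b. Op b f))"
      by (intro Fock.span_diff Fock.span_neg Fock.span_base) auto
    finally show "beta m (Op a f) - Op a (beta m f) \<in> Fock.span (range (\<lambda>b. Op b f))" .
  qed
  then show ?thesis by (simp add: Op_def)
qed

text \<open>Symmetry carries the bound on the right index over to the left one. This makes the sums
  along i + j = t finite in both directions.\<close>

lemma N_vanish: "\<exists>M. \<forall>i j. i < M \<or> j < M \<longrightarrow> N i j f = 0"
  using N_vanish_right[of f] N_commute by metis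

text \<open>The two factors are inverse to each other: both sides change by the same amount from (i
  + 1, j - 1) to (i, j) and vanish for small j, where the induction starts.\<close>

lemma YY_eq_N: "Y i (Y j f) = hsum (\<lambda>n. N (i + n) (j - n) f)"
proof -
  obtain M where M: "\<And>i j. j < M \<Longrightarrow> N i j f = 0" using N_vanish_right[of f] by blast
  obtain M' where M': "\<And>l. l < M' \<Longrightarrow> Y l f = 0" using Y_bounded[of f] by blast
  have rec: "hsum (\<lambda>n. N (i + n) (j - n) f) =
      hsum (\<lambda>n. N (i + 1 + n) (j - 1 - n) f) + N i j f + N (i + 1) (j - 1) f" for i j
    using hsum_shift[of "j - M + 1" "\<lambda>n. N (i + n) (j - n) f"] by (simp add: M algebra_simps)
  show ?thesis
  proof (cases "min M M' - 1 \<le> j")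
    case False
    then have "hsum (\<lambda>n. N (i + n) (j - n) f) = 0"
      by (intro hsum_eq_0) (simp add: M)
    then show ?thesis using False M' by (simp add: linearD[OF Y_linear])
  next
    case True
    then show ?thesis
    proof (induction j arbitrary: i rule: int_ge_induct)
      case base
      then have "hsum (\<lambda>n. N (i + n) (min M M' - 1 - n) f) = 0"
        by (intro hsum_eq_0) (simp add: M)
      then show ?case using M' by (simp add: linearD[OF Y_linear])
    next
      case (step j)
      then show ?case
        using N_rec[of i "j + 1" f] rec[of i "j + 1"] step.IH[of "i + 1"]
        by (simp add: algebra_simps)
    qed
  qed
qed

text \<open>The coefficients of \<open>N(-a,a)\<close> and of \<open>a \<partial>N(a,b)/\<partial>a\<close> at \<open>(-a,a)\<close>.\<close>

definition Z :: "int \<Rightarrow> fock \<Rightarrow> fock" where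
  "Z t f = (\<Sum>i. sg i (N i (t - i) f))"

definition Z' :: "int \<Rightarrow> fock \<Rightarrow> fock" where
  "Z' t f = (\<Sum>i. fscale (of_int i) (sg i (N i (t - i) f)))"

lemma N_finite: "finite {i. N (i + a) (t - i) f \<noteq> 0}"
proof -
  obtain M where M: "\<And>i j. i < M \<or> j < M \<Longrightarrow> N i j f = 0" using N_vanish[of f] by blast
  show ?thesis by (rule finite_support_int[of "M - a" _ "t - M"]) (auto simp: M)
qed

lemma Z_finite: "finite {i. fscale (r i) (sg i (N (i + a) (t - i) f)) \<noteq> 0}"
  by (rule finite_subset[OF _ N_finite[of a t f]]) auto

lemma Z_linear: "flinear (Z t)"
  unfolding Z_def[abs_def]
  using Z_finite[of "\<lambda>_. 1" 0 t]
  by (intro linear_Sum_any linear_sg N_linear vector_space_fock) simp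

lemma Z'_linear: "flinear (Z' t)"
  unfolding Z'_def[abs_def]
  using Z_finite[of of_int 0 t]
  by (intro linear_Sum_any linear_scaled linear_sg N_linear vector_space_fock) simp

text \<open>A mode shifts one of the two indices by the odd number 2m + 1. Reindexing the shift of i
  flips the sign, so the two contributions cancel except for the difference of the weights.\<close>

lemma beta_weighted_sum:
  "beta m (\<Sum>i. fscale (r i) (sg i (N i (t - i) f))) =
    (\<Sum>i. fscale (r i) (sg i (N i (t - i) (beta m f)))) +
    (\<Sum>i. fscale (r (i + (2 * m + 1)) - r i) (sg i (N i (t - 2 * m - 1 - i) f)))"
proof -
  let ?q = "2 * m + 1"
  let ?g = "\<lambda>i. fscale (r i) (sg i (N (i - ?q) (t - i) f))"
  have f0: "finite {i. fscale (r i) (sg i (N i (t - i) f)) \<noteq> 0}"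
    and f1: "finite {i. fscale (r i) (sg i (N i (t - i) (beta m f))) \<noteq> 0}"
    and f2: "finite {i. ?g i \<noteq> 0}"
    and f3: "finite {i. fscale (r i) (sg i (N i (t - ?q - i) f)) \<noteq> 0}"
    and f4: "finite {i. fscale (r (i + ?q)) (sg i (N i (t - ?q - i) f)) \<noteq> 0}"
    using Z_finite[of r 0 t f] Z_finite[of r 0 t "beta m f"] Z_finite[of r "- ?q" t f, unfolded add_uminus_conv_diff]
      Z_finite[of r 0 "t - ?q" f] Z_finite[of "\<lambda>i. r (i + ?q)" 0 "t - ?q" f]
    by simp_all
  have "beta m (\<Sum>i. fscale (r i) (sg i (N i (t - i) f))) =
      (\<Sum>i. beta m (fscale (r i) (sg i (N i (t - i) f))))"
    by (rule Sum_any_linear[OF beta_linear f0])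
  also have "\<dots> = (\<Sum>i. fscale (r i) (sg i (N i (t - i) (beta m f))) -
      (?g i + fscale (r i) (sg i (N i (t - ?q - i) f))))"
    by (rule Sum_any.cong)
       (simp add: linearD[OF beta_linear] sg_def beta_N Fock.scale_right_diff_distrib algebra_simps)
  also have "\<dots> = (\<Sum>i. fscale (r i) (sg i (N i (t - i) (beta m f)))) -
      ((\<Sum>i. ?g i) + (\<Sum>i. fscale (r i) (sg i (N i (t - ?q - i) f))))"
  proof -
    have "finite {i. ?g i + fscale (r i) (sg i (N i (t - ?q - i) f)) \<noteq> 0}"
      by (rule finite_subset[OF _ finite_UnI[OF f2 f3]]) auto
    then show ?thesis by (simp add: Sum_any_diff[OF f1] Sum_any.distrib[OF f2 f3])
  qed
  also have "(\<Sum>i. ?g i) = (\<Sum>i. ?g (i + ?q))" by (rule Sum_any_shift[symmetric])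
  also have "\<dots> = (\<Sum>i. - fscale (r (i + ?q)) (sg i (N i (t - ?q - i) f)))"
    by (rule Sum_any.cong) (simp add: sg_def algebra_simps)
  also have "\<dots> = - (\<Sum>i. fscale (r (i + ?q)) (sg i (N i (t - ?q - i) f)))"
    by (rule Sum_any_additive[OF f4, symmetric]) simp_all
  finally have "beta m (\<Sum>i. fscale (r i) (sg i (N i (t - i) f))) =
    (\<Sum>i. fscale (r i) (sg i (N i (t - i) (beta m f)))) +
    ((\<Sum>i. fscale (r (i + ?q)) (sg i (N i (t - ?q - i) f))) -
     (\<Sum>i. fscale (r i) (sg i (N i (t - ?q - i) f))))"
    by simp
  with Sum_any_diff[OF f4 f3] show ?thesis
    by (simp only: Fock.scale_left_diff_distrib diff_diff_eq)
qed

text \<open>With constant weight the sum commutes with all modes and is therefore a scalar. Its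
  vacuum value comes from i = j = 1 alone: the sign -1 times c^2 = -4.\<close>

lemma Z_eq: "Z t f = (if t = 2 then fscale 4 f else 0)"
proof -
  define Op where "Op = (\<lambda>(_::unit) f. Z t f - fscale (if t = 2 then 4 else 0) f)"
  have "Op () f = 0"
  proof (rule fock_operators_eq_0[of Op])
    show "flinear (Op a)" for a
      by (rule flinearI) (simp_all add: Op_def linearD[OF Z_linear] Fock.scale_right_diff_distrib
          Fock.scale_right_distrib mult.commute)
    have "vac (Z t 1) = (\<Sum>i. sg i (vac (N i (t - i) 1)))"
      unfolding Z_def using Z_finite[of "\<lambda>_. 1" 0 t 1]
      by (subst Sum_any_additive[where h = vac]) (auto simp: lookup_add sg_def intro!: Sum_any.cong)
    also have "\<dots> = (\<Sum>i::int. if i = 1 then (if t = 2 then 4 else 0) else 0)"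
      by (rule Sum_any.cong) (auto simp: vac_N_1 sg_def c_square)
    finally show "vac (Op a 1) = 0" for a by (simp add: Op_def lookup_minus)
    show "beta m (Op a f) - Op a (beta m f) \<in> Fock.span (range (\<lambda>b. Op b f))" for a m f
      using beta_weighted_sum[of m "\<lambda>_. 1" t f]
      by (simp add: Op_def linearD[OF beta_linear] Z_def Fock.span_zero)
  qed
  then show ?thesis by (simp add: Op_def split: if_splits)
qed

text \<open>With weight i, the commutator with beta(m) is (2m + 1) times a value of
  \<open>Z\<close>, namely 4(2m + 1) when t = 2m + 3. The same comes from -8 times the opposite
  mode, because [beta(k), beta(-k)] = -k with k = m + 1/2.\<close>

lemma Z'_eq:
  "Z' t f = (if t = 2 then fscale 4 f else 0) - (if odd t then fscale 8 (beta ((1 - t) div 2) f) else 0)"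
proof -
  define Op where "Op = (\<lambda>(_::unit) f. Z' t f - fscale (if t = 2 then 4 else 0) f +
      fscale (if odd t then 8 else 0) (beta ((1 - t) div 2) f))"
  have "Op () f = 0"
  proof (rule fock_operators_eq_0[of Op])
    show "flinear (Op a)" for a
      by (rule flinearI) (simp_all add: Op_def linearD[OF Z'_linear] linearD[OF beta_linear]
          Fock.scale_right_diff_distrib Fock.scale_right_distrib mult.commute)
    have "vac (Z' t 1) = (\<Sum>i. of_int i * sg i (vac (N i (t - i) 1)))"
      unfolding Z'_def using Z_finite[of of_int 0 t 1]
      by (subst Sum_any_additive[where h = vac]) (auto simp: lookup_add sg_def intro!: Sum_any.cong)
    also have "\<dots> = (\<Sum>i::int. if i = 1 then (if t = 2 then 4 else 0) else 0)"
      by (rule Sum_any.cong) (auto simp: vac_N_1 sg_def c_square)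
    finally have "vac (Z' t 1) = (if t = 2 then 4 else 0)" by simp
    moreover have "vac (beta n 1) = 0" for n
      by (cases "n < 0") (simp_all add: vac_beta_neg beta_1)
    ultimately show "vac (Op a 1) = 0" for a by (simp add: Op_def lookup_minus lookup_add)
    show "beta m (Op a f) - Op a (beta m f) \<in> Fock.span (range (\<lambda>b. Op b f))" for a m f
    proof -
      have "(\<Sum>i. fscale (of_int (i + (2 * m + 1)) - of_int i) (sg i (N i (t - 2 * m - 1 - i) f))) =
          (\<Sum>i. fscale (of_int (2 * m + 1)) (sg i (N i (t - 2 * m - 1 - i) f)))"
        by (rule Sum_any.cong) simp
      also have "\<dots> = fscale (of_int (2 * m + 1)) (Z (t - 2 * m - 1) f)"
        unfolding Z_def using Z_finite[of "\<lambda>_. 1" 0 "t - 2 * m - 1" f]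
        by (intro Sum_any_additive[symmetric]) (simp_all add: Fock.scale_right_distrib)
      finally have "beta m (Z' t f) = Z' t (beta m f) + fscale (of_int (2 * m + 1)) (Z (t - 2 * m - 1) f)"
        using beta_weighted_sum[of m of_int t f] by (simp add: Z'_def)
      moreover have "fscale (if odd t then 8 else 0) (beta m (beta ((1 - t) div 2) f)) =
          fscale (if odd t then 8 else 0) (beta ((1 - t) div 2) (beta m f)) -
            fscale (of_int (2 * m + 1)) (Z (t - 2 * m - 1) f)"
      \<comment> \<open>Precisely here \<open>Z (t - 2 * m - 1)\<close> is nonzero and the two beta
        modes fail to commute.\<close>
      proof (cases "t = 2 * m + 3")
        case True
        have "8 * - (of_int m + 1 / 2) = - (of_int (2 * m + 1) * (4::complex))" by simp
        then have comm: "fscale 8 (beta m (beta (- m - 1) f)) =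
            fscale 8 (beta (- m - 1) (beta m f)) - fscale (of_int (2 * m + 1)) (fscale 4 f)"
          by (subst beta_commutator) (simp only: Fock.scale_right_distrib Fock.scale_scale, simp)
        have Zt: "Z (t - 2 * m - 1) f = fscale 4 f" by (simp add: Z_eq True)
        from True have "(1 - t) div 2 = - m - 1" "odd t" by auto
        then show ?thesis
          using comm Zt by (simp only: if_True simp_thms)
      next
        case False
        then have "odd t \<Longrightarrow> m + (1 - t) div 2 + 1 \<noteq> 0" by presburger
        with False show ?thesis
          by (simp add: beta_commutator[of m "(1 - t) div 2"] Z_eq)
      qed
      ultimately have "beta m (Op a f) - Op a (beta m f) = 0"
        by (simp add: Op_def linearD[OF beta_linear])
      then show ?thesis by (simp add: Fock.span_zero)
    qed
  qed
  then show ?thesis by (auto simp: Op_def algebra_simps split: if_splits)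
qed

end

section \<open>Restricted modules\<close>

lemma lin_ext_superset:
  assumes "vector_space s" "finite K" "Poly_Mapping.keys a \<subseteq> K"
  shows "lin_ext s \<rho> a v = (\<Sum>b\<in>K. s (Poly_Mapping.lookup a b) (\<rho> b v))"
proof -
  interpret vector_space s by fact
  show ?thesis unfolding lin_ext_def
    by (rule sum.mono_neutral_left) (use assms in \<open>auto simp: in_keys_iff\<close>)
qed

lemma lin_ext_add:
  assumes "vector_space s"
  shows "lin_ext s \<rho> (a + b) v = lin_ext s \<rho> a v + lin_ext s \<rho> b v"
proof -
  interpret vector_space s by fact
  let ?K = "Poly_Mapping.keys a \<union> Poly_Mapping.keys b"
  have "finite ?K" "Poly_Mapping.keys (a + b) \<subseteq> ?K" by (simp_all add: Poly_Mapping.keys_add)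
  then show ?thesis
    by (simp add: lin_ext_superset[OF assms, of ?K] lookup_add scale_left_distrib sum.distrib)
qed

lemma lin_ext_single:
  assumes "vector_space s"
  shows "lin_ext s \<rho> (Poly_Mapping.single b c) v = s c (\<rho> b v)"
  by (subst lin_ext_superset[OF assms, of "{b}"]) auto

lemma lin_ext_0 [simp]: "lin_ext s \<rho> 0 v = 0"
  by (simp add: lin_ext_def)

lemma pm_scale_mult_single: "pm_scale (*) c (Poly_Mapping.single b x) = Poly_Mapping.single b (c * x)"
  by (simp add: pm_scale_def)

lemma neg_one_powi: "(-1 :: complex) powi k = (if even k then 1 else - 1)"
  by (cases "0 \<le> k") (auto simp: power_int_def even_nat_iff)

locale restricted_atw_module =
  fixes s :: "complex \<Rightarrow> 'u \<Rightarrow> 'u::ab_group_add" and \<rho> :: "atw \<Rightarrow> 'u \<Rightarrow> 'u"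
  assumes module: "lie_super_module atw_odd atw_bracket s \<rho>"
    and restricted: "atw_restricted \<rho>"
    and C: "\<rho> tw_C u = s (- 3) u"
begin

lemma vector_space: "vector_space s"
  using module by (simp add: lie_super_module_def)

sublocale U: vector_space s by (rule vector_space)

lemma linear: "Vector_Spaces.linear s s (\<rho> a)"
  using module by (simp add: lie_super_module_def)

abbreviation T :: "int \<Rightarrow> 'u \<Rightarrow> 'u" where
  "T n \<equiv> \<rho> (tw_T n)"

definition G :: "int \<Rightarrow> 'u \<Rightarrow> 'u" where
  "G p = \<rho> (tw_G (- p - 3))"

lemma G_dist_eq: "G_dist \<rho> = G"
  by (simp add: fun_eq_iff G_dist_def G_def)

lemma G_linear: "Vector_Spaces.linear s s (G p)"
  unfolding G_def by (rule linear)

lemma central: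
  assumes "a \<notin> atw_odd"
  shows "\<rho> a (\<rho> b v) = \<rho> b (\<rho> a v)"
proof -
  have "atw_bracket a b = 0" using assms by (cases a) (auto simp: atw_odd_def)
  moreover have "\<rho> a (\<rho> b v) - \<rho> b (\<rho> a v) = lin_ext s \<rho> (atw_bracket a b) v"
    using module assms unfolding lie_super_module_def by metis
  ultimately show ?thesis by simp
qed

lemma T_commute: "T n (\<rho> a v) = \<rho> a (T n v)"
  by (rule central) (auto simp: atw_odd_def)

text \<open>The defining relation at r = -(p + 3)/2 and -(q + 3)/2: then (-1)^(2r+1) = (-1)^p, and C
  = -3 turns (C/3)(r^2 - 1/4) into -((p + 3)^2 - 1)/4.\<close>

lemma G_anticommutator:
  "G p (G q u) + G q (G p u) = sg p
     (if odd (p + q) then s (of_int (p - q) / 2) (T ((- p - q - 6) div 2) u)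
      else s 2 (\<rho> (tw_S ((- p - q - 6) div 2)) u) +
        (if p + q = - 6 then s (- ((of_int p + 3)\<^sup>2 - 1) / 4) u else 0))"
proof -
  define k l where "k = - p - 3" and "l = - q - 3"
  have "G p (G q u) + G q (G p u) = lin_ext s \<rho> (atw_bracket (tw_G k) (tw_G l)) u"
  proof -
    have "tw_G k \<in> atw_odd" "tw_G l \<in> atw_odd" by (auto simp: atw_odd_def)
    then show ?thesis using module unfolding lie_super_module_def G_def k_def l_def by metis
  qed
  also have "\<dots> = sg p
     (if odd (p + q) then s (of_int (p - q) / 2) (T ((- p - q - 6) div 2) u)
      else s 2 (\<rho> (tw_S ((- p - q - 6) div 2)) u) +
        (if p + q = - 6 then s (- ((of_int p + 3)\<^sup>2 - 1) / 4) u else 0))"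
  proof (cases "even (p + q)")
    case False
    have "(k + l) div 2 = (- p - q - 6) div 2" by (simp add: k_def l_def)
    moreover from False have "odd (k + l)" by (auto simp: k_def l_def)
    moreover from this have "k + l \<noteq> 0" by (metis even_zero)
    moreover have "of_int k / 2 - of_int l / 2 = - (of_int (p - q) / 2 :: complex)"
      by (simp add: k_def l_def field_simps)
    moreover have "even (k + 1) = even p" by (simp add: k_def)
    ultimately have "lin_ext s \<rho> (atw_bracket (tw_G k) (tw_G l)) u =
        s ((if even p then 1 else - 1) * (of_int (p - q) / 2)) (T ((- p - q - 6) div 2) u)"
      by (simp only: atw_bracket.simps if_False if_True not_True_eq_False not_False_eq_True neg_one_powi
            add_0_right diff_0 single_uminus[symmetric] minus_minus pm_scale_mult_single
            lin_ext_single[OF vector_space])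
    then show ?thesis using False by (simp add: sg_def del: of_int_diff)
  next
    case True
    have "(k + l) div 2 = (- p - q - 6) div 2" by (simp add: k_def l_def)
    from True have "even (k + l)" by (auto simp: k_def l_def)
    have "(k + l = 0) = (p + q = - 6)" by (auto simp: k_def l_def)
    have z: "((of_int k / 2)\<^sup>2 - 1 / 4) / 3 * - 3 = (- ((of_int p + 3)\<^sup>2 - 1) / 4 :: complex)"
      by (simp add: k_def power2_eq_square field_simps)
    have "even (k + 1) = even p" by (simp add: k_def)
    moreover note \<open>even (k + l)\<close> \<open>(k + l = 0) = _\<close> \<open>(k + l) div 2 = _\<close>
    moreover have "pm_scale (*) c (0 :: atw \<Rightarrow>\<^sub>0 complex) = 0" for c
      by (rule poly_mapping_eqI) (simp add: lookup_pm_scale[OF vector_space_complex_mult])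
    moreover have "pm_scale (*) c (x + y) = pm_scale (*) c x + pm_scale (*) c y"
      for c :: complex and x y :: "atw \<Rightarrow>\<^sub>0 complex"
      by (rule poly_mapping_eqI) (simp add: lookup_add lookup_pm_scale[OF vector_space_complex_mult] distrib_left)
    ultimately have "lin_ext s \<rho> (atw_bracket (tw_G k) (tw_G l)) u =
        s ((if even p then 1 else - 1) * 2) (\<rho> (tw_S ((- p - q - 6) div 2)) u) +
        (if p + q = - 6 then s ((if even p then 1 else - 1) * (((of_int k / 2)\<^sup>2 - 1 / 4) / 3)) (s (- 3) u) else 0)"
      by (simp only: atw_bracket.simps if_True not_True_eq_False if_False diff_0_right neg_one_powi
          lin_ext_add[OF vector_space] pm_scale_mult_single lin_ext_single[OF vector_space])
         (simp add: pm_scale_mult_single lin_ext_single[OF vector_space] C)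
    also have "\<dots> = sg p (s 2 (\<rho> (tw_S ((- p - q - 6) div 2)) u) +
        (if p + q = - 6 then s (((of_int k / 2)\<^sup>2 - 1 / 4) / 3 * - 3) u else 0))"
    proof -
      have "s ((if even p then 1 else - 1) * 2) x + (if d then s ((if even p then 1 else - 1) * y) (s (- 3) v) else 0) =
          sg p (s 2 x + (if d then s (y * - 3) v else 0))" for x y v d
        by (auto simp: sg_def)
      then show ?thesis .
    qed
    finally show ?thesis using True z by (simp only: if_False not_True_eq_False)
  qed
  finally show ?thesis .
qed

lemma G_bounded: "\<exists>M. \<forall>p<M. G p u = 0"
proof -
  obtain N where "\<And>n. N \<le> n \<Longrightarrow> \<rho> (tw_G n) u = 0"
    using restricted unfolding atw_restricted_def by blast
  then have "G p u = 0" if "p < - N - 3" for p using that by (simp add: G_def)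
  then show ?thesis by blast
qed

text \<open>Restrictedness bounds p only for each vector \<open>G q u\<close> separately. The bound
  is uniform because \<open>G q u\<close> vanishes for small q, which leaves finitely many q up to
  b.\<close>

lemma GG_bounded: "\<exists>M. \<forall>p<M. \<forall>q\<le>b. G p (G q u) = 0"
proof -
  obtain M where M: "\<And>p. p < M \<Longrightarrow> G p u = 0" using G_bounded by blast
  have "\<exists>M'. \<forall>p<M'. \<forall>q\<in>Q. G p (G q u) = 0" if "finite Q" for Q
    using that
  proof (induction Q rule: finite_induct)
    case (insert q Q)
    then obtain M1 where "\<forall>p<M1. \<forall>q\<in>Q. G p (G q u) = 0" by blast
    moreover obtain M2 where "\<forall>p<M2. G p (G q u) = 0" using G_bounded by blast
    ultimately show ?case by (intro exI[of _ "min M1 M2"]) auto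
  qed simp
  from this[of "{M..b}"] obtain M' where M': "\<forall>p<M'. \<forall>q\<in>{M..b}. G p (G q u) = 0" by auto
  have "G p (G q u) = 0" if "p < M'" "q \<le> b" for p q
  proof (cases "q < M")
    case True
    then show ?thesis by (simp add: M linearD[OF G_linear])
  next
    case False
    then show ?thesis using M' that by auto
  qed
  then show ?thesis by blast
qed

text \<open>The coefficient of \<open>a\<^sup>p b\<^sup>q\<close> in \<open>(a + b)/(a - b) \<G>(a) \<G>(b)\<close>.\<close>

definition A :: "int \<Rightarrow> int \<Rightarrow> 'u \<Rightarrow> 'u" where
  "A p q u = hsum (\<lambda>n. G (p + n) (G (q - n) u))"

lemma GG_vanish: "\<exists>M. \<forall>n\<ge>M. G (p + n) (G (q - n) u) = 0"
proof -
  obtain M where "\<And>l. l < M \<Longrightarrow> G l u = 0" using G_bounded[of u] by blast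
  then have "G (p + n) (G (q - n) u) = 0" if "q - M + 1 \<le> n" for n
    using that by (simp add: linearD[OF G_linear])
  then show ?thesis by blast
qed

lemma A_rec: "A p q u = A (p + 1) (q - 1) u + G p (G q u) + G (p + 1) (G (q - 1) u)"
proof -
  obtain M where "\<And>n. M \<le> n \<Longrightarrow> G (p + n) (G (q - n) u) = 0" using GG_vanish by blast
  then have "hsum (\<lambda>n. G (p + n) (G (q - n) u)) =
      hsum (\<lambda>n. G (p + (n + 1)) (G (q - (n + 1)) u)) + G (p + 0) (G (q - 0) u) + G (p + 1) (G (q - 1) u)"
    by (rule hsum_shift)
  moreover have "p + (n + 1) = p + 1 + n" "q - (n + 1) = q - 1 - n" for n by simp_all
  ultimately show ?thesis by (simp only: A_def diff_0_right add_0_right)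
qed

text \<open>Along a line of constant p + q, \<open>A_rec\<close> changes the left side by two
  neighbouring anticommutators. The claimed right side obeys the same recursion, so agreement at one
  point of the line suffices.\<close>

lemma A_commutator:
  "A p q u - A q p u = sg p
     (if odd (p + q) then s (- 1 / 2) (T ((- p - q - 6) div 2) u)
      else if p + q = - 6 then s ((of_int p + 3) / 4) u else 0)" (is "?D p q = ?E p q")
proof -
  have rec: "?D p q = ?D (p + 1) (q - 1) + (G p (G q u) + G q (G p u)) +
      (G (p + 1) (G (q - 1) u) + G (q - 1) (G (p + 1) u))" for p q
    using A_rec[of p q u] A_rec[of "q - 1" "p + 1" u] by (simp add: algebra_simps)
  \<comment> \<open>The two S-terms have opposite signs and cancel. The quadratic terms leave ((p +
    4)^2 - (p + 3)^2)/4 = (p + 3)/4 + (p + 4)/4, the origin of the linear central term.\<close>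
  have rec': "?E p q = ?E (p + 1) (q - 1) + (G p (G q u) + G q (G p u)) +
      (G (p + 1) (G (q - 1) u) + G (q - 1) (G (p + 1) u))" for p q
  proof -
    have idx: "p + 1 + (q - 1) = p + q" "- (p + 1) - (q - 1) - 6 = - p - q - 6" by simp_all
    have scl: "s a x = - s a' x + s b x - s b' x" if "a = - a' + b - b'" for a a' b b' x
      unfolding that by (simp only: U.scale_left_distrib U.scale_left_diff_distrib U.scale_minus_left)
    show ?thesis
    proof (cases "even (p + q)")
      case False
      let ?x = "T ((- p - q - 6) div 2) u"
      have "s (- 1 / 2) ?x = - s (- 1 / 2) ?x + s (of_int (p - q) / 2) ?x - s (of_int (p + 1 - (q - 1)) / 2) ?x"
        by (rule scl) (simp add: field_simps)
      from arg_cong[OF this, of "sg p"] False show ?thesis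
        by (simp only: G_anticommutator idx sg_Suc sg_add sg_diff sg_uminus if_True not_False_eq_True)
           (simp only: diff_conv_add_uminus minus_add_distrib)
    next
      case True
      let ?S = "s 2 (\<rho> (tw_S ((- p - q - 6) div 2)) u)"
      let ?c = "\<lambda>y. if p + q = - 6 then s y u else 0"
      have "?c ((of_int p + 3) / 4) = - ?c ((of_int (p + 1) + 3) / 4) +
          (?S + ?c (- ((of_int p + 3)\<^sup>2 - 1) / 4)) - (?S + ?c (- ((of_int (p + 1) + 3)\<^sup>2 - 1) / 4))"
        using scl[of "(of_int p + 3) / 4" "(of_int (p + 1) + 3) / 4" "- ((of_int p + 3)\<^sup>2 - 1) / 4"
            "- ((of_int (p + 1) + 3)\<^sup>2 - 1) / 4" u]
        by (simp add: power2_eq_square field_simps)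
      from arg_cong[OF this, of "sg p"] True show ?thesis
        by (simp only: G_anticommutator idx sg_Suc sg_add sg_diff sg_uminus if_False not_True_eq_False)
           (simp only: diff_conv_add_uminus minus_add_distrib)
    qed
  qed
  define t where "t = p + q"
  have const: "?D p q - ?E p q = ?D (p + 1) (q - 1) - ?E (p + 1) (q - 1)" for p q
    by (subst rec, subst rec') simp
  define F where "F p = ?D p (t - p) - ?E p (t - p)" for p
  have F: "F (p + 1) = F p" for p
    using const[of p "t - p"] unfolding F_def by (simp only: diff_diff_eq)
  have "F p = 0"
  \<comment> \<open>Start at the middle of the line: for even t both sides vanish at p = q, and for
    odd t neighbouring indices give a single anticommutator by one use of
    \<open>A_rec\<close>.\<close>
  proof (induction p rule: int_induct[where k = "t div 2"])
    case base
    show ?case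
    proof (cases "even t")
      case True
      then have "t - t div 2 = t div 2" by auto
      with True show ?thesis by (auto simp: F_def)
    next
      case False
      then obtain p where "t = 2 * p + 1" by (elim oddE)
      then show ?thesis
        using A_rec[of p "p + 1" u] G_anticommutator[of p "p + 1" u] by (simp add: F_def)
    qed
  next
    case (step1 i)
    then show ?case by (simp add: F)
  next
    case (step2 i)
    then show ?case using F[of "i - 1"] by simp
  qed
  then show ?thesis by (simp only: F_def t_def add_diff_cancel_left' right_minus_eq)
qed

end

lemma Sum_any_nested:
  assumes "finite {(a, b). g a b \<noteq> 0}"
  shows "(\<Sum>a. \<Sum>b. g a b) = (\<Sum>(a, b). g a b)"
proof (rule Sum_any.cartesian_product)
  let ?F = "{(a, b). g a b \<noteq> 0}"
  show "finite (fst ` ?F \<times> snd ` ?F)" using assms by simp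
  show "{a. \<exists>b. g a b \<noteq> 0} \<times> {b. \<exists>a. g a b \<noteq> 0} \<subseteq> fst ` ?F \<times> snd ` ?F"
    by (force simp: image_iff)
qed

lemma Sum_any_nested3:
  assumes "finite {(a, b, c). g a b c \<noteq> 0}"
  shows "(\<Sum>a. \<Sum>b. \<Sum>c. g a b c) = (\<Sum>(a, b, c). g a b c)"
proof -
  let ?F = "{(a, b, c). g a b c \<noteq> 0}"
  have "finite {(b, c). g a b c \<noteq> 0}" for a
    by (rule finite_subset[OF _ finite_imageI[OF assms, of snd]]) (force simp: image_iff)
  then have "(\<Sum>a. \<Sum>b. \<Sum>c. g a b c) = (\<Sum>a. \<Sum>bc. g a (fst bc) (snd bc))"
    by (simp add: Sum_any_nested case_prod_unfold)
  also have "\<dots> = (\<Sum>(a, bc). g a (fst bc) (snd bc))"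
    by (rule Sum_any_nested) (use assms in \<open>simp add: case_prod_unfold\<close>)
  finally show ?thesis by (simp add: case_prod_unfold)
qed

lemma Sum_any_bij: "bij h \<Longrightarrow> Sum_any g = (\<Sum>x. g (h x))"
  by (rule Sum_any.reindex_cong) (auto simp: o_def)

lemma finite_support_bij:
  assumes "bij h" "finite {x. g (h x) \<noteq> 0}" shows "finite {x. g x \<noteq> 0}"
proof -
  have "{x. g x \<noteq> 0} = h ` {x. g (h x) \<noteq> 0}"
    using bij_is_surj[OF assms(1)] by (auto simp: image_iff)
  then show ?thesis using assms(2) by simp
qed

section \<open>The action on the tensor product\<close>

locale tensor_action = vertex_operator Y c + restricted_atw_module s \<rho>
  for Y c and s :: "complex \<Rightarrow> 'u \<Rightarrow> 'u::ab_group_add" and \<rho>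
begin

abbreviation tn :: "'u \<Rightarrow> fock \<Rightarrow> (nat \<Rightarrow>\<^sub>0 nat) \<Rightarrow>\<^sub>0 'u" where
  "tn \<equiv> tens s"

abbreviation pms :: "complex \<Rightarrow> ((nat \<Rightarrow>\<^sub>0 nat) \<Rightarrow>\<^sub>0 'u) \<Rightarrow> ((nat \<Rightarrow>\<^sub>0 nat) \<Rightarrow>\<^sub>0 'u)" where
  "pms \<equiv> pm_scale s"

lemma vector_space_tensor: "Vector_Spaces.vector_space pms"
  by (rule vector_space_pm_scale[OF vector_space])

sublocale P: Vector_Spaces.vector_space pms
  by (rule vector_space_tensor)

lemmas tn_bilinear = tens_bilinear[OF vector_space]

lemma tn_linear1: "Vector_Spaces.linear s pms (\<lambda>u. tn u f)"
  by (rule linearI[OF vector_space vector_space_tensor]) (simp_all add: tn_bilinear)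

lemma tn_linear2: "Vector_Spaces.linear fscale pms (tn u)"
  by (rule linearI[OF vector_space_fock vector_space_tensor]) (simp_all add: tn_bilinear)

lemmas tn_simps = linearD[OF tn_linear1] linearD[OF tn_linear2]

lemma tn_sg: "tn (sg n u) f = sg n (tn u f)" "tn u (sg n f) = sg n (tn u f)"
  by (simp_all add: sg_def tn_simps)

lemma tensor_induct [case_names add tens]:
  assumes "\<And>x y. R x \<Longrightarrow> R y \<Longrightarrow> R (x + y)" "\<And>u f. R (tn u f)"
  shows "R w"
proof -
  have R0: "R 0" using assms(2)[of 0 0] by (simp add: tn_simps)
  have "R (\<Sum>k\<in>K. tn (Poly_Mapping.lookup w k) (Poly_Mapping.single k 1))" if "finite K" for K
    using that by (induction K rule: finite_induct) (auto intro: assms R0)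
  from this[of "Poly_Mapping.keys w"] show ?thesis
    by (simp add: tens_single[OF vector_space] sum_single_keys[OF vector_space])
qed

lemmas op_linear = tensor_op_linear[OF vector_space]
lemmas op_tens = tensor_op_tens[OF vector_space]

lemma GY_linear: "Vector_Spaces.linear pms pms (tensor_op s (G l) (Y k))"
  by (rule op_linear[OF G_linear Y_linear])

definition X :: "int \<Rightarrow> ((nat \<Rightarrow>\<^sub>0 nat) \<Rightarrow>\<^sub>0 'u) \<Rightarrow> ((nat \<Rightarrow>\<^sub>0 nat) \<Rightarrow>\<^sub>0 'u)" where
  "X k w = (\<Sum>l. tensor_op s (G l) (Y (k - l)) w)"

lemma X_finite_tens: "finite {l. tn (G l u) (Y (k - l) f) \<noteq> 0}"
proof -
  obtain M where "\<And>p. p < M \<Longrightarrow> G p u = 0" using G_bounded by blast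
  moreover obtain M' where "\<And>p. p < M' \<Longrightarrow> Y p f = 0" using Y_bounded by blast
  ultimately show ?thesis
    by (intro finite_support_int[of M _ "k - M'"]) (simp_all add: tn_simps)
qed

lemma X_finite: "finite {l. tensor_op s (G l) (Y (k - l)) w \<noteq> 0}"
proof (induction w rule: tensor_induct)
  case (add x y)
  then show ?case
    by (rule finite_subset[OF _ finite_UnI, rotated]) (auto simp: linearD[OF GY_linear])
next
  case (tens u f)
  then show ?case by (simp add: op_tens[OF G_linear Y_linear] X_finite_tens)
qed

lemma X_linear: "Vector_Spaces.linear pms pms (X k)"
  unfolding X_def[abs_def]
  by (rule linear_Sum_any[OF vector_space_tensor vector_space_tensor GY_linear X_finite])

lemma X_tens: "X k (tn u f) = (\<Sum>l. tn (G l u) (Y (k - l) f))"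
  by (simp add: X_def op_tens[OF G_linear Y_linear])

text \<open>The common summand of two computations: the n-th term of (a + b)/(a - b), attached to N,
  gives the product of the Y's; attached to the G's, it gives \<open>A\<close>.\<close>

definition Q :: "int \<Rightarrow> int \<Rightarrow> 'u \<Rightarrow> fock \<Rightarrow> int \<times> int \<times> int \<Rightarrow> (nat \<Rightarrow>\<^sub>0 nat) \<Rightarrow>\<^sub>0 'u" where
  "Q k l u f = (\<lambda>(i, j, n). wt n (tn (G (k - i + n) (G (l - j - n) u)) (N i j f)))"

text \<open>N bounds i and j below, the inner G then bounds j and n above, and
  \<open>GG_bounded\<close> finally bounds i above.\<close>

lemma Q_finite: "finite {x. Q k l u f x \<noteq> 0}"
proof -
  obtain M where M: "\<And>p. p < M \<Longrightarrow> G p u = 0" using G_bounded by blast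
  obtain M' where M': "\<And>i j. i < M' \<or> j < M' \<Longrightarrow> N i j f = 0" using N_vanish by blast
  obtain M'' where M'': "\<And>p q. p < M'' \<Longrightarrow> q \<le> l - M' \<Longrightarrow> G p (G q u) = 0" using GG_bounded by blast
  have "Q k l u f (i, j, n) = 0"
    if "(i, j, n) \<notin> {M'..k + (l - M' - M) - M''} \<times> {M'..l - M} \<times> {0..l - M' - M}" for i j n
  proof -
    consider "n < 0" | "0 \<le> n" "i < M' \<or> j < M'" | "0 \<le> n" "M' \<le> j" "l - j - n < M"
      | "0 \<le> n" "M' \<le> j" "M' \<le> i" "M \<le> l - j - n" by linarith
    then show ?thesis
    proof cases
      case 4
      with that have "k - i + n < M''" "l - j - n \<le> l - M'" by auto
      then show ?thesis by (simp add: Q_def M'' tn_simps)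
    qed (auto simp: Q_def wt_def M M' tn_simps linearD[OF G_linear])
  qed
  note zero = this
  have "{x. Q k l u f x \<noteq> 0} \<subseteq> {M'..k + (l - M' - M) - M''} \<times> {M'..l - M} \<times> {0..l - M' - M}"
  proof (rule subsetI, rule ccontr)
    fix x assume x: "x \<in> {x. Q k l u f x \<noteq> 0}"
      "x \<notin> {M'..k + (l - M' - M) - M''} \<times> {M'..l - M} \<times> {0..l - M' - M}"
    obtain i j n where ijn: "x = (i, j, n)" by (cases x)
    show False using zero[OF x(2)[unfolded ijn]] x(1) by (simp add: ijn)
  qed
  then show ?thesis by (rule finite_subset) simp
qed

text \<open>The singular factor moves from the Fock side to the U side by an exchange of summation,
  justified by \<open>Q_finite\<close>.\<close>

lemma XX_tens:
  "finite {(i, j). tn (A (k - i) (l - j) u) (N i j f) \<noteq> 0}" (is ?fin)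
  "X k (X l (tn u f)) = (\<Sum>(i, j). tn (A (k - i) (l - j) u) (N i j f))" (is ?eq)
proof -
  have 1: "tn (A (k - i) (l - j) u) (N i j f) = (\<Sum>n. Q k l u f (i, j, n))" for i j
  proof -
    obtain M where "\<And>n. M \<le> n \<Longrightarrow> G (k - i + n) (G (l - j - n) u) = 0"
      using GG_vanish by blast
    then have "tn (A (k - i) (l - j) u) (N i j f) = hsum (\<lambda>n. tn (G (k - i + n) (G (l - j - n) u)) (N i j f))"
      unfolding A_def
      by (intro hsum_additive[where h = "\<lambda>x. tn x (N i j f)"]) (simp_all add: tn_simps)
    then show ?thesis by (simp add: Q_def hsum_def)
  qed
  show fin2: ?fin
  proof (rule finite_subset[OF _ finite_imageI[OF Q_finite[of k l u f], of "\<lambda>(i, j, n). (i, j)"]], safe)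
    fix i j assume "tn (A (k - i) (l - j) u) (N i j f) \<noteq> 0"
    then obtain n where "Q k l u f (i, j, n) \<noteq> 0"
      unfolding 1 by (rule Sum_any.not_neutral_obtains_not_neutral)
    then show "(i, j) \<in> (\<lambda>(i, j, n). (i, j)) ` {x. Q k l u f x \<noteq> 0}"
      by (force simp: image_iff)
  qed
  let ?h = "\<lambda>q p n. wt n (tn (G p (G q u)) (N (k - p + n) (l - q - n) f))"
  \<comment> \<open>From the indices of N to those of the two G's, with the expansion index n
    kept.\<close>
  let ?b = "\<lambda>(i, j, n). (l - j - n, k - i + n, n :: int)"
  have bij: "bij ?b"
    by (rule bij_betw_byWitness[where f' = "\<lambda>(q, p, n). (k - p + n, l - q - n, n)"]) auto
  have Qh: "(case ?b x of (q, p, n) \<Rightarrow> ?h q p n) = Q k l u f x" for x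
    by (cases x) (simp add: Q_def)
  have fin: "finite {x. (case x of (q, p, n) \<Rightarrow> ?h q p n) \<noteq> 0}"
    by (rule finite_support_bij[OF bij]) (simp only: Qh Q_finite)
  have "X k (X l (tn u f)) = (\<Sum>q. X k (tn (G q u) (Y (l - q) f)))"
    by (subst X_tens) (rule Sum_any_linear[OF X_linear X_finite_tens])
  also have "\<dots> = (\<Sum>q. \<Sum>p. \<Sum>n. ?h q p n)"
  proof (intro Sum_any.cong)
    fix q
    have "tn (G p (G q u)) (Y (k - p) (Y (l - q) f)) = (\<Sum>n. ?h q p n)" for p
    proof -
      obtain M where "\<And>i j. i < M \<or> j < M \<Longrightarrow> N i j f = 0" using N_vanish by blast
      then have "tn (G p (G q u)) (hsum (\<lambda>n. N (k - p + n) (l - q - n) f)) =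
          hsum (\<lambda>n. tn (G p (G q u)) (N (k - p + n) (l - q - n) f))"
        by (intro hsum_additive[of "l - q - M + 1"]) (simp_all add: tn_simps)
      then show ?thesis by (simp add: YY_eq_N hsum_def)
    qed
    then show "X k (tn (G q u) (Y (l - q) f)) = (\<Sum>p. \<Sum>n. ?h q p n)"
      by (simp add: X_tens)
  qed
  also have "\<dots> = (\<Sum>x. case x of (q, p, n) \<Rightarrow> ?h q p n)"
    by (rule Sum_any_nested3) (use fin in \<open>simp add: case_prod_unfold\<close>)
  also have "\<dots> = (\<Sum>x. Q k l u f x)"
    by (subst Sum_any_bij[OF bij]) (simp only: Qh)
  also have "\<dots> = (\<Sum>i. \<Sum>j. \<Sum>n. Q k l u f (i, j, n))"
    by (subst Sum_any_nested3) (use Q_finite[of k l u f] in \<open>simp_all add: case_prod_unfold\<close>)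
  also have "\<dots> = (\<Sum>i. \<Sum>j. tn (A (k - i) (l - j) u) (N i j f))"
    by (simp only: 1)
  also have "\<dots> = (\<Sum>(i, j). tn (A (k - i) (l - j) u) (N i j f))"
    by (rule Sum_any_nested[OF fin2])
  finally show ?eq .
qed

end

lemma sg_mult: "sg (m - n) x = sg m (sg n x)"
  by (simp add: sg_def)

lemma linear_id: "vector_space s \<Longrightarrow> Vector_Spaces.linear s s id"
  by (rule linearI) auto

lemma lie_module_iff:
  "lie_module br s \<rho> \<longleftrightarrow> vector_space s \<and> (\<forall>a. Vector_Spaces.linear s s (\<rho> a)) \<and>
     (\<forall>a b v. \<rho> a (\<rho> b v) - \<rho> b (\<rho> a v) = lin_ext s \<rho> (br a b) v)"
  by (simp add: lie_super_module_def)

section \<open>Commutation relations of X and H\<close>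

context tensor_action
begin

lemma Sum_any_tn_Z: "(\<Sum>i. tn u (sg i (N i (t - i) f))) = tn u (Z t f)"
  unfolding Z_def using Z_finite[of "\<lambda>_. 1" 0 t f]
  by (intro Sum_any_linear[OF tn_linear2, symmetric]) simp

lemma Sum_any_tn_Z': "(\<Sum>i. tn u (fscale (of_int i) (sg i (N i (t - i) f)))) = tn u (Z' t f)"
  unfolding Z'_def using Z_finite[of of_int 0 t f]
  by (intro Sum_any_linear[OF tn_linear2, symmetric]) simp

definition H :: "int \<Rightarrow> ((nat \<Rightarrow>\<^sub>0 nat) \<Rightarrow>\<^sub>0 'u) \<Rightarrow> ((nat \<Rightarrow>\<^sub>0 nat) \<Rightarrow>\<^sub>0 'u)" where
  "H m w = pms (- 2) (tensor_op s id (beta m) w) + pms 2 (tensor_op s (T m) id w)"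

lemma id_linear: "Vector_Spaces.linear s s id" "flinear id"
  by (rule linear_id, rule vector_space vector_space_fock)+

lemma H_linear: "Vector_Spaces.linear pms pms (H m)"
  unfolding H_def[abs_def]
  by (intro linear_plus linear_scaled op_linear id_linear beta_linear linear)

lemma H_tens: "H m (tn u f) = pms (- 2) (tn u (beta m f)) + pms 2 (tn (T m u) f)"
  by (simp add: H_def op_tens[OF id_linear(1) beta_linear] op_tens[OF linear id_linear(2)])

lemma pms_sg: "pms a (sg k w) = sg k (pms a w)"
  by (simp add: sg_def)

text \<open>By \<open>A_commutator\<close> the coefficient against \<open>N i j\<close> is the sign
  of k - i times something depending on t = i + j only, apart from a term linear in i at t = k + l +
  6. For fixed t the sum over i is thus a combination of \<open>Z t\<close> and
  \<open>Z' t\<close>.\<close>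

lemma X_commutator_tens:
  "X k (X l (tn u f)) - X l (X k (tn u f)) = sg k
    ((if k + l = - 4 then pms (of_int (k + 2)) (tn u f) else 0) -
     (if odd (k + l) then H ((- k - l - 5) div 2) (tn u f) else 0))"
proof -
  define e where "e i t = (if odd (k + l - t) then s (- 1 / 2) (T ((t - k - l - 6) div 2) u)
      else if t = k + l + 6 then s ((of_int (k - i) + 3) / 4) u else 0)" for i t
  define E where "E i t = tn (sg (k - i) (e i t)) (N i (t - i) f)" for i t
  have D: "A (k - i) (l - j) u - A (l - j) (k - i) u = sg (k - i) (e i (i + j))" for i j
  proof -
    have "k - i + (l - j) = k + l - (i + j)" "- (k - i) - (l - j) - 6 = i + j - k - l - 6"
      "(k + l - (i + j) = - 6) = (i + j = k + l + 6)" by auto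
    then show ?thesis by (simp only: A_commutator e_def)
  qed
  have DE: "tn (A (k - i) (l - j) u) (N i j f) - tn (A (l - j) (k - i) u) (N i j f) = E i (i + j)" for i j
    unfolding tn_simps(3)[symmetric] D by (simp add: E_def)
  have fin1: "finite {x. (case x of (i, j) \<Rightarrow> tn (A (k - i) (l - j) u) (N i j f)) \<noteq> 0}"
    using XX_tens(1)[of k l u f] by (simp add: case_prod_unfold)
  \<comment> \<open>By the symmetry of N, the product in the other order is a sum against the same
    \<open>N i j\<close>.\<close>
  have swap: "bij (\<lambda>(i, j). (j, i) :: int \<times> int)"
    by (rule bij_betw_byWitness[where f' = "\<lambda>(i, j). (j, i)"]) auto
  have fin2: "finite {x. (case x of (i, j) \<Rightarrow> tn (A (l - j) (k - i) u) (N i j f)) \<noteq> 0}"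
  proof (rule finite_support_bij[OF swap, where g = "\<lambda>(i, j). tn (A (l - j) (k - i) u) (N i j f)"])
    show "finite {x. (case case x of (i, j) \<Rightarrow> (j, i) of (i, j) \<Rightarrow> tn (A (l - j) (k - i) u) (N i j f)) \<noteq> 0}"
      using XX_tens(1)[of l k u f] by (simp add: case_prod_unfold N_commute[of "fst _"])
  qed
  have "X l (X k (tn u f)) = (\<Sum>x. case x of (i, j) \<Rightarrow> tn (A (l - j) (k - i) u) (N i j f))"
    unfolding XX_tens(2)
    by (subst Sum_any_bij[OF swap]) (rule Sum_any.cong, simp add: case_prod_unfold N_commute[of "fst _"])
  then have "X k (X l (tn u f)) - X l (X k (tn u f)) =
     (\<Sum>x. (case x of (i, j) \<Rightarrow> tn (A (k - i) (l - j) u) (N i j f)) -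
       (case x of (i, j) \<Rightarrow> tn (A (l - j) (k - i) u) (N i j f)))"
    by (simp only: XX_tens(2)[of k l] Sum_any_diff[OF fin1 fin2])
  also have "\<dots> = (\<Sum>x. case x of (i, j) \<Rightarrow> E i (i + j))"
  proof (rule Sum_any.cong)
    fix x :: "int \<times> int"
    obtain i j where x: "x = (i, j)" by (cases x)
    show "(case x of (i, j) \<Rightarrow> tn (A (k - i) (l - j) u) (N i j f)) -
       (case x of (i, j) \<Rightarrow> tn (A (l - j) (k - i) u) (N i j f)) = (case x of (i, j) \<Rightarrow> E i (i + j))"
      by (simp only: x prod.case DE)
  qed
  also have "\<dots> = (\<Sum>x. case x of (t, i) \<Rightarrow> E i t)"
  proof -
    have "bij (\<lambda>(t, i). (i, t - i :: int))"
      by (rule bij_betw_byWitness[where f' = "\<lambda>(i, j). (i + j, i)"]) auto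
    then show ?thesis
      by (subst Sum_any_bij) (auto intro!: Sum_any.cong)
  qed
  also have "\<dots> = (\<Sum>t. \<Sum>i. E i t)"
  proof (rule Sum_any_nested[symmetric])
    have bij: "bij (\<lambda>(i, j). (i + j, i :: int))"
      by (rule bij_betw_byWitness[where f' = "\<lambda>(t, i). (i, t - i)"]) auto
    have "finite {x. (case x of (i, j) \<Rightarrow> tn (A (k - i) (l - j) u) (N i j f)) -
       (case x of (i, j) \<Rightarrow> tn (A (l - j) (k - i) u) (N i j f)) \<noteq> 0}"
      by (rule finite_subset[OF _ finite_UnI[OF fin1 fin2]]) auto
    moreover have "(case x of (i, j) \<Rightarrow> tn (A (k - i) (l - j) u) (N i j f)) -
       (case x of (i, j) \<Rightarrow> tn (A (l - j) (k - i) u) (N i j f)) =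
       (case (case x of (i, j) \<Rightarrow> (i + j, i)) of (t, i) \<Rightarrow> E i t)" for x
      by (cases x) (simp only: prod.case DE)
    ultimately have "finite {x. (case x of (t, i) \<Rightarrow> E i t) \<noteq> 0}"
      by (intro finite_support_bij[OF bij, where g = "\<lambda>(t, i). E i t"]) (simp only:)
    then show "finite {(t, i). E i t \<noteq> 0}" by (simp add: case_prod_unfold)
  qed
  \<comment> \<open>Two values of t survive: t = 2, where \<open>Z\<close> is nonzero, carries the
    T-term with factor (-1/2) 4 = -2, and t = k + l + 6 carries the central term.\<close>
  also have "\<dots> = (\<Sum>t. (if t = 2 then if odd (k + l) then sg k (tn (s (- 2) (T ((- k - l - 4) div 2) u)) f) else 0 else 0) +
     (if t = k + l + 6 then sg k (tn (s ((of_int k + 3) / 4) u) (Z t f) + tn (s (- 1 / 4) u) (Z' t f)) else 0))"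
  proof (rule Sum_any.cong)
    fix t
    show "(\<Sum>i. E i t) =
     (if t = 2 then if odd (k + l) then sg k (tn (s (- 2) (T ((- k - l - 4) div 2) u)) f) else 0 else 0) +
     (if t = k + l + 6 then sg k (tn (s ((of_int k + 3) / 4) u) (Z t f) + tn (s (- 1 / 4) u) (Z' t f)) else 0)"
    proof (cases "odd (k + l - t)")
      case True
      let ?x = "s (- 1 / 2) (T ((t - k - l - 6) div 2) u)"
      have "(\<Sum>i. E i t) = (\<Sum>i. tn (sg k ?x) (sg i (N i (t - i) f)))"
        by (rule Sum_any.cong) (simp only: E_def e_def True if_True sg_mult tn_sg, simp only: sg_def, simp)
      also have "\<dots> = sg k (tn ?x (Z t f))" by (simp only: Sum_any_tn_Z) (simp only: tn_sg)
      also have "\<dots> = (if t = 2 then if odd (k + l) then sg k (tn (s (- 2) (T ((- k - l - 4) div 2) u)) f) else 0 else 0)"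
        using True by (auto simp: Z_eq tn_simps)
      finally show ?thesis using True by auto
    next
      case False
      show ?thesis
      proof (cases "t = k + l + 6")
        case True
        have lin: "E i t = tn (sg k (s ((of_int k + 3) / 4) u)) (sg i (N i (t - i) f)) +
            tn (sg k (s (- 1 / 4) u)) (fscale (of_int i) (sg i (N i (t - i) f)))" for i
        proof -
          have "s ((of_int (k - i) + 3) / 4) u = s ((of_int k + 3) / 4) u + s (- 1 / 4) (s (of_int i) u)"
            by (simp add: diff_divide_distrib add_divide_distrib algebra_simps)
          then have "E i t = sg k (sg i (tn (s ((of_int k + 3) / 4) u + s (- 1 / 4) (s (of_int i) u)) (N i (t - i) f)))"
            using False by (simp only: E_def e_def True if_False if_True refl tn_sg sg_mult)
          then show ?thesis
            by (simp only: tn_simps tn_sg sg_add) (simp only: sg_def, simp add: mult.commute)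
        qed
        have f1: "finite {i. tn (sg k (s ((of_int k + 3) / 4) u)) (sg i (N i (t - i) f)) \<noteq> 0}"
          by (rule finite_subset[OF _ Z_finite[of "\<lambda>_. 1" 0 t f]]) (auto simp: tn_simps)
        have f2: "finite {i. tn (sg k (s (- 1 / 4) u)) (fscale (of_int i) (sg i (N i (t - i) f))) \<noteq> 0}"
          by (rule finite_subset[OF _ Z_finite[of "\<lambda>_. 1" 0 t f]]) (auto simp: tn_simps)
        have "(\<Sum>i. E i t) = sg k (tn (s ((of_int k + 3) / 4) u) (Z t f) + tn (s (- 1 / 4) u) (Z' t f))"
          by (simp only: lin Sum_any.distrib[OF f1 f2] Sum_any_tn_Z Sum_any_tn_Z') (simp only: tn_sg sg_add)
        moreover have "(if t = 2 then if odd (k + l) then y else 0 else 0) = 0" for y :: "(nat \<Rightarrow>\<^sub>0 nat) \<Rightarrow>\<^sub>0 'u"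
          using False by auto
        ultimately show ?thesis by (simp only: True refl if_True add_0)
      next
        case neq: False
        then have "E i t = 0" for i using False by (simp add: E_def e_def tn_simps)
        with neq False show ?thesis by auto
      qed
    qed
  qed
  also have "\<dots> = (if odd (k + l) then sg k (tn (s (- 2) (T ((- k - l - 4) div 2) u)) f) else 0) +
     sg k (tn (s ((of_int k + 3) / 4) u) (Z (k + l + 6) f) + tn (s (- 1 / 4) u) (Z' (k + l + 6) f))"
  proof -
    have "finite {t. (if t = a then x else 0) \<noteq> (0 :: (nat \<Rightarrow>\<^sub>0 nat) \<Rightarrow>\<^sub>0 'u)}" for a :: int and x
      by (rule finite_subset[of _ "{a}"]) auto
    then show ?thesis
      by (subst Sum_any.distrib) (auto intro: rev_finite_subset[of "{k + l + 6}"])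
  qed
  also have "\<dots> = sg k
    ((if k + l = - 4 then pms (of_int (k + 2)) (tn u f) else 0) -
     (if odd (k + l) then H ((- k - l - 5) div 2) (tn u f) else 0))"
  \<comment> \<open>In the odd case the derivative contributes (-1/4)(-8) beta = 2 beta next to -2
    T, at the same mode; together they are minus \<open>H\<close>.\<close>
  proof (cases "odd (k + l)")
    case True
    then have "(- k - l - 4) div 2 = (- k - l - 5) div 2" "(1 - (k + l + 6)) div 2 = (- k - l - 5) div 2"
      "k + l \<noteq> - 4" by presburger+
    with True show ?thesis
      by (simp add: Z_eq Z'_eq H_tens tn_simps sg_add sg_diff sg_uminus pms_sg)
  next
    case False
    show ?thesis
    proof (cases "k + l = - 4")
      case True
      \<comment> \<open>\<open>Z\<close> contributes k + 3 and the derivative -1.\<close>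
      have "4 * ((of_int k + 3) / 4) + 4 * (- 1 / 4) = (of_int (k + 2) :: complex)" by simp
      then have "tn (s ((of_int k + 3) / 4) u) (fscale 4 f) + tn (s (- 1 / 4) u) (fscale 4 f) = pms (of_int (k + 2)) (tn u f)"
        by (simp only: tn_simps P.scale_scale P.scale_left_distrib[symmetric])
      with True show ?thesis
        by (simp only: Z_eq Z'_eq) simp
    next
      case neq: False
      with False show ?thesis by (simp add: Z_eq Z'_eq tn_simps)
    qed
  qed
  finally show ?thesis .
qed

lemma X_commutator:
  "X k (X l w) - X l (X k w) = sg k
    ((if k + l = - 4 then pms (of_int (k + 2)) w else 0) -
     (if odd (k + l) then H ((- k - l - 5) div 2) w else 0))"
proof (induction w rule: tensor_induct)
  case (add x y)
  have "X k (X l (x + y)) - X l (X k (x + y)) = (X k (X l x) - X l (X k x)) + (X k (X l y) - X l (X k y))"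
    by (simp add: linearD[OF X_linear])
  then show ?case
    unfolding add by (simp add: linearD[OF H_linear] P.scale_right_distrib sg_add sg_diff sg_uminus)
qed (rule X_commutator_tens)

text \<open>The T part is central, so only -2 beta acts, and \<open>beta_Y\<close> contributes
  another sign.\<close>

lemma H_X_commutator: "H m (X k w) - X k (H m w) = pms 2 (X (k - 2 * m - 1) w)"
proof (induction w rule: tensor_induct)
  case (add x y)
  have "H m (X k (x + y)) - X k (H m (x + y)) = (H m (X k x) - X k (H m x)) + (H m (X k y) - X k (H m y))"
    by (simp add: linearD[OF X_linear] linearD[OF H_linear])
  then show ?case
    unfolding add by (simp add: linearD[OF X_linear] P.scale_right_distrib)
next
  case (tens u f)
  let ?q = "2 * m + 1"
  have fin1: "finite {l. pms (- 2) (tn (G l u) (Y (k - l) (beta m f))) \<noteq> 0}"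
    and fin2: "finite {l. pms 2 (tn (G l (T m u)) (Y (k - l) f)) \<noteq> 0}"
    and fin3: "finite {l. pms 2 (tn (G l u) (Y (k - ?q - l) f)) \<noteq> 0}"
    using X_finite_tens[of u k "beta m f"] X_finite_tens[of "T m u" k f] X_finite_tens[of u "k - ?q" f]
    by simp_all
  have fin12: "finite {l. pms (- 2) (tn (G l u) (Y (k - l) (beta m f))) + pms 2 (tn (G l (T m u)) (Y (k - l) f)) \<noteq> 0}"
    by (rule finite_subset[OF _ finite_UnI[OF fin1 fin2]]) auto
  have pl: "Vector_Spaces.linear pms pms (pms a)" for a
    by (rule linearI[OF vector_space_tensor vector_space_tensor]) (simp_all add: P.scale_right_distrib mult.commute)
  have "H m (X k (tn u f)) = (\<Sum>l. H m (tn (G l u) (Y (k - l) f)))"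
    unfolding X_tens by (rule Sum_any_linear[OF H_linear X_finite_tens])
  also have "\<dots> = (\<Sum>l. (pms (- 2) (tn (G l u) (Y (k - l) (beta m f))) + pms 2 (tn (G l (T m u)) (Y (k - l) f))) +
      pms 2 (tn (G l u) (Y (k - ?q - l) f)))"
  proof (rule Sum_any.cong)
    fix l
    have "k - l - 2 * m - 1 = k - ?q - l" by simp
    then have "beta m (Y (k - l) f) = Y (k - l) (beta m f) - Y (k - ?q - l) f"
      by (simp only: beta_Y)
    moreover have "T m (G l u) = G l (T m u)" unfolding G_def by (rule T_commute)
    ultimately show "H m (tn (G l u) (Y (k - l) f)) =
      (pms (- 2) (tn (G l u) (Y (k - l) (beta m f))) + pms 2 (tn (G l (T m u)) (Y (k - l) f))) +
      pms 2 (tn (G l u) (Y (k - ?q - l) f))"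
      by (simp add: H_tens tn_simps P.scale_right_diff_distrib)
  qed
  also have "\<dots> = (\<Sum>l. pms (- 2) (tn (G l u) (Y (k - l) (beta m f)))) + (\<Sum>l. pms 2 (tn (G l (T m u)) (Y (k - l) f))) +
      (\<Sum>l. pms 2 (tn (G l u) (Y (k - ?q - l) f)))"
    by (simp only: Sum_any.distrib[OF fin12 fin3] Sum_any.distrib[OF fin1 fin2])
  also have "\<dots> = pms (- 2) (X k (tn u (beta m f))) + pms 2 (X k (tn (T m u) f)) + pms 2 (X (k - ?q) (tn u f))"
    by (simp only: X_tens Sum_any_linear[OF pl X_finite_tens])
  finally show ?case by (simp add: H_tens linearD[OF X_linear] algebra_simps)
qed

text \<open>The constant is (-2)^2 times -(m + 1/2), that is 2(m + 1/2) K at K = -2.\<close>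

lemma H_commutator: "H m (H n w) - H n (H m w) = (if m + n + 1 = 0 then pms (- 4 * (of_int m + 1 / 2)) w else 0)"
proof (induction w rule: tensor_induct)
  case (add x y)
  have "H m (H n (x + y)) - H n (H m (x + y)) = (H m (H n x) - H n (H m x)) + (H m (H n y) - H n (H m y))"
    by (simp add: linearD[OF H_linear])
  then show ?case
    unfolding add by (simp add: P.scale_right_distrib)
next
  case (tens u f)
  have "H m (H n (tn u f)) - H n (H m (tn u f)) = pms 4 (tn u (beta m (beta n f) - beta n (beta m f)))"
    by (simp add: H_tens linearD[OF H_linear] T_commute[of m "tw_T n"] tn_simps P.scale_right_distrib
        P.scale_right_diff_distrib)
  also have "beta m (beta n f) - beta n (beta m f) = (if m + n + 1 = 0 then fscale (- (of_int m + 1 / 2)) f else 0)"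
    by (subst beta_commutator) simp
  finally show ?case by (simp only: tn_simps P.scale_scale P.scale_zero_right split: if_split) simp
qed

end

section \<open>The operators of the basis elements and their brackets\<close>

locale wakimoto_action = restricted_atw_module s \<rho>
  for s :: "complex \<Rightarrow> 'u \<Rightarrow> 'u::ab_group_add" and \<rho> +
  fixes i :: nat
begin

sublocale tensor_action "Y_tw i" "- (2 * \<i>) * (- 1) ^ i" s \<rho>
  by (intro tensor_action.intro vertex_operator_Y_tw restricted_atw_module_axioms)

text \<open>Both families in one: even \<open>k\<close> carries the modes of x^+, odd
  \<open>k\<close> those of x^-.\<close>

definition x :: "int \<Rightarrow> ((nat \<Rightarrow>\<^sub>0 nat) \<Rightarrow>\<^sub>0 'u) \<Rightarrow> ((nat \<Rightarrow>\<^sub>0 nat) \<Rightarrow>\<^sub>0 'u)" where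
  "x k w = pms 2 (pms (1 / complex_of_real (sqrt 2)) (X k w))"

lemma action_simps:
  "sl2t_action s \<rho> i (sl_xp n) = x (- 2 * n - 2)"
  "sl2t_action s \<rho> i (sl_xm n) = x (- 2 * n - 3)"
  "sl2t_action s \<rho> i (sl_h m) = H m"
  "sl2t_action s \<rho> i sl_K = pms (- 2)"
proof -
  have X: "X_plus s \<rho> i k w = pms (1 / complex_of_real (sqrt 2)) (X k w)" for k w
    by (simp only: X_def X_plus_def fd_tensor_def G_dist_eq)
  have "2 * (- n - 1) = - 2 * n - 2" "2 * (- n - 1) - 1 = - 2 * n - 3" by simp_all
  then show "sl2t_action s \<rho> i (sl_xp n) = x (- 2 * n - 2)"
    "sl2t_action s \<rho> i (sl_xm n) = x (- 2 * n - 3)"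
    by (simp_all only: fun_eq_iff sl2t_action.simps x_def X simp_thms)
qed (simp_all add: fun_eq_iff H_def)

lemma x_linear: "Vector_Spaces.linear pms pms (x k)"
  unfolding x_def[abs_def] by (intro linear_scaled X_linear)

lemma action_linear: "Vector_Spaces.linear pms pms (sl2t_action s \<rho> i a)"
proof -
  have "Vector_Spaces.linear pms pms (pms c)" for c
    by (rule linearI[OF vector_space_tensor vector_space_tensor]) (simp_all add: P.scale_right_distrib mult.commute)
  then show ?thesis by (cases a) (simp_all only: action_simps x_linear H_linear)
qed

lemma x_commutator: "x k (x l w) - x l (x k w) = sg k
    ((if k + l = - 4 then pms (2 * of_int (k + 2)) w else 0) -
     (if odd (k + l) then pms 2 (H ((- k - l - 5) div 2) w) else 0))"
proof -
  have r: "complex_of_real (sqrt 2) * complex_of_real (sqrt 2) = 2"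
    by (simp flip: of_real_mult)
  then have "2 * (1 / complex_of_real (sqrt 2)) * (2 * (1 / complex_of_real (sqrt 2))) = 2"
    by (simp add: divide_simps r)
  then have "x k (x l w) = pms 2 (X k (X l w))" for k l
    unfolding x_def linearD(5)[OF X_linear] P.scale_scale by (simp only: mult.assoc)
  then have "x k (x l w) - x l (x k w) = pms 2 (X k (X l w) - X l (X k w))"
    by (simp add: P.scale_right_diff_distrib)
  then show ?thesis
    by (simp add: X_commutator pms_sg P.scale_right_diff_distrib sg_diff if_distrib[of "pms 2"] if_distrib[of "sg k"] cong: if_cong)
qed

lemma H_x_commutator: "H m (x k w) - x k (H m w) = pms 2 (x (k - 2 * m - 1) w)"
proof -
  let ?c = "2 * (1 / complex_of_real (sqrt 2))"
  have x: "x k w = pms ?c (X k w)" for k w by (simp only: x_def P.scale_scale)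
  have "H m (x k w) - x k (H m w) = pms ?c (H m (X k w) - X k (H m w))"
    by (simp only: x linearD[OF H_linear] P.scale_right_diff_distrib)
  also have "\<dots> = pms 2 (x (k - 2 * m - 1) w)"
    by (simp only: H_X_commutator x P.scale_scale mult.commute)
  finally show ?thesis .
qed

text \<open>Since x^+ sits at even and x^- at odd indices, the sign \<open>sg k\<close> in
  \<open>x_commutator\<close> accounts for the opposite signs of the brackets [x^+, x^+] and
  [x^-, x^-].\<close>

lemma action_lie_module: "lie_module sl2t_bracket pms (sl2t_action s \<rho> i)"
  unfolding lie_module_iff
proof (intro conjI allI)
  show "Vector_Spaces.vector_space pms" by (rule vector_space_tensor)
  show "Vector_Spaces.linear pms pms (sl2t_action s \<rho> i a)" for a by (rule action_linear)
  fix a b w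
  let ?f = "sl2t_action s \<rho> i"
  have anti: "?f a (?f b w) - ?f b (?f a w) = - (?f b (?f a w) - ?f a (?f b w))" for a b by simp
  note le = lin_ext_single[OF vector_space_tensor] action_simps
  have hx: "x k (H m w) - H m (x k w) = pms (- 2) (x (k - 2 * m - 1) w)" for k m
    using H_x_commutator[of m k w] by (simp add: algebra_simps)
  have xx: "?f (sl_xp r) (?f (sl_xm m) w) - ?f (sl_xm m) (?f (sl_xp r) w) = pms (- 2) (H (m + r) w)" for r m
  proof -
    have "(- (- 2 * r - 2) - (- 2 * m - 3) - 5) div 2 = m + r" "even (- 2 * r - 2)" "odd (- 2 * r - 2 + (- 2 * m - 3))"
      "- 2 * r - 2 + (- 2 * m - 3) \<noteq> - 4"
      by simp_all presburger+
    then show ?thesis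
      unfolding action_simps x_commutator by (simp add: sg_def add.commute)
  qed
  show "?f a (?f b w) - ?f b (?f a w) = lin_ext pms ?f (sl2t_bracket a b) w"
  proof (cases a; cases b)
    fix m n assume ab: "a = sl_h m" "b = sl_h n"
    have "- 4 * (of_int m + 1 / 2) = (2 * (of_int m + 1 / 2) * - 2 :: complex)" by simp
    then show ?thesis
      by (cases "m + n + 1 = 0")
         (simp_all only: ab sl2t_bracket.simps if_True if_False refl le H_commutator lin_ext_0 P.scale_scale)
  next
    fix m n assume ab: "a = sl_h m" "b = sl_xm n"
    have "- 2 * n - 3 - 2 * m - 1 = - 2 * (m + n + 1) - 2" by simp
    then show ?thesis unfolding ab sl2t_bracket.simps le H_x_commutator by (simp only:)
  next
    fix m n assume ab: "a = sl_h m" "b = sl_xp n"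
    have "- 2 * n - 2 - 2 * m - 1 = - 2 * (m + n) - 3" by simp
    then show ?thesis unfolding ab sl2t_bracket.simps le H_x_commutator by (simp only:)
  next
    fix m n assume ab: "a = sl_xm n" "b = sl_h m"
    have "- 2 * n - 3 - 2 * m - 1 = - 2 * (m + n + 1) - 2" by simp
    then show ?thesis unfolding ab sl2t_bracket.simps le hx by (simp only:)
  next
    fix m n assume ab: "a = sl_xp n" "b = sl_h m"
    have "- 2 * n - 2 - 2 * m - 1 = - 2 * (m + n) - 3" by simp
    then show ?thesis unfolding ab sl2t_bracket.simps le hx by (simp only:)
  next
    fix m n assume ab: "a = sl_xp m" "b = sl_xp n"
    have "(- 2 * m - 2 + (- 2 * n - 2) = - 4) = (m + n = 0)" by auto
    then show ?thesis
      unfolding ab action_simps x_commutator by (simp add: sg_def le)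
  next
    fix m n assume ab: "a = sl_xm m" "b = sl_xm n"
    have "(- 2 * m - 3 + (- 2 * n - 3) = - 4) = (m + n + 1 = 0)" by auto
    moreover have "2 * (of_int (- 2 * m - 3 + 2) :: complex) = - (- 2 * (of_int m + 1 / 2) * - 2)" by simp
    ultimately show ?thesis
      unfolding ab action_simps x_commutator by (simp add: sg_def le)
  next
    fix m n assume ab: "a = sl_xp m" "b = sl_xm n"
    show ?thesis unfolding ab xx by (simp add: le)
  next
    fix m n assume ab: "a = sl_xm m" "b = sl_xp n"
    show ?thesis unfolding ab anti[of "sl_xm m"] xx by (simp add: le)
  \<comment> \<open>The remaining pairs all involve the central K.\<close>
  qed (simp_all add: action_simps(4) linearD[OF action_linear] del: sl2t_action.simps)
qed

end

section \<open>Schur's lemma in countable dimension\<close>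

context Vector_Spaces.vector_space
begin

text \<open>A countable spanning set is exhausted by the finite sets \<open>F n\<close>, and an
  independent set meets the span of each in a finite set.\<close>

lemma countable_independent:
  assumes "countable B" "span B = UNIV" "independent I"
  shows "countable I"
proof -
  define F where "F n = {b \<in> B. to_nat_on B b < n}" for n
  have "finite (F n)" for n
  proof -
    have "inj_on (to_nat_on B) (F n)"
      using inj_on_to_nat_on[OF assms(1)] by (rule inj_on_subset) (auto simp: F_def)
    moreover have "finite (to_nat_on B ` F n)"
      by (rule finite_subset[of _ "{..<n}"]) (auto simp: F_def)
    ultimately show ?thesis by (rule finite_imageD[rotated])
  qed
  then have fin: "finite (I \<inter> span (F n))" for n
    using independent_span_bound[of "F n" "I \<inter> span (F n)"] independent_mono[OF assms(3)] by blast
  have "I \<subseteq> (\<Union>n. I \<inter> span (F n))"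
  proof
    fix x assume x: "x \<in> I"
    have "x \<in> span B" by (simp add: assms(2))
    then obtain t r where t: "finite t" "t \<subseteq> B" "x = (\<Sum>a\<in>t. scale (r a) a)"
      unfolding span_explicit by auto
    obtain n where "\<forall>k\<in>to_nat_on B ` t. k < n"
      using finite_nat_set_iff_bounded t(1) by blast
    then have "t \<subseteq> F n" using t(2) by (auto simp: F_def)
    then have "x \<in> span (F n)"
      unfolding t(3) by (intro span_sum span_scale span_base) auto
    with x show "x \<in> (\<Union>n. I \<inter> span (F n))" by auto
  qed
  moreover have "countable (\<Union>n. I \<inter> span (F n))"
    using fin by (intro countable_UN) (auto intro: countable_finite)
  ultimately show ?thesis by (rule countable_subset)
qed

end

section \<open>Polynomials in an operator and its resolvents\<close>

locale endomorphism = Vector_Spaces.vector_space s for s :: "complex \<Rightarrow> 'v \<Rightarrow> 'v::ab_group_add" +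
  fixes t :: "'v \<Rightarrow> 'v"
  assumes t: "Vector_Spaces.linear s s t"
begin

definition poly_op :: "complex poly \<Rightarrow> 'v \<Rightarrow> 'v" where
  "poly_op p v = (\<Sum>i\<le>degree p. s (coeff p i) ((t ^^ i) v))"

lemma poly_op_eq: "degree p \<le> n \<Longrightarrow> poly_op p v = (\<Sum>i\<le>n. s (coeff p i) ((t ^^ i) v))"
  unfolding poly_op_def
  by (rule sum.mono_neutral_left) (auto simp: coeff_eq_0)

lemma funpow_linear: "Vector_Spaces.linear s s (t ^^ i)"
proof (induction i)
  case 0
  then show ?case using linear_id by (simp add: id_def)
next
  case (Suc i)
  then show ?case using linear_comp[OF Suc t] by (simp add: o_def)
qed

lemma poly_op_add: "poly_op (p + q) v = poly_op p v + poly_op q v"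
proof -
  define n where "n = max (degree p) (degree q)"
  have "degree (p + q) \<le> n" by (simp add: n_def degree_add_le_max)
  then show ?thesis
    by (simp add: poly_op_eq[of _ n] n_def scale_left_distrib sum.distrib)
qed

lemma poly_op_smult: "poly_op (smult c p) v = s c (poly_op p v)"
  by (simp add: poly_op_eq[of _ "degree p"] degree_smult_le scale_sum_right)

lemma poly_op_0 [simp]: "poly_op 0 v = 0"
  by (simp add: poly_op_def)

lemma poly_op_sum: "poly_op (sum f A) v = (\<Sum>a\<in>A. poly_op (f a) v)"
  by (induction A rule: infinite_finite_induct) (simp_all add: poly_op_add)

lemma poly_op_linear: "Vector_Spaces.linear s s (poly_op p)"
proof (rule linearI[OF vector_space_axioms vector_space_axioms])
  show "poly_op p (x + y) = poly_op p x + poly_op p y" for x y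
    by (simp add: poly_op_def linearD[OF funpow_linear] scale_right_distrib sum.distrib)
  show "poly_op p (s c x) = s c (poly_op p x)" for c x
    by (simp add: poly_op_def linearD[OF funpow_linear] scale_sum_right mult.commute)
qed

lemma poly_op_pCons_0: "poly_op (pCons 0 p) v = poly_op p (t v)"
proof -
  have "degree (pCons 0 p) \<le> Suc (degree p)" by (simp add: degree_pCons_le)
  then have "poly_op (pCons 0 p) v = (\<Sum>i\<le>Suc (degree p). s (coeff (pCons 0 p) i) ((t ^^ i) v))"
    by (rule poly_op_eq)
  also have "\<dots> = (\<Sum>i\<le>degree p. s (coeff p i) ((t ^^ Suc i) v))"
    by (subst sum.atMost_Suc_shift) simp
  finally show ?thesis by (simp add: poly_op_def funpow_swap1)
qed

lemma poly_op_linear_factor: "poly_op ([:- a, 1:] * p) v = poly_op p (t v - s a v)"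
proof -
  have "[:- a, 1:] * p = smult (- a) p + pCons 0 p" by simp
  then show ?thesis
    by (simp only: poly_op_add poly_op_smult poly_op_pCons_0 linearD[OF poly_op_linear]) simp
qed

text \<open>Over the complex numbers p splits into linear factors, and each t - a is
  injective.\<close>

lemma poly_op_inj:
  assumes inj: "\<And>a v. t v = s a v \<Longrightarrow> v = 0"
  shows "p \<noteq> 0 \<Longrightarrow> poly_op p v = 0 \<Longrightarrow> v = 0"
proof (induction "degree p" arbitrary: p v rule: less_induct)
  case less
  show ?case
  proof (cases "degree p = 0")
    case True
    then obtain c where "p = [:c:]" by (rule degree_eq_zeroE)
    with less.prems show ?thesis by (simp add: poly_op_def)
  next
    case False
    then obtain a where "poly p a = 0"
      using fundamental_theorem_of_algebra[of p] constant_degree[of p] by auto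
    then obtain q where q: "p = [:- a, 1:] * q" by (auto simp: poly_eq_0_iff_dvd elim: dvdE)
    then have "q \<noteq> 0" using less.prems by auto
    then have "degree q < degree p" unfolding q by (subst degree_mult_eq) auto
    moreover have "poly_op q (t v - s a v) = 0"
      using less.prems(2) by (simp only: q poly_op_linear_factor)
    ultimately have "t v - s a v = 0" using less.hyps \<open>q \<noteq> 0\<close> by blast
    then show ?thesis using inj by simp
  qed
qed

text \<open>Here r a is (t - a)^(-1) u. Clearing denominators in a linear relation gives p(t) u = 0,
  hence p = 0 by \<open>poly_op_inj\<close>.\<close>

lemma resolvent_independent:
  assumes inj: "\<And>a v. t v = s a v \<Longrightarrow> v = 0"
    and r: "\<And>a. t (r a) - s a (r a) = u" and u: "u \<noteq> 0"
  shows "inj r" "independent (range r)"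
proof -
  show inj_r: "inj r"
  proof (rule injI)
    fix a b assume eq: "r a = r b"
    have "s a (r a) = t (r a) - u" using r[of a] by (simp add: algebra_simps)
    moreover have "s b (r a) = t (r a) - u" using r[of b] eq by (simp add: algebra_simps)
    moreover have "r a \<noteq> 0" using r[of a] u linearD(1)[OF t] by auto
    ultimately show "a = b" by (metis scale_cancel_right)
  qed
  show "independent (range r)"
    unfolding independent_explicit_finite_subsets
  proof (intro allI impI ballI)
    fix S c x assume S: "S \<subseteq> range r" "finite S" and c: "(\<Sum>v\<in>S. s (c v) v) = 0" and x: "x \<in> S"
    obtain L where L: "S = r ` L" "finite L"
      using S by (metis finite_subset_image)
    define p where "p = (\<Sum>a\<in>L. smult (c (r a)) (\<Prod>b\<in>L - {a}. [:- b, 1:]))"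
    define P where "P = (\<Prod>b\<in>L. [:- b, 1 :: complex:])"
    have "poly_op p u = (\<Sum>a\<in>L. s (c (r a)) (poly_op (\<Prod>b\<in>L - {a}. [:- b, 1:]) u))"
      by (simp add: p_def poly_op_sum poly_op_smult)
    also have "\<dots> = (\<Sum>a\<in>L. s (c (r a)) (poly_op P (r a)))"
    proof (rule sum.cong[OF refl])
      fix a assume "a \<in> L"
      then have "P = [:- a, 1:] * (\<Prod>b\<in>L - {a}. [:- b, 1:])"
        unfolding P_def using L(2) by (rule prod.remove[rotated])
      then show "s (c (r a)) (poly_op (\<Prod>b\<in>L - {a}. [:- b, 1:]) u) = s (c (r a)) (poly_op P (r a))"
        by (simp only: poly_op_linear_factor r)
    qed
    also have "\<dots> = poly_op P (\<Sum>a\<in>L. s (c (r a)) (r a))"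
    proof -
      interpret P: Vector_Spaces.linear s s "poly_op P" by (rule poly_op_linear)
      show ?thesis by (simp add: P.sum P.scale)
    qed
    also have "(\<Sum>a\<in>L. s (c (r a)) (r a)) = 0"
      using c unfolding L(1) by (subst (asm) sum.reindex) (use inj_r in \<open>auto simp: inj_on_def o_def\<close>)
    finally have "poly_op p u = 0" by (simp add: linearD[OF poly_op_linear])
    then have "p = 0" using poly_op_inj[of p u] inj u by blast
    obtain a where a: "a \<in> L" "x = r a" using x L by auto
    \<comment> \<open>As in Lagrange interpolation, evaluation at a kills every summand but its
      own.\<close>
    have "poly p a = (\<Sum>d\<in>L. c (r d) * (\<Prod>b\<in>L - {d}. a - b))"
      by (simp add: p_def poly_sum poly_prod)
    also have "\<dots> = (\<Sum>d\<in>L. if d = a then c (r a) * (\<Prod>b\<in>L - {a}. a - b) else 0)"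
    proof (rule sum.cong[OF refl])
      fix d assume "d \<in> L"
      show "c (r d) * (\<Prod>b\<in>L - {d}. a - b) = (if d = a then c (r a) * (\<Prod>b\<in>L - {a}. a - b) else 0)"
      proof (cases "d = a")
        case False
        then have "(\<Prod>b\<in>L - {d}. a - b) = 0" using a L(2) by (intro prod_zero) auto
        with False show ?thesis by simp
      qed simp
    qed
    also have "\<dots> = c (r a) * (\<Prod>b\<in>L - {a}. a - b)" using a L(2) by simp
    finally have "c (r a) * (\<Prod>b\<in>L - {a}. a - b) = 0" using \<open>p = 0\<close> by simp
    moreover have "(\<Prod>b\<in>L - {a}. a - b) \<noteq> 0" using L(2) by auto
    ultimately show "c x = 0" using a by simp
  qed
qed

end

text \<open>Kernel and image of t - c are submodules, so a non-scalar t makes every t - c bijective.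
  The resolvents of u are then uncountably many independent vectors.\<close>

lemma countable_schur:
  fixes s :: "complex \<Rightarrow> 'v \<Rightarrow> 'v::ab_group_add" and \<rho> :: "'b \<Rightarrow> 'v \<Rightarrow> 'v"
  assumes vs: "vector_space s" and lin: "\<And>a. Vector_Spaces.linear s s (\<rho> a)"
    and irr: "irreducible_action s \<rho>" and cb: "countable (UNIV :: 'b set)"
    and t: "Vector_Spaces.linear s s t" and comm: "\<And>a v. t (\<rho> a v) = \<rho> a (t v)"
  obtains c where "\<And>v. t v = s c v"
proof (rule ccontr)
  assume "\<not> thesis"
  then have nonscalar: "\<exists>v. t v \<noteq> s c v" for c using that by blast
  interpret endomorphism s t
    by (intro endomorphism.intro vs endomorphism_axioms.intro t)
  have irr': "W = {0} \<or> W = UNIV" if "subspace W" "\<And>a w. w \<in> W \<Longrightarrow> \<rho> a w \<in> W" for W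
    using conjunct2[OF irr[unfolded irreducible_action_def]] that by blast
  obtain u :: 'v where u: "u \<noteq> 0" using conjunct1[OF irr[unfolded irreducible_action_def]] by (rule exE)
  have inj: "v = 0" if "t v = s c v" for c v
  proof -
    have "{v. t v = s c v} = {0} \<or> {v. t v = s c v} = UNIV"
      by (rule irr')
         (auto intro!: subspaceI simp: linearD[OF t] linearD[OF lin] comm scale_right_distrib mult.commute)
    moreover have "{v. t v = s c v} \<noteq> UNIV" using nonscalar[of c] by auto
    ultimately show ?thesis using that by auto
  qed
  have "\<exists>v. t v - s c v = u" for c
  proof -
    have "range (\<lambda>v. t v - s c v) = {0} \<or> range (\<lambda>v. t v - s c v) = UNIV"
    proof (rule irr')
      have "Vector_Spaces.linear s s (\<lambda>v. t v - s c v)"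
        by (rule linearI[OF vs vs]) (auto simp: linearD[OF t] scale_right_distrib scale_right_diff_distrib mult.commute)
      then interpret h: Vector_Spaces.linear s s "\<lambda>v. t v - s c v" .
      show "subspace (range (\<lambda>v. t v - s c v))" by (rule h.subspace_image[OF subspace_UNIV])
      fix a w assume "w \<in> range (\<lambda>v. t v - s c v)"
      then obtain v where "w = t v - s c v" by blast
      then have "\<rho> a w = t (\<rho> a v) - s c (\<rho> a v)" by (simp add: linearD[OF lin] comm)
      then show "\<rho> a w \<in> range (\<lambda>v. t v - s c v)" by blast
    qed
    moreover have "t u - s c u \<noteq> 0" using inj[of u c] u by auto
    ultimately have "u \<in> range (\<lambda>v. t v - s c v)" by blast
    then show ?thesis by auto
  qed
  then obtain r where r: "\<And>c. t (r c) - s c (r c) = u" by metis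
  \<comment> \<open>Words in the generators applied to u: countably many, and they span because u
    generates the module.\<close>
  define B where "B = range (\<lambda>ws. foldr \<rho> ws u)"
  have "countable B"
  proof -
    have "countable (lists (UNIV :: 'b set))" using cb by (rule countable_lists)
    then have "countable (UNIV :: 'b list set)" by simp
    then show ?thesis unfolding B_def by (rule countable_image)
  qed
  moreover have "span B = UNIV"
  proof -
    have "span B = {0} \<or> span B = UNIV"
    proof (rule irr')
      fix a w assume "w \<in> span B"
      then show "\<rho> a w \<in> span B"
      proof (induction w rule: span_induct_alt)
        case base
        then show ?case by (simp add: linearD[OF lin] span_zero)
      next
        case (step c x y)
        then obtain ws where "x = foldr \<rho> ws u" by (auto simp: B_def)
        then have "\<rho> a x = foldr \<rho> (a # ws) u" by simp
        then have "\<rho> a x \<in> span B" unfolding B_def by (metis rangeI span_base)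
        with step show ?case by (simp add: linearD[OF lin] span_add span_scale)
      qed
    qed simp
    moreover have "u \<in> span B" unfolding B_def by (rule span_base) (auto intro: image_eqI[of _ _ "[]"])
    ultimately show ?thesis using u by auto
  qed
  ultimately have "countable (range r)"
    using resolvent_independent(2)[OF inj r u] by (rule countable_independent)
  then have "countable (UNIV :: complex set)"
    using resolvent_independent(1)[OF inj r u] by (rule countable_image_inj_on)
  then have "countable (range Re)" by (rule countable_image)
  moreover have "range Re = UNIV" by (metis surjI Re_complex_of_real)
  ultimately show False using uncountable_UNIV_real by simp
qed

lemma countable_atw: "countable (UNIV :: atw set)"
proof -
  have "(UNIV :: atw set) = range tw_S \<union> range tw_T \<union> range tw_G \<union> {tw_C}"
    by (auto simp: image_iff) (metis atw.exhaust)
  then show ?thesis by (metis countable_Un countable_image countable_insert countable_empty countableI_type)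
qed

section \<open>Irreducibility\<close>

context wakimoto_action
begin

lemma T_scalar:
  assumes "irreducible_action s \<rho>"
  obtains \<tau> where "\<And>n u. T n u = s (\<tau> n) u"
proof -
  have "\<exists>c. \<forall>u. T n u = s c u" for n
  proof (rule countable_schur[OF vector_space linear assms countable_atw linear[of "tw_T n"] T_commute[of n]])
    fix c assume "\<And>u. T n u = s c u"
    then show "\<exists>c. \<forall>u. T n u = s c u" by blast
  qed
  then have "\<forall>n. \<exists>c. \<forall>u. T n u = s c u" by blast
  then obtain \<tau> where "\<forall>n u. T n u = s (\<tau> n) u" by (rule choice[THEN exE])
  then show ?thesis using that by blast
qed

lemma tens_single_1: "tn u (Poly_Mapping.single m 1) = Poly_Mapping.single m u"
  by (simp add: tens_single[OF vector_space])

lemma lookup_tn: "Poly_Mapping.lookup (tn u f) m = s (Poly_Mapping.lookup f m) u"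
  by (rule lookup_tens[OF vector_space])

lemma id_beta_linear: "Vector_Spaces.linear pms pms (tensor_op s id (beta m))"
  by (rule op_linear[OF id_linear(1) beta_linear])

lemma id_beta_tens: "tensor_op s id (beta m) (tn u f) = tn u (beta m f)"
  by (simp add: op_tens[OF id_linear(1) beta_linear])

lemma lookup_id_beta:
  assumes "0 \<le> m"
  shows "Poly_Mapping.lookup (tensor_op s id (beta m) w) \<mu> =
    s (- (of_int m + 1 / 2) * of_nat (Suc (Poly_Mapping.lookup \<mu> (nat m))))
      (Poly_Mapping.lookup w (\<mu> + Poly_Mapping.single (nat m) 1))"
proof (induction w rule: tensor_induct)
  case (add x y)
  then show ?case by (simp only: linearD[OF id_beta_linear] lookup_add U.scale_right_distrib)
next
  case (tens u f)
  show ?case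
    unfolding id_beta_tens lookup_tn
    by (simp only: beta_nonneg[OF assms] lookup_fscale lookup_fock_deriv U.scale_scale mult.assoc)
qed

text \<open>Only the coefficient of \<open>Y_tw\<close> at index 1 has a vacuum component on 1, so
  each single G can be isolated.\<close>

lemma lookup_X_vacuum:
  "Poly_Mapping.lookup (X k (tn u 1)) 0 = s (- (2 * \<i>) * (- 1) ^ i) (G (k - 1) u)"
proof -
  have "Poly_Mapping.lookup (X k (tn u 1)) 0 = (\<Sum>l. Poly_Mapping.lookup (tn (G l u) (Y_tw i (k - l) 1)) 0)"
    unfolding X_tens
    by (rule Sum_any_additive[OF X_finite_tens, where h = "\<lambda>w. Poly_Mapping.lookup w 0"]) (simp_all add: lookup_add)
  also have "\<dots> = (\<Sum>l. if l = k - 1 then s (- (2 * \<i>) * (- 1) ^ i) (G l u) else 0)"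
    by (rule Sum_any.cong) (simp only: lookup_tn vac_Y_1, auto)
  finally show ?thesis by simp
qed

lemma irreducible_tensor:
  assumes irr: "irreducible_action s \<rho>"
  shows "irreducible_action pms (sl2t_action s \<rho> i)"
  unfolding irreducible_action_def
proof (intro conjI allI impI)
  obtain u where "u \<noteq> (0::'u)" using conjunct1[OF irr[unfolded irreducible_action_def]] by (rule exE)
  then have "Poly_Mapping.single (0 :: nat \<Rightarrow>\<^sub>0 nat) u \<noteq> 0"
    by (metis lookup_single_eq lookup_zero)
  then show "\<exists>v. v \<noteq> (0 :: (nat \<Rightarrow>\<^sub>0 nat) \<Rightarrow>\<^sub>0 'u)" by blast
next
  fix W :: "((nat \<Rightarrow>\<^sub>0 nat) \<Rightarrow>\<^sub>0 'u) set"
  assume W: "P.subspace W \<and> (\<forall>a. \<forall>w\<in>W. sl2t_action s \<rho> i a w \<in> W)"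
  then have sub: "P.subspace W" by blast
  have act: "sl2t_action s \<rho> i a w \<in> W" if "w \<in> W" for a w using W that by blast
  obtain \<tau> where \<tau>: "\<And>n u. T n u = s (\<tau> n) u" using T_scalar[OF irr] by blast
  have beta_W: "tensor_op s id (beta m) w \<in> W" if w: "w \<in> W" for m w
  proof -
    have "tensor_op s (T m) id w = pms (\<tau> m) w"
    proof (induction w rule: tensor_induct)
      case (add x y)
      then show ?case
        by (simp only: linearD[OF op_linear[OF linear id_linear(2)]] P.scale_right_distrib)
    next
      case (tens u f)
      show ?case unfolding op_tens[OF linear id_linear(2)] by (simp only: \<tau> tn_simps id_apply)
    qed
    \<comment> \<open>Once T is a scalar, H = -2 beta + 2 T can be solved for beta.\<close>
    then have "tensor_op s id (beta m) w = pms (- 1 / 2) (H m w - pms 2 (pms (\<tau> m) w))"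
      by (simp add: H_def P.scale_right_diff_distrib P.scale_right_distrib)
    moreover have "H m w \<in> W" using act[OF w, of "sl_h m"] by (simp only: action_simps)
    ultimately show ?thesis using w by (simp only: P.subspace_scale P.subspace_diff sub)
  qed
  have X_W: "X k w \<in> W" if w: "w \<in> W" for k w
  proof -
    have "x k w \<in> W"
    proof (cases "even k")
      case True
      then have "k = - 2 * (- (k div 2) - 1) - 2" by auto
      then show ?thesis using act[OF w, of "sl_xp (- (k div 2) - 1)"] by (simp only: action_simps)
    next
      case False
      then have "k = - 2 * (- (k div 2) - 2) - 3" by presburger
      then show ?thesis using act[OF w, of "sl_xm (- (k div 2) - 2)"] by (simp only: action_simps)
    qed
    then have "pms (complex_of_real (sqrt 2)) (pms (1 / 2) (x k w)) \<in> W" by (intro P.subspace_scale[OF sub])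
    moreover have "pms (complex_of_real (sqrt 2)) (pms (1 / 2) (x k w)) = X k w"
      by (simp add: x_def)
    ultimately show ?thesis by simp
  qed
  define U' where "U' = {u. tn u 1 \<in> W}"
  have subU: "U.subspace U'"
    unfolding U'_def
    by (rule U.subspaceI) (simp_all add: tn_simps P.subspace_0 P.subspace_add P.subspace_scale sub)
  have creation: "Poly_Mapping.single m u \<in> W" if "u \<in> U'" for m u
  proof (induction m rule: monomial_induct)
    case zero
    then show ?case using that by (simp add: U'_def flip: tens_single_1)
  next
    case (add m j)
    have "Poly_Mapping.single (m + Poly_Mapping.single j (Suc 0)) u =
        tensor_op s id (beta (- int j - 1)) (Poly_Mapping.single m u)"
      by (simp add: id_beta_tens beta_neg fock_var_def mult_single add.commute flip: tens_single_1)
    then show ?case using beta_W[OF add] by simp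
  qed
  \<comment> \<open>Induction on a degree bound: an annihilation mode lowers the degree and turns a
    coefficient at a nonconstant monomial into a nonzero multiple of one in lower degree.\<close>
  have coeffs: "Poly_Mapping.lookup w \<mu> \<in> U'"
    if "w \<in> W" "\<And>\<mu>. Poly_Mapping.lookup w \<mu> \<noteq> 0 \<Longrightarrow> mdeg \<mu> \<le> d" for w d \<mu>
    using that
  proof (induction d arbitrary: w \<mu>)
    \<comment> \<open>Annihilation modes cannot reach the constant term; it is isolated by
      subtracting the other terms, which lie in W by \<open>creation\<close>.\<close>
    have vacuum: "Poly_Mapping.lookup w 0 \<in> U'"
      if w: "w \<in> W" and nz: "\<And>\<mu>. \<mu> \<noteq> 0 \<Longrightarrow> Poly_Mapping.lookup w \<mu> \<in> U'" for w
    proof -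
      have "w - (\<Sum>\<mu>\<in>Poly_Mapping.keys w - {0}. Poly_Mapping.single \<mu> (Poly_Mapping.lookup w \<mu>)) \<in> W"
        by (intro P.subspace_diff[OF sub] P.subspace_sum[OF sub] creation nz w) auto
      moreover have "w - (\<Sum>\<mu>\<in>Poly_Mapping.keys w - {0}. Poly_Mapping.single \<mu> (Poly_Mapping.lookup w \<mu>)) =
          Poly_Mapping.single 0 (Poly_Mapping.lookup w 0)"
        by (rule poly_mapping_eqI)
           (auto simp: lookup_minus lookup_sum lookup_single when_def in_keys_iff)
      ultimately show ?thesis by (simp add: U'_def flip: tens_single_1)
    qed
    {
      case 0
      have "Poly_Mapping.lookup w \<nu> \<in> U'" if "\<nu> \<noteq> 0" for \<nu>
      proof -
        obtain \<nu>' j where "\<nu> = \<nu>' + Poly_Mapping.single j 1" using \<open>\<nu> \<noteq> 0\<close> monomial_cases[of \<nu>] by blast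
        then have "\<not> mdeg \<nu> \<le> 0" by simp
        then have "Poly_Mapping.lookup w \<nu> = 0" using 0(2) by blast
        then show ?thesis by (simp add: U.subspace_0 subU)
      qed
      then show ?case using vacuum[OF 0(1)] by (cases "\<mu> = 0") auto
    next
      case (Suc d)
      have "Poly_Mapping.lookup w \<nu> \<in> U'" if "\<nu> \<noteq> 0" for \<nu>
      proof -
        obtain \<nu>' j where \<nu>: "\<nu> = \<nu>' + Poly_Mapping.single j 1" using \<open>\<nu> \<noteq> 0\<close> monomial_cases[of \<nu>] by blast
        let ?w = "tensor_op s id (beta (int j)) w"
        let ?c = "\<lambda>\<nu>'. - (of_int (int j) + 1 / 2) * of_nat (Suc (Poly_Mapping.lookup \<nu>' j)) :: complex"
        have look: "Poly_Mapping.lookup ?w \<kappa> = s (?c \<kappa>) (Poly_Mapping.lookup w (\<kappa> + Poly_Mapping.single j 1))" for \<kappa>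
          using lookup_id_beta[of "int j" w \<kappa>] by simp
        have in_U': "Poly_Mapping.lookup ?w \<nu>' \<in> U'"
        proof (rule Suc.IH[OF beta_W[OF Suc.prems(1)]])
          fix \<kappa> assume "Poly_Mapping.lookup ?w \<kappa> \<noteq> 0"
          then have "Poly_Mapping.lookup w (\<kappa> + Poly_Mapping.single j 1) \<noteq> 0" by (auto simp: look)
          then show "mdeg \<kappa> \<le> d" using Suc.prems(2) by force
        qed
        have "?c \<nu>' \<noteq> 0"
        proof -
          have "of_int (int j) + 1 / 2 \<noteq> (0 :: complex)" by (simp add: complex_eq_iff)
          then show ?thesis
            by (simp only: mult_eq_0_iff neg_equal_0_iff_equal of_nat_eq_0_iff nat.distinct simp_thms)
        qed
        have "s (1 / ?c \<nu>') (s (?c \<nu>') (Poly_Mapping.lookup w \<nu>)) \<in> U'"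
          using U.subspace_scale[OF subU in_U', of "1 / ?c \<nu>'"] by (simp only: look \<nu>)
        moreover have "1 / ?c \<nu>' * ?c \<nu>' = 1"
          by (simp only: times_divide_eq_left mult_1 divide_self[OF \<open>?c \<nu>' \<noteq> 0\<close>])
        ultimately show ?thesis by (simp only: U.scale_scale U.scale_one)
      qed
      then show ?case using vacuum[OF Suc.prems(1)] by (cases "\<mu> = 0") auto
    }
  qed
  have coeff: "Poly_Mapping.lookup w \<mu> \<in> U'" if "w \<in> W" for w \<mu>
  proof (rule coeffs[OF that])
    fix \<mu> assume "Poly_Mapping.lookup w \<mu> \<noteq> 0"
    then show "mdeg \<mu> \<le> Max (mdeg ` Poly_Mapping.keys w)"
      by (intro Max_ge) (auto simp: in_keys_iff)
  qed
  have G_U': "G p u \<in> U'" if "u \<in> U'" for p u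
  proof -
    let ?c = "- (2 * \<i>) * (- 1) ^ i"
    have "Poly_Mapping.lookup (X (p + 1) (tn u 1)) 0 \<in> U'"
      using that by (intro coeff X_W) (simp add: U'_def)
    then have cG: "s ?c (G p u) \<in> U'" by (simp only: lookup_X_vacuum add_diff_cancel_right')
    have "1 / ?c * ?c = 1" by simp
    then show ?thesis
      using U.subspace_scale[OF subU cG, of "1 / ?c"] by (simp only: U.scale_scale U.scale_one)
  qed
  have "\<rho> a u \<in> U'" if u: "u \<in> U'" for a u
  proof (cases a)
    case (tw_S n)
    \<comment> \<open>S(n) is recovered from an anticommutator, with even first index 0 to make the
      sign positive. The scalar -2 is -((0 + 3)^2 - 1)/4.\<close>
    have "G 0 (G (- 2 * n - 6) u) + G (- 2 * n - 6) (G 0 u) = s 2 (\<rho> (tw_S n) u) +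
        (if n = 0 then s (- 2) u else 0)"
      using G_anticommutator[of 0 "- 2 * n - 6" u] by (simp add: power2_eq_square)
    then have "\<rho> (tw_S n) u = s (1 / 2) (G 0 (G (- 2 * n - 6) u) + G (- 2 * n - 6) (G 0 u) - (if n = 0 then s (- 2) u else 0))"
      by simp
    then show ?thesis unfolding tw_S
      by (simp only:) (auto intro!: U.subspace_scale U.subspace_add U.subspace_diff U.subspace_0 subU G_U' u)
  next
    case (tw_T n)
    then show ?thesis by (simp add: \<tau> U.subspace_scale subU u)
  next
    case (tw_G n)
    then show ?thesis using G_U'[OF u, of "- n - 3"] by (simp add: G_def)
  next
    case tw_C
    then show ?thesis by (simp only: C U.subspace_scale subU u)
  qed
  with subU have "U' = {0} \<or> U' = UNIV"
    using conjunct2[OF irr[unfolded irreducible_action_def]] by blast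
  then show "W = {0} \<or> W = UNIV"
  proof
    assume "U' = {0}"
    then have "w = 0" if "w \<in> W" for w
      using coeff[OF that] by (intro poly_mapping_eqI) simp
    then show ?thesis using P.subspace_0[OF sub] by blast
  next
    assume "U' = UNIV"
    then have "w \<in> W" for w
      using P.subspace_sum[OF sub, of "Poly_Mapping.keys w" "\<lambda>k. Poly_Mapping.single k (Poly_Mapping.lookup w k)"]
      by (simp add: sum_single_keys[OF vector_space] creation)
    then show ?thesis by blast
  qed
qed

end

theorem theorem1p1:
  fixes s :: "complex \<Rightarrow> 'u \<Rightarrow> 'u::ab_group_add"
    and \<rho> :: "atw \<Rightarrow> 'u \<Rightarrow> 'u"
    and i :: nat
  assumes "lie_super_module atw_odd atw_bracket s \<rho>"
    and "atw_restricted \<rho>"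
    and "irreducible_action s \<rho>"
    and "\<forall>u. \<rho> tw_C u = s (-3) u"
    and "i \<in> {1, 2}"
  shows "lie_module sl2t_bracket (pm_scale s) (sl2t_action s \<rho> i) \<and>
    irreducible_action (pm_scale s) (sl2t_action s \<rho> i) \<and>
    (\<forall>w. sl2t_action s \<rho> i sl_K w = pm_scale s (-2) w)"
proof -
  interpret wakimoto_action s \<rho> i
    by unfold_locales (use assms in auto)
  show ?thesis using action_lie_module irreducible_tensor[OF assms(3)] by simp
qed

end
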